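(* Let $\mathcal E$ be a Hilbert space, let $\mathcal Q\subseteq H_{\mathcal E}(\mathcal K)$ be a right shift co-invariant closed subspace, and let $X\in\mathcal B(\mathcal Q)$ with $\|X\|\le 1$. If $$X\big(P_{\mathcal Q}(\tilde M_{z_i}\otimes I_{\mathcal E})|_{\mathcal Q}\big)=\big(P_{\mathcal Q}(\tilde M_{z_i}\otimes I_{\mathcal E})|_{\mathcal Q}\big)X\qquad(i=1,\dots,d),$$ then there exists a left multiplier $\Phi\in \mathrm{Mult}_L(H_{\mathcal E}(\mathcal K))$ such that $$\|M_\Phi\|=\|X\|\quad\text{and}\quad X=P_{\mathcal Q}M_\Phi|_{\mathcal Q}.$$
   Context: Hilbert spaces are complex, inner products linear in the first argument; $d\in\mathbb N$ is fixed. $\mathbb M^d=\bigsqcup_{n\ge1}M_n(\mathbb C)^d$ and $\mathfrak B_d=\{X=(X_1,\dots,X_d)\in\mathbb M^d:\|\sum_jX_jX_j^*\|<1\}$, with $\mathfrak B_d(n)=\mathfrak B_d\cap M_n(\mathbb C)^d$. $\mathbb W_d$ is the free monoid on $\{1,\dots,d\}$ (words, with concatenation $\alpha\cdot\beta$); for $\alpha=\alpha_1\cdots\alpha_p$, $Z^\alpha=Z_{\alpha_1}\cdots Z_{\alpha_p}$, and $Z^\emptyset=I$. An nc function on $\mathfrak B_d$ with values in a vector space $\mathcal V$ is a map $f:\mathfrak B_d\to\bigsqcup_nM_n(\mathcal V)$ that is graded ($f(X)\in M_n(\mathcal V)$ for $X\in\mathfrak B_d(n)$), respects direct sums ($f(X\oplus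 Y)=f(X)\oplus f(Y)$) and similarities ($f(S^{-1}XS)=S^{-1}f(X)S$ for $X\in\mathfrak B_d(n)$, $S\in M_n(\mathbb C)$ invertible with $S^{-1}XS\in\mathfrak B_d(n)$). $M_n(\mathcal B(\mathcal E,\mathcal F))$ is identified with $\mathcal B(\mathbb C^n\otimes\mathcal E,\mathbb C^n\otimes\mathcal F)$. The $\mathcal E$-valued nc Drury–Arveson space $H_{\mathcal E}(\mathcal K)$ is the Hilbert space of nc functions $f(Z)=\sum_{\alpha\in\mathbb W_d}Z^\alpha\otimes f_\alpha$, $f_\alpha\in\mathcal E$, $\sum\|f_\alpha\|^2<\infty$, on $\mathfrak B_d$, where $f(Z):\mathbb C^n\to\mathbb C^n\otimes\mathcal E$, $f(Z)v=\sum_\alpha Z^\alpha v\otimes f_\alpha$ for $Z\in\mathfrak B_d(n)$, with $\langle f,g\rangle=\sum_\alpha\langle f_\alpha,g_\alpha\rangle$. (It is the nc reproducing kernel Hilbert space of $\mathcal K\otimes I_{\mathcal E}$, $\mathcal K(Z,W)(P)=\sum_\alpha Z^\alpha P(W^\alpha)^*$.) Right shifts: $(\tilde M_{z_i}\otimes I_{\mathcal E})f(Z)=\sum_\alpha Z^{\alpha\cdot i}\otimes f_\alpha$. A subspace $\mathcal Q$ is right shift co-invariant if $(\tilde M_{z_i}\otimes I_{\mathcal E})^*\mathcal Q\subseteq\mathcal Q$ for $i=1,\dots,d$. $P_{\mathcal Q}$ is the orthogonal projection onto $\mathcal Q$. A left multiplier $\Phi\in\mathrm{Mult}_L(H_{\mathcal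 E}(\mathcal K))$ is an nc function $\Phi$ on $\mathfrak B_d$ with values in $\mathcal B(\mathcal E)$ such that $\Phi f\in H_{\mathcal E}(\mathcal K)$ for all $f\in H_{\mathcal E}(\mathcal K)$, where $(\Phi f)(W)=\Phi(W)f(W)$; $M_\Phi f=\Phi f$ is the corresponding (automatically bounded) operator. *)

theory Defs
  imports
    "Jordan_Normal_Form.Schur_Decomposition"
    "HOL-Analysis.Infinite_Sum"
    "HOL-Analysis.L2_Norm"
    "HOL-Analysis.Operator_Norm"
    "HOL-Library.FuncSet"
begin

section \<open>Complex Hilbert spaces\<close>

class complex_vector = real_vector +
  fixes scaleC :: "complex \<Rightarrow> 'a \<Rightarrow> 'a"  (infixr \<open>*\<^sub>C\<close> 75)
  assumes scaleC_add_right: "a *\<^sub>C (x + y) = a *\<^sub>C x + a *\<^sub>C y"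
    and scaleC_add_left: "(a + b) *\<^sub>C x = a *\<^sub>C x + b *\<^sub>C x"
    and scaleC_scaleC: "a *\<^sub>C (b *\<^sub>C x) = (a * b) *\<^sub>C x"
    and scaleR_scaleC: "r *\<^sub>R x = of_real r *\<^sub>C x"

class complex_normed_vector = complex_vector + real_normed_vector +
  assumes norm_scaleC: "norm (a *\<^sub>C x) = cmod a * norm x"

class chilbert_space = complex_normed_vector + banach +
  fixes cinner :: "'a \<Rightarrow> 'a \<Rightarrow> complex"
  assumes cinner_add_left: "cinner (x + y) z = cinner x z + cinner y z"
    and cinner_scaleC_left: "cinner (a *\<^sub>C x) y = a * cinner x y"
    and cinner_commute: "cinner x y = cnj (cinner y x)"
    and norm_eq_sqrt_cinner: "norm x = sqrt (Re (cinner x x))"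

lemma scaleC_one: "1 *\<^sub>C x = (x::'a::complex_vector)"
  using scaleR_scaleC[of 1 x] by simp

global_interpretation complex_vector: vector_space "scaleC :: complex \<Rightarrow> 'a \<Rightarrow> 'a::complex_vector"
  by unfold_locales (auto simp: scaleC_add_right scaleC_add_left scaleC_scaleC scaleC_one)

instantiation complex :: chilbert_space
begin
definition scaleC_complex :: "complex \<Rightarrow> complex \<Rightarrow> complex" where "scaleC_complex a x = a * x"
definition cinner_complex :: "complex \<Rightarrow> complex \<Rightarrow> complex" where "cinner_complex x y = x * cnj y"
instance
proof
  fix x :: complex
  show "norm x = sqrt (Re (cinner x x))"
    by (simp add: cinner_complex_def cmod_def power2_eq_square)
qed (auto simp: scaleC_complex_def cinner_complex_def algebra_simps scaleR_conv_of_real norm_mult)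
end

definition bounded_clinear :: "('a::complex_normed_vector \<Rightarrow> 'b::complex_normed_vector) \<Rightarrow> bool"
  where "bounded_clinear f \<longleftrightarrow> bounded_linear f \<and> (\<forall>c x. f (c *\<^sub>C x) = c *\<^sub>C f x)"

typedef (overloaded) ('a, 'b) cblin = "{f :: 'a::complex_normed_vector \<Rightarrow> 'b::complex_normed_vector. bounded_clinear f}"
  morphisms cblin_apply Cblin
  by (rule exI[of _ "\<lambda>_. 0"]) (simp add: bounded_clinear_def)

setup_lifting type_definition_cblin

lemma bounded_linear_scaleC: "bounded_linear (\<lambda>x::'a::complex_normed_vector. c *\<^sub>C x)"
  by (rule bounded_linear_intro[where K = "cmod c"])
     (simp_all add: scaleC_add_right scaleR_scaleC scaleC_scaleC norm_scaleC mult.commute)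

instantiation cblin :: (complex_normed_vector, complex_normed_vector) complex_vector
begin
lift_definition zero_cblin :: "('a, 'b) cblin" is "\<lambda>_. 0" by (simp add: bounded_clinear_def)
lift_definition plus_cblin :: "('a, 'b) cblin \<Rightarrow> ('a, 'b) cblin \<Rightarrow> ('a, 'b) cblin"
  is "\<lambda>f g x. f x + g x" by (simp add: bounded_clinear_def bounded_linear_add scaleC_add_right)
lift_definition uminus_cblin :: "('a, 'b) cblin \<Rightarrow> ('a, 'b) cblin"
  is "\<lambda>f x. - f x" by (simp add: bounded_clinear_def bounded_linear_minus)
lift_definition minus_cblin :: "('a, 'b) cblin \<Rightarrow> ('a, 'b) cblin \<Rightarrow> ('a, 'b) cblin"
  is "\<lambda>f g x. f x - g x"
  by (simp add: bounded_clinear_def bounded_linear_sub complex_vector.scale_right_diff_distrib)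
lift_definition scaleC_cblin :: "complex \<Rightarrow> ('a, 'b) cblin \<Rightarrow> ('a, 'b) cblin"
  is "\<lambda>c f x. c *\<^sub>C f x"
  by (auto simp: bounded_clinear_def scaleC_scaleC mult.commute
      intro: bounded_linear_compose[OF bounded_linear_scaleC])
lift_definition scaleR_cblin :: "real \<Rightarrow> ('a, 'b) cblin \<Rightarrow> ('a, 'b) cblin"
  is "\<lambda>c f x. c *\<^sub>R f x"
  by (auto simp: bounded_clinear_def scaleC_scaleC scaleR_scaleC mult.commute
      intro: bounded_linear_compose[OF bounded_linear_scaleC])
instance
  by intro_classes
    (transfer; auto simp: scaleC_add_right scaleC_add_left scaleR_scaleC scaleC_scaleC scaleC_one algebra_simps)+
end

section \<open>The nc unit ball and nc functions\<close>

text \<open>The matrices are those of the Jordan normal form entry: the size of a matrix is part of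
its value, and a tuple of matrices has type \<^typ>\<open>'d \<Rightarrow> complex mat\<close> with the finite type
\<^typ>\<open>'d\<close> in the role of the index set of the variables.\<close>

definition nc_tuples :: "nat \<Rightarrow> ('d \<Rightarrow> complex mat) set"
  where "nc_tuples n = {X. \<forall>j. X j \<in> carrier_mat n n}"

definition nc_dim :: "('d \<Rightarrow> complex mat) \<Rightarrow> nat"
  where "nc_dim X = (THE n. X \<in> nc_tuples n)"

definition vec_l2norm :: "complex vec \<Rightarrow> real"
  where "vec_l2norm v = L2_set (\<lambda>i. cmod (vec_index v i)) {..<dim_vec v}"

definition mat_opnorm :: "complex mat \<Rightarrow> real"
  where "mat_opnorm A =
    (SUP v \<in> {v \<in> carrier_vec (dim_col A). vec_l2norm v \<le> 1}. vec_l2norm (A *\<^sub>v v))"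

text \<open>\<open>row_gram X\<close> is the matrix $\sum_j X_j X_j^*$.\<close>

definition row_gram :: "('d::finite \<Rightarrow> complex mat) \<Rightarrow> complex mat"
  where "row_gram X = Matrix.mat (nc_dim X) (nc_dim X)
    (\<lambda>(k, l). \<Sum>j\<in>UNIV. (X j * mat_adjoint (X j)) $$ (k, l))"

definition nc_ball_at :: "nat \<Rightarrow> ('d::finite \<Rightarrow> complex mat) set"
  where "nc_ball_at n = {X \<in> nc_tuples n. mat_opnorm (row_gram X) < 1}"

definition nc_ball :: "('d::finite \<Rightarrow> complex mat) set"
  where "nc_ball = (\<Union>n\<in>{1..}. nc_ball_at n)"

definition mat_dsum :: "'a::zero mat \<Rightarrow> 'a mat \<Rightarrow> 'a mat"
  where "mat_dsum A B =
    four_block_mat A (0\<^sub>m (dim_row A) (dim_col B)) (0\<^sub>m (dim_row B) (dim_col A)) B"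

text \<open>Products of a scalar matrix with a matrix over a complex vector space.\<close>

definition scalar_mat_mult :: "complex mat \<Rightarrow> 'v::complex_vector mat \<Rightarrow> 'v mat"
  where "scalar_mat_mult A M = Matrix.mat (dim_row A) (dim_col M)
    (\<lambda>(i, j). \<Sum>k<dim_row M. A $$ (i, k) *\<^sub>C M $$ (k, j))"

definition mat_scalar_mult :: "'v::complex_vector mat \<Rightarrow> complex mat \<Rightarrow> 'v mat"
  where "mat_scalar_mult M A = Matrix.mat (dim_row M) (dim_col A)
    (\<lambda>(i, j). \<Sum>k<dim_row A. A $$ (k, j) *\<^sub>C M $$ (i, k))"

text \<open>In the last clause \<open>T\<close> is the inverse of \<open>S\<close>.\<close>

definition nc_function :: "(('d::finite \<Rightarrow> complex mat) \<Rightarrow> 'v::complex_vector mat) \<Rightarrow> bool"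
  where "nc_function f \<longleftrightarrow>
    f \<in> extensional nc_ball \<and>
    (\<forall>n\<ge>1. \<forall>X\<in>nc_ball_at n. f X \<in> carrier_mat n n) \<and>
    (\<forall>X\<in>nc_ball. \<forall>Y\<in>nc_ball. f (\<lambda>j. mat_dsum (X j) (Y j)) = mat_dsum (f X) (f Y)) \<and>
    (\<forall>n\<ge>1. \<forall>X\<in>nc_ball_at n. \<forall>S\<in>carrier_mat n n. \<forall>T\<in>carrier_mat n n.
       S * T = 1\<^sub>m n \<longrightarrow> T * S = 1\<^sub>m n \<longrightarrow> (\<lambda>j. T * X j * S) \<in> nc_ball_at n \<longrightarrow>
       f (\<lambda>j. T * X j * S) = scalar_mat_mult T (mat_scalar_mult (f X) S))"

fun nc_word :: "('d \<Rightarrow> complex mat) \<Rightarrow> 'd list \<Rightarrow> complex mat"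
  where "nc_word Z [] = 1\<^sub>m (nc_dim Z)"
  | "nc_word Z (j # \<alpha>) = Z j * nc_word Z \<alpha>"

definition square_summable :: "('i \<Rightarrow> 'e::real_normed_vector) \<Rightarrow> bool"
  where "square_summable c \<longleftrightarrow> (\<lambda>\<alpha>. (norm (c \<alpha>))\<^sup>2) summable_on UNIV"

text \<open>The function $Z \mapsto \sum_\alpha Z^\alpha \otimes c_\alpha$; the series is taken entrywise.\<close>

definition nc_series :: "('d::finite list \<Rightarrow> 'e::complex_normed_vector) \<Rightarrow> ('d \<Rightarrow> complex mat) \<Rightarrow> 'e mat"
  where "nc_series c = (\<lambda>Z\<in>nc_ball. Matrix.mat (nc_dim Z) (nc_dim Z)
    (\<lambda>(k, l). \<Sum>\<^sub>\<infinity>\<alpha>. nc_word Z \<alpha> $$ (k, l) *\<^sub>C c \<alpha>))"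

section \<open>Convergence of the series and uniqueness of the coefficients\<close>

lemma cinner_add_right: "cinner x (y + z) = cinner x y + cinner x (z::'a::chilbert_space)"
  by (metis cinner_add_left cinner_commute complex_cnj_add)

lemma cinner_scaleC_right: "cinner x (a *\<^sub>C y) = cnj a * cinner x (y::'a::chilbert_space)"
  by (metis cinner_scaleC_left cinner_commute complex_cnj_mult)

lemma cinner_self: "cinner x x = complex_of_real ((norm (x::'a::chilbert_space))\<^sup>2)"
proof -
  have "Im (cinner x x) = 0"
    using cinner_commute[of x x] by (metis cnj.simps(2) neg_equal_zero)
  moreover have "Re (cinner x x) \<ge> 0"
    using norm_eq_sqrt_cinner[of x] norm_ge_zero[of x] by (metis real_sqrt_ge_0_iff)
  ultimately show ?thesis
    using norm_eq_sqrt_cinner[of x] by (simp add: complex_eq_iff)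
qed

lemma cinner_zero_left [simp]: "cinner 0 (x::'a::chilbert_space) = 0"
  using cinner_add_left[of 0 0 x] by simp

lemma cinner_zero_right [simp]: "cinner (x::'a::chilbert_space) 0 = 0"
  using cinner_add_right[of x 0 0] by simp

lemma cinner_Cauchy_Schwarz: "cmod (cinner x y) \<le> norm x * norm (y::'a::chilbert_space)"
proof (cases "y = 0")
  case False
  define c where "c = - (cinner x y / cinner y y)"
  have yy: "cinner y y \<noteq> 0" using False by (simp add: cinner_self)
  have "cinner (x + c *\<^sub>C y) (x + c *\<^sub>C y)
      = cinner x x + cnj c * cinner x y + c * cinner y x + c * cnj c * cinner y y"
    by (simp add: cinner_add_left cinner_add_right cinner_scaleC_left cinner_scaleC_right algebra_simps)
  also have "c * cinner y x = c * cnj (cinner x y)" by (metis cinner_commute)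
  also have "c * cnj c * cinner y y = - (cnj c * cinner x y)"
    using yy by (simp add: c_def)
  finally have "cinner (x + c *\<^sub>C y) (x + c *\<^sub>C y) = cinner x x + c * cnj (cinner x y)" by simp
  also have "c * cnj (cinner x y) = - complex_of_real ((cmod (cinner x y))\<^sup>2 / (norm y)\<^sup>2)"
    by (simp add: c_def cinner_self complex_norm_square[symmetric])
  finally have "complex_of_real ((norm (x + c *\<^sub>C y))\<^sup>2)
      = complex_of_real ((norm x)\<^sup>2 - (cmod (cinner x y))\<^sup>2 / (norm y)\<^sup>2)"
    by (simp add: cinner_self)
  then have "(norm (x + c *\<^sub>C y))\<^sup>2 = (norm x)\<^sup>2 - (cmod (cinner x y))\<^sup>2 / (norm y)\<^sup>2"
    using of_real_eq_iff by blast
  then have "(cmod (cinner x y))\<^sup>2 / (norm y)\<^sup>2 \<le> (norm x)\<^sup>2"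
    by (metis diff_ge_0_iff_ge zero_le_power2)
  then have "(cmod (cinner x y))\<^sup>2 \<le> (norm x * norm y)\<^sup>2"
    using False by (simp add: divide_le_eq power_mult_distrib)
  then show ?thesis by (meson mult_nonneg_nonneg norm_ge_zero power2_le_imp_le)
qed simp

lemma nc_dim_eq: "X \<in> nc_tuples n \<Longrightarrow> nc_dim X = n"
  unfolding nc_dim_def nc_tuples_def by (rule the_equality) (blast, metis (mono_tags, lifting) carrier_matD(1) mem_Collect_eq)

lemma nc_ballE:
  assumes "Z \<in> nc_ball"
  obtains n where "n \<ge> 1" "Z \<in> nc_ball_at n" "Z \<in> nc_tuples n" "nc_dim Z = n"
  using assms nc_dim_eq unfolding nc_ball_def nc_ball_at_def by auto

lemma nc_ball_at_ball: "n \<ge> 1 \<Longrightarrow> Z \<in> nc_ball_at n \<Longrightarrow> Z \<in> nc_ball"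
  unfolding nc_ball_def by auto

lemma nc_ball_at_dim: "Z \<in> nc_ball_at n \<Longrightarrow> nc_dim Z = n"
  using nc_dim_eq unfolding nc_ball_at_def by auto

lemma nc_word_carrier: "Z \<in> nc_tuples n \<Longrightarrow> nc_word Z \<alpha> \<in> carrier_mat n n"
  by (induction \<alpha>) (auto simp: nc_tuples_def nc_dim_eq intro!: mult_carrier_mat)

lemma mat_mult_index:
  assumes "A \<in> carrier_mat n m" "B \<in> carrier_mat m p" "i < n" "j < p"
  shows "(A * B) $$ (i, j) = (\<Sum>k<m. A $$ (i, k) * B $$ (k, j))"
  using assms by (simp add: scalar_prod_def lessThan_atLeast0)

lemma nc_word_Cons_index:
  assumes "Z \<in> nc_tuples n" "k < n" "l < n"
  shows "nc_word Z (j # \<alpha>) $$ (k, l) = (\<Sum>m<n. Z j $$ (k, m) * nc_word Z \<alpha> $$ (m, l))"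
  unfolding nc_word.simps
  using assms nc_word_carrier[OF assms(1)]
  by (intro mat_mult_index[where n = n and p = n]) (auto simp: nc_tuples_def)

lemma vec_l2norm_mult_le:
  assumes A: "A \<in> carrier_mat n m" and v: "v \<in> carrier_vec m"
  shows "vec_l2norm (A *\<^sub>v v) \<le> mat_opnorm A * vec_l2norm v"
proof -
  let ?S = "{v \<in> carrier_vec (dim_col A). vec_l2norm v \<le> 1}"
  have idx: "vec_index (A *\<^sub>v w) i = (\<Sum>k<m. A $$ (i, k) * vec_index w k)"
    if "w \<in> carrier_vec m" "i < n" for w i
    using that A by (simp add: scalar_prod_def lessThan_atLeast0)
  have bdd: "bdd_above ((\<lambda>v. vec_l2norm (A *\<^sub>v v)) ` ?S)"
  proof (rule bdd_aboveI2[where M = "\<Sum>i<n. \<Sum>k<m. cmod (A $$ (i, k))"])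
    fix w assume w: "w \<in> ?S"
    then have wm: "w \<in> carrier_vec m" using A by auto
    have le1: "cmod (vec_index w k) \<le> 1" if "k < m" for k
      using member_le_L2_set[of "{..<m}" k "\<lambda>i. cmod (vec_index w i)"] that w wm
      by (auto simp: vec_l2norm_def)
    have "vec_l2norm (A *\<^sub>v w) = L2_set (\<lambda>i. cmod (\<Sum>k<m. A $$ (i, k) * vec_index w k)) {..<n}"
      unfolding vec_l2norm_def using A idx[OF wm] by (intro L2_set_cong) auto
    also have "\<dots> \<le> (\<Sum>i<n. cmod (\<Sum>k<m. A $$ (i, k) * vec_index w k))"
      by (rule L2_set_le_sum) auto
    also have "\<dots> \<le> (\<Sum>i<n. \<Sum>k<m. cmod (A $$ (i, k)))"
    proof (intro sum_mono order.trans[OF norm_sum])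
      fix i k assume "k \<in> {..<m}"
      then show "cmod (A $$ (i, k) * vec_index w k) \<le> cmod (A $$ (i, k))"
        using le1[of k] by (simp add: norm_mult mult_left_le)
    qed
    finally show "vec_l2norm (A *\<^sub>v w) \<le> (\<Sum>i<n. \<Sum>k<m. cmod (A $$ (i, k)))" .
  qed
  have scale: "vec_l2norm (c \<cdot>\<^sub>v w) = cmod c * vec_l2norm w" for c w
    unfolding vec_l2norm_def L2_set_right_distrib[OF norm_ge_zero] by (intro L2_set_cong) (auto simp: norm_mult)
  have l2ge: "vec_l2norm w \<ge> 0" for w unfolding vec_l2norm_def by simp
  show ?thesis
  proof (cases "vec_l2norm v = 0")
    case True
    then have "\<forall>k<m. vec_index v k = 0"
      using v unfolding vec_l2norm_def by (subst (asm) L2_set_eq_0_iff) auto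
    then have "vec_l2norm (A *\<^sub>v v) = 0"
      using A idx[OF v] unfolding vec_l2norm_def by (subst L2_set_eq_0_iff) auto
    then show ?thesis using True by simp
  next
    case False
    define c where "c = complex_of_real (1 / vec_l2norm v)"
    have pos: "vec_l2norm v > 0" using False l2ge[of v] by simp
    have "vec_l2norm (c \<cdot>\<^sub>v v) = 1" using pos unfolding scale c_def by (simp add: norm_divide)
    then have "c \<cdot>\<^sub>v v \<in> ?S" using v A by auto
    then have "vec_l2norm (A *\<^sub>v (c \<cdot>\<^sub>v v)) \<le> mat_opnorm A"
      unfolding mat_opnorm_def by (intro cSUP_upper bdd)
    moreover have "A *\<^sub>v (c \<cdot>\<^sub>v v) = c \<cdot>\<^sub>v (A *\<^sub>v v)"
      using A v by (metis mult_mat_vec)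
    ultimately have "vec_l2norm (A *\<^sub>v v) / vec_l2norm v \<le> mat_opnorm A"
      using pos by (simp add: scale c_def norm_divide)
    then show ?thesis using pos by (simp add: divide_le_eq)
  qed
qed

lemma row_gram_index:
  assumes X: "X \<in> nc_tuples n" and "k < n" "l < n"
  shows "row_gram X $$ (k, l) = (\<Sum>j\<in>UNIV. \<Sum>m<n. X j $$ (k, m) * cnj (X j $$ (l, m)))"
proof -
  have Xj: "X j \<in> carrier_mat n n" for j using X by (auto simp: nc_tuples_def)
  have adj: "mat_adjoint (X j) \<in> carrier_mat n n" for j
    using Xj[of j] unfolding mat_adjoint_def by auto
  have entry: "mat_adjoint (X j) $$ (m, l) = cnj (X j $$ (l, m))" if "m < n" for m j
    using Xj[of j] that assms(3) unfolding mat_adjoint_def by (auto simp: mat_of_rows_def)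
  show ?thesis
    using assms nc_dim_eq[OF X]
    by (auto simp: row_gram_def mat_mult_index[OF Xj adj] entry intro!: sum.cong)
qed

definition row_sq :: "nat \<Rightarrow> (nat \<Rightarrow> complex) \<Rightarrow> real"
  where "row_sq n x = (\<Sum>k<n. (cmod (x k))\<^sup>2)"

lemma ball_row_bound:
  assumes Z: "Z \<in> nc_ball_at n"
  shows "(\<Sum>j\<in>UNIV. row_sq n (\<lambda>l. \<Sum>k<n. x k * Z j $$ (k, l)))
    \<le> mat_opnorm (row_gram Z) * row_sq n x"
proof -
  have Zt: "Z \<in> nc_tuples n" using Z by (simp add: nc_ball_at_def)
  let ?M = "row_gram Z"
  have M: "?M \<in> carrier_mat n n" unfolding row_gram_def nc_dim_eq[OF Zt] by auto
  define v where "v = Matrix.vec n (\<lambda>k. cnj (x k))"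
  have v: "v \<in> carrier_vec n" by (simp add: v_def)
  have Mv: "vec_index (?M *\<^sub>v v) k = (\<Sum>l<n. ?M $$ (k, l) * cnj (x l))" if "k < n" for k
    using that M v by (simp add: scalar_prod_def lessThan_atLeast0 v_def)
  have "complex_of_real (\<Sum>j\<in>UNIV. row_sq n (\<lambda>l. \<Sum>k<n. x k * Z j $$ (k, l)))
      = (\<Sum>j\<in>UNIV. \<Sum>m<n. (\<Sum>k<n. x k * Z j $$ (k, m)) * cnj (\<Sum>l<n. x l * Z j $$ (l, m)))"
    unfolding row_sq_def of_real_sum complex_norm_square ..
  also have "\<dots> = (\<Sum>j\<in>UNIV. \<Sum>m<n. \<Sum>k<n. \<Sum>l<n. x k * (Z j $$ (k, m) * cnj (Z j $$ (l, m)) * cnj (x l)))"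
    by (simp add: sum_product algebra_simps)
  also have "\<dots> = (\<Sum>j\<in>UNIV. \<Sum>k<n. \<Sum>m<n. \<Sum>l<n. x k * (Z j $$ (k, m) * cnj (Z j $$ (l, m)) * cnj (x l)))"
    by (intro sum.cong refl sum.swap)
  also have "\<dots> = (\<Sum>k<n. \<Sum>j\<in>UNIV. \<Sum>m<n. \<Sum>l<n. x k * (Z j $$ (k, m) * cnj (Z j $$ (l, m)) * cnj (x l)))"
    by (rule sum.swap)
  also have "\<dots> = (\<Sum>k<n. \<Sum>j\<in>UNIV. \<Sum>l<n. \<Sum>m<n. x k * (Z j $$ (k, m) * cnj (Z j $$ (l, m)) * cnj (x l)))"
    by (intro sum.cong refl sum.swap)
  also have "\<dots> = (\<Sum>k<n. \<Sum>l<n. \<Sum>j\<in>UNIV. \<Sum>m<n. x k * (Z j $$ (k, m) * cnj (Z j $$ (l, m)) * cnj (x l)))"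
    by (intro sum.cong refl sum.swap)
  also have "\<dots> = (\<Sum>k<n. x k * vec_index (?M *\<^sub>v v) k)"
  proof (intro sum.cong refl)
    fix k assume k: "k \<in> {..<n}"
    show "(\<Sum>l<n. \<Sum>j\<in>UNIV. \<Sum>m<n. x k * (Z j $$ (k, m) * cnj (Z j $$ (l, m)) * cnj (x l)))
        = x k * vec_index (?M *\<^sub>v v) k"
      using k by (simp add: Mv row_gram_index[OF Zt] sum_distrib_left sum_distrib_right)
  qed
  finally have eq: "complex_of_real (\<Sum>j\<in>UNIV. row_sq n (\<lambda>l. \<Sum>k<n. x k * Z j $$ (k, l)))
      = (\<Sum>k<n. x k * vec_index (?M *\<^sub>v v) k)" .
  have nonneg: "(\<Sum>j\<in>UNIV. row_sq n (\<lambda>l. \<Sum>k<n. x k * Z j $$ (k, l))) \<ge> 0"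
    unfolding row_sq_def by (intro sum_nonneg) auto
  have vn: "vec_l2norm v = L2_set (\<lambda>k. cmod (x k)) {..<n}"
    unfolding vec_l2norm_def v_def by (intro L2_set_cong) auto
  have "(\<Sum>j\<in>UNIV. row_sq n (\<lambda>l. \<Sum>k<n. x k * Z j $$ (k, l)))
      = cmod (\<Sum>k<n. x k * vec_index (?M *\<^sub>v v) k)"
    unfolding eq[symmetric] norm_of_real using nonneg by simp
  also have "\<dots> \<le> (\<Sum>k<n. \<bar>cmod (x k)\<bar> * \<bar>cmod (vec_index (?M *\<^sub>v v) k)\<bar>)"
    by (rule order.trans[OF norm_sum]) (simp add: norm_mult)
  also have "\<dots> \<le> L2_set (\<lambda>k. cmod (x k)) {..<n} * L2_set (\<lambda>k. cmod (vec_index (?M *\<^sub>v v) k)) {..<n}"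
    by (rule L2_set_mult_ineq)
  also have "\<dots> = vec_l2norm v * vec_l2norm (?M *\<^sub>v v)"
    unfolding vn using M by (simp add: vec_l2norm_def)
  also have "\<dots> \<le> vec_l2norm v * (mat_opnorm ?M * vec_l2norm v)"
    by (intro mult_left_mono vec_l2norm_mult_le[OF M v]) (simp add: vec_l2norm_def)
  also have "\<dots> = mat_opnorm ?M * (vec_l2norm v)\<^sup>2" by (simp add: power2_eq_square)
  also have "(vec_l2norm v)\<^sup>2 = row_sq n x"
    unfolding vn L2_set_def row_sq_def by (simp add: sum_nonneg)
  finally show ?thesis .
qed

lemma mat_opnorm_nonneg: "mat_opnorm A \<ge> 0"
proof -
  define m where "m = dim_col A"
  have A: "A \<in> carrier_mat (dim_row A) m" by (auto simp: m_def)
  show ?thesis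
  proof (cases "m = 0")
    case True
    have "{v::complex vec. v \<in> carrier_vec (dim_col A) \<and> vec_l2norm v \<le> 1} = {0\<^sub>v 0}"
      using True by (auto simp: vec_l2norm_def L2_set_def m_def)
    then show ?thesis unfolding mat_opnorm_def by (simp add: vec_l2norm_def)
  next
    case False
    define v :: "complex vec" where "v = unit_vec m 0"
    have v: "v \<in> carrier_vec m" by (simp add: v_def)
    have "vec_l2norm v > 0"
    proof (rule ccontr)
      assume "\<not> ?thesis"
      then have "L2_set (\<lambda>i. cmod (vec_index v i)) {..<m} = 0"
        using v by (simp add: vec_l2norm_def not_less antisym)
      then have "cmod (vec_index v 0) = 0" using False by (subst (asm) L2_set_eq_0_iff) auto
      then show False using False by (simp add: v_def)
    qed
    moreover have "0 \<le> mat_opnorm A * vec_l2norm v"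
      using vec_l2norm_mult_le[OF A v] by (rule order.trans[rotated]) (simp add: vec_l2norm_def)
    ultimately show ?thesis by (simp add: zero_le_mult_iff)
  qed
qed

lemma level_bound:
  fixes Z :: "'d::finite \<Rightarrow> complex mat"
  assumes Z: "Z \<in> nc_ball_at n"
  shows "(\<Sum>\<alpha>\<in>{\<alpha>::'d list. length \<alpha> = p}. row_sq n (\<lambda>l. \<Sum>k<n. x k * nc_word Z \<alpha> $$ (k, l)))
    \<le> mat_opnorm (row_gram Z) ^ p * row_sq n x"
proof (induction p arbitrary: x)
  case 0
  have Zt: "Z \<in> nc_tuples n" using Z by (simp add: nc_ball_at_def)
  have "row_sq n (\<lambda>l. \<Sum>k<n. x k * nc_word Z [] $$ (k, l)) = row_sq n x"
    unfolding row_sq_def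
  proof (intro sum.cong refl)
    fix l assume l: "l \<in> {..<n}"
    have "(\<Sum>k<n. x k * nc_word Z [] $$ (k, l)) = (\<Sum>k<n. if k = l then x k else 0)"
      using l by (intro sum.cong) (auto simp: nc_dim_eq[OF Zt])
    then show "(cmod (\<Sum>k<n. x k * nc_word Z [] $$ (k, l)))\<^sup>2 = (cmod (x l))\<^sup>2"
      using l by simp
  qed
  then show ?case by simp
next
  case (Suc p)
  have Zt: "Z \<in> nc_tuples n" using Z by (simp add: nc_ball_at_def)
  define y where "y j l = (\<Sum>k<n. x k * Z j $$ (k, l))" for j l
  have set_eq: "{\<alpha>::'d list. length \<alpha> = Suc p} = (\<lambda>(j, \<alpha>). j # \<alpha>) ` (UNIV \<times> {\<alpha>. length \<alpha> = p})"
    by (auto simp: image_iff length_Suc_conv)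
  have inj: "inj_on (\<lambda>(j::'d, \<alpha>). j # \<alpha>) (UNIV \<times> {\<alpha>. length \<alpha> = p})"
    by (auto simp: inj_on_def)
  have step: "(\<Sum>k<n. x k * nc_word Z (j # \<alpha>) $$ (k, l)) = (\<Sum>m<n. y j m * nc_word Z \<alpha> $$ (m, l))"
    if "l < n" for j \<alpha> l
  proof -
    have "(\<Sum>k<n. x k * nc_word Z (j # \<alpha>) $$ (k, l))
        = (\<Sum>k<n. \<Sum>m<n. x k * Z j $$ (k, m) * nc_word Z \<alpha> $$ (m, l))"
      using that by (intro sum.cong refl)
        (simp del: nc_word.simps add: nc_word_Cons_index[OF Zt] sum_distrib_left mult.assoc)
    also have "\<dots> = (\<Sum>m<n. \<Sum>k<n. x k * Z j $$ (k, m) * nc_word Z \<alpha> $$ (m, l))"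
      by (rule sum.swap)
    finally show ?thesis by (simp add: y_def sum_distrib_right)
  qed
  have "(\<Sum>\<alpha>\<in>{\<alpha>::'d list. length \<alpha> = Suc p}. row_sq n (\<lambda>l. \<Sum>k<n. x k * nc_word Z \<alpha> $$ (k, l)))
      = (\<Sum>(j, \<alpha>)\<in>UNIV \<times> {\<alpha>::'d list. length \<alpha> = p}.
          row_sq n (\<lambda>l. \<Sum>k<n. x k * nc_word Z (j # \<alpha>) $$ (k, l)))"
    unfolding set_eq sum.reindex[OF inj] by (simp add: case_prod_beta comp_def)
  also have "\<dots> = (\<Sum>j\<in>UNIV. \<Sum>\<alpha>\<in>{\<alpha>::'d list. length \<alpha> = p}.
          row_sq n (\<lambda>l. \<Sum>k<n. x k * nc_word Z (j # \<alpha>) $$ (k, l)))"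
    by (rule sum.cartesian_product[symmetric])
  also have "\<dots> = (\<Sum>j\<in>UNIV. \<Sum>\<alpha>\<in>{\<alpha>::'d list. length \<alpha> = p}.
          row_sq n (\<lambda>l. \<Sum>m<n. y j m * nc_word Z \<alpha> $$ (m, l)))"
    unfolding row_sq_def using step by (intro sum.cong refl) (simp del: nc_word.simps)
  also have "\<dots> \<le> (\<Sum>j\<in>UNIV. mat_opnorm (row_gram Z) ^ p * row_sq n (y j))"
    by (intro sum_mono Suc.IH)
  also have "\<dots> = mat_opnorm (row_gram Z) ^ p * (\<Sum>j\<in>UNIV. row_sq n (y j))"
    by (simp add: sum_distrib_left)
  also have "\<dots> \<le> mat_opnorm (row_gram Z) ^ p * (mat_opnorm (row_gram Z) * row_sq n x)"
    unfolding y_def by (intro mult_left_mono ball_row_bound[OF Z] zero_le_power mat_opnorm_nonneg)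
  finally show ?case by (simp add: mult.assoc mult.left_commute)
qed

lemma nc_word_square_summable:
  fixes Z :: "'d::finite \<Rightarrow> complex mat"
  assumes Z: "Z \<in> nc_ball_at n" and kl: "k < n" "l < n"
  shows "(\<lambda>\<alpha>. (cmod (nc_word Z \<alpha> $$ (k, l)))\<^sup>2) summable_on UNIV"
proof -
  define \<rho> where "\<rho> = mat_opnorm (row_gram Z)"
  have \<rho>: "0 \<le> \<rho>" "\<rho> < 1" using Z mat_opnorm_nonneg by (auto simp: \<rho>_def nc_ball_at_def)
  define x where "x = (\<lambda>i. if i = k then 1 else (0::complex))"
  have rx: "row_sq n x = 1"
  proof -
    have "row_sq n x = (\<Sum>i<n. if i = k then 1 else 0)"
      unfolding row_sq_def x_def by (intro sum.cong) auto
    then show ?thesis using kl by simp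
  qed
  have le: "(cmod (nc_word Z \<alpha> $$ (k, l)))\<^sup>2 \<le> row_sq n (\<lambda>l. \<Sum>i<n. x i * nc_word Z \<alpha> $$ (i, l))" for \<alpha>
  proof -
    have "(\<Sum>i<n. x i * nc_word Z \<alpha> $$ (i, l)) = (\<Sum>i<n. if i = k then nc_word Z \<alpha> $$ (i, l) else 0)"
      unfolding x_def by (intro sum.cong) auto
    then have "nc_word Z \<alpha> $$ (k, l) = (\<Sum>i<n. x i * nc_word Z \<alpha> $$ (i, l))" using kl by simp
    then show ?thesis unfolding row_sq_def
      using kl member_le_sum[of l "{..<n}" "\<lambda>l. (cmod (\<Sum>i<n. x i * nc_word Z \<alpha> $$ (i, l)))\<^sup>2"] by auto
  qed
  have fin: "finite {\<alpha>::'d list. length \<alpha> = p}" for p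
    using finite_lists_length_eq[of "UNIV::'d set" p] by simp
  show ?thesis
  proof (rule nonneg_bdd_above_summable_on)
    show "bdd_above (sum (\<lambda>\<alpha>. (cmod (nc_word Z \<alpha> $$ (k, l)))\<^sup>2) ` {F. F \<subseteq> UNIV \<and> finite F})"
    proof (rule bdd_aboveI2[where M = "1 / (1 - \<rho>)"])
      fix F :: "'d list set" assume "F \<in> {F. F \<subseteq> UNIV \<and> finite F}"
      then have F: "finite F" by auto
      define N where "N = Suc (Max (insert 0 (length ` F)))"
      have FN: "F \<subseteq> (\<Union>p\<in>{..<N}. {\<alpha>. length \<alpha> = p})"
        using F by (auto simp: N_def less_Suc_eq_le intro: Max_ge)
      have "(\<Sum>\<alpha>\<in>F. (cmod (nc_word Z \<alpha> $$ (k, l)))\<^sup>2)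
          \<le> (\<Sum>\<alpha>\<in>F. row_sq n (\<lambda>l. \<Sum>i<n. x i * nc_word Z \<alpha> $$ (i, l)))"
        by (intro sum_mono le)
      also have "\<dots> \<le> (\<Sum>\<alpha>\<in>(\<Union>p\<in>{..<N}. {\<alpha>. length \<alpha> = p}).
            row_sq n (\<lambda>l. \<Sum>i<n. x i * nc_word Z \<alpha> $$ (i, l)))"
        using FN fin by (intro sum_mono2) (auto simp: row_sq_def sum_nonneg)
      also have "\<dots> = (\<Sum>p<N. \<Sum>\<alpha>\<in>{\<alpha>. length \<alpha> = p}.
            row_sq n (\<lambda>l. \<Sum>i<n. x i * nc_word Z \<alpha> $$ (i, l)))"
        using fin by (intro sum.UNION_disjoint) auto
      also have "\<dots> \<le> (\<Sum>p<N. \<rho> ^ p)"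
        using level_bound[OF Z, of x] rx by (intro sum_mono) (simp add: \<rho>_def)
      also have "\<dots> \<le> 1 / (1 - \<rho>)"
        using \<rho> by (simp add: sum_gp_strict divide_right_mono)
      finally show "(\<Sum>\<alpha>\<in>F. (cmod (nc_word Z \<alpha> $$ (k, l)))\<^sup>2) \<le> 1 / (1 - \<rho>)" .
    qed
  qed auto
qed

lemma abs_summable_prod_l2:
  fixes a b :: "'i \<Rightarrow> real"
  assumes "(\<lambda>i. (a i)\<^sup>2) summable_on UNIV" "(\<lambda>i. (b i)\<^sup>2) summable_on UNIV"
  shows "(\<lambda>i. a i * b i) summable_on UNIV"
proof -
  have "(\<lambda>i. (a i)\<^sup>2 + (b i)\<^sup>2) summable_on UNIV" by (rule summable_on_add[OF assms])
  moreover have "norm (a i * b i) \<le> (a i)\<^sup>2 + (b i)\<^sup>2" for i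
  proof -
    have "0 \<le> (\<bar>a i\<bar> - \<bar>b i\<bar>)\<^sup>2" by simp
    then have "2 * (\<bar>a i\<bar> * \<bar>b i\<bar>) \<le> (a i)\<^sup>2 + (b i)\<^sup>2" by (simp add: power2_diff)
    moreover have "0 \<le> \<bar>a i\<bar> * \<bar>b i\<bar>" by simp
    ultimately show ?thesis by (simp only: real_norm_def abs_mult)
  qed
  ultimately have "(\<lambda>i. a i * b i) abs_summable_on UNIV"
    by (intro abs_summable_on_comparison_test'[where g = "\<lambda>i. (a i)\<^sup>2 + (b i)\<^sup>2"]) auto
  then show ?thesis by (rule abs_summable_summable)
qed

lemma nc_series_summable:
  fixes c :: "'d::finite list \<Rightarrow> 'e::{complex_normed_vector, banach}"
  assumes c: "square_summable c" and Z: "Z \<in> nc_ball_at n" and kl: "k < n" "l < n"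
  shows "(\<lambda>\<alpha>. nc_word Z \<alpha> $$ (k, l) *\<^sub>C c \<alpha>) summable_on UNIV"
proof (rule abs_summable_summable)
  show "(\<lambda>\<alpha>. nc_word Z \<alpha> $$ (k, l) *\<^sub>C c \<alpha>) abs_summable_on UNIV"
    using abs_summable_prod_l2[OF nc_word_square_summable[OF Z kl]] c
    by (simp add: norm_scaleC square_summable_def)
qed

lemma nc_series_carrier: "n \<ge> 1 \<Longrightarrow> Z \<in> nc_ball_at n \<Longrightarrow> nc_series c Z \<in> carrier_mat n n"
  using nc_ball_at_ball[of n Z] by (simp add: nc_series_def nc_ball_at_dim)

lemma nc_series_index:
  "n \<ge> 1 \<Longrightarrow> Z \<in> nc_ball_at n \<Longrightarrow> k < n \<Longrightarrow> l < n \<Longrightarrow>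
    nc_series c Z $$ (k, l) = (\<Sum>\<^sub>\<infinity>\<alpha>. nc_word Z \<alpha> $$ (k, l) *\<^sub>C c \<alpha>)"
  using nc_ball_at_ball[of n Z] by (simp add: nc_series_def nc_ball_at_dim)

lemma mat_opnorm_le:
  assumes A: "A \<in> carrier_mat n m" and K: "K \<ge> 0"
    and le: "\<And>v. v \<in> carrier_vec m \<Longrightarrow> vec_l2norm (A *\<^sub>v v) \<le> K * vec_l2norm v"
  shows "mat_opnorm A \<le> K"
  unfolding mat_opnorm_def
proof (rule cSUP_least)
  have "0\<^sub>v m \<in> {v::complex vec. v \<in> carrier_vec (dim_col A) \<and> vec_l2norm v \<le> 1}"
    using A by (auto simp: vec_l2norm_def L2_set_def)
  then show "{v::complex vec. v \<in> carrier_vec (dim_col A) \<and> vec_l2norm v \<le> 1} \<noteq> {}" by blast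
next
  fix v :: "complex vec" assume v: "v \<in> {v. v \<in> carrier_vec (dim_col A) \<and> vec_l2norm v \<le> 1}"
  then have "vec_l2norm (A *\<^sub>v v) \<le> K * vec_l2norm v" using A by (intro le) auto
  also have "\<dots> \<le> K" using v K by (simp add: mult_left_le)
  finally show "vec_l2norm (A *\<^sub>v v) \<le> K" .
qed

lemma sum_lessThan_add: "(\<Sum>p<n+m. f p) = (\<Sum>p<n. f p) + (\<Sum>p<m. f (n+p::nat) :: 'a::comm_monoid_add)"
  by (induction m) (simp_all add: add.assoc)

lemma mat_mult_vec_index:
  assumes "A \<in> carrier_mat n m" "v \<in> carrier_vec m" "i < n"
  shows "vec_index (A *\<^sub>v v) i = (\<Sum>k<m. A $$ (i, k) * vec_index v k)"
  using assms by (simp add: scalar_prod_def lessThan_atLeast0)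

lemma vec_l2norm_sq: "v \<in> carrier_vec n \<Longrightarrow> (vec_l2norm v)\<^sup>2 = (\<Sum>i<n. (cmod (vec_index v i))\<^sup>2)"
  by (simp add: vec_l2norm_def L2_set_def sum_nonneg)

lemma vec_l2norm_nonneg: "vec_l2norm v \<ge> 0"
  by (simp add: vec_l2norm_def)

lemma mat_dsum_carrier: "A \<in> carrier_mat n n \<Longrightarrow> B \<in> carrier_mat m m \<Longrightarrow> mat_dsum A B \<in> carrier_mat (n + m) (n + m)"
  by (simp add: mat_dsum_def)

lemma mat_dsum_index:
  assumes "A \<in> carrier_mat n n" "B \<in> carrier_mat m m" "i < n + m" "j < n + m"
  shows "mat_dsum A B $$ (i, j) = (if i < n then if j < n then A $$ (i, j) else 0
      else if j < n then 0 else B $$ (i - n, j - n))"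
  using assms by (auto simp: mat_dsum_def)

lemma mat_dsum_opnorm:
  assumes A: "A \<in> carrier_mat n n" and B: "B \<in> carrier_mat m m"
  shows "mat_opnorm (mat_dsum A B) \<le> max (mat_opnorm A) (mat_opnorm B)"
proof (rule mat_opnorm_le[OF mat_dsum_carrier[OF A B]])
  let ?K = "max (mat_opnorm A) (mat_opnorm B)"
  show K: "0 \<le> ?K" using mat_opnorm_nonneg[of A] by simp
  fix v :: "complex vec" assume v: "v \<in> carrier_vec (n + m)"
  define a where "a = Matrix.vec n (\<lambda>i. vec_index v i)"
  define b where "b = Matrix.vec m (\<lambda>i. vec_index v (n + i))"
  have a: "a \<in> carrier_vec n" and b: "b \<in> carrier_vec m" by (auto simp: a_def b_def)
  have ai: "vec_index a i = vec_index v i" if "i < n" for i using that by (simp add: a_def)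
  have bi: "vec_index b i = vec_index v (n + i)" if "i < m" for i using that by (simp add: b_def)
  let ?D = "mat_dsum A B"
  note D = mat_dsum_carrier[OF A B]
  have up: "vec_index (?D *\<^sub>v v) i = vec_index (A *\<^sub>v a) i" if "i < n" for i
    using that v by (simp add: mat_mult_vec_index[OF D v] mat_mult_vec_index[OF A a] sum_lessThan_add
        mat_dsum_index[OF A B] ai)
  have low: "vec_index (?D *\<^sub>v v) (n + i) = vec_index (B *\<^sub>v b) i" if "i < m" for i
    using that v by (simp add: mat_mult_vec_index[OF D v] mat_mult_vec_index[OF B b] sum_lessThan_add
        mat_dsum_index[OF A B] bi)
  have Dv: "?D *\<^sub>v v \<in> carrier_vec (n + m)" by (rule mult_mat_vec_carrier[OF D v])
  have Aa: "A *\<^sub>v a \<in> carrier_vec n" by (rule mult_mat_vec_carrier[OF A a])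
  have Bb: "B *\<^sub>v b \<in> carrier_vec m" by (rule mult_mat_vec_carrier[OF B b])
  have "(vec_l2norm (?D *\<^sub>v v))\<^sup>2 = (vec_l2norm (A *\<^sub>v a))\<^sup>2 + (vec_l2norm (B *\<^sub>v b))\<^sup>2"
    by (simp add: vec_l2norm_sq[OF Dv] vec_l2norm_sq[OF Aa] vec_l2norm_sq[OF Bb] sum_lessThan_add up low)
  also have "\<dots> \<le> (?K * vec_l2norm a)\<^sup>2 + (?K * vec_l2norm b)\<^sup>2"
  proof (intro add_mono power_mono vec_l2norm_nonneg)
    show "vec_l2norm (A *\<^sub>v a) \<le> ?K * vec_l2norm a"
      by (rule order.trans[OF vec_l2norm_mult_le[OF A a]]) (simp add: mult_right_mono vec_l2norm_nonneg)
    show "vec_l2norm (B *\<^sub>v b) \<le> ?K * vec_l2norm b"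
      by (rule order.trans[OF vec_l2norm_mult_le[OF B b]]) (simp add: mult_right_mono vec_l2norm_nonneg)
  qed
  also have "\<dots> = ?K\<^sup>2 * ((vec_l2norm a)\<^sup>2 + (vec_l2norm b)\<^sup>2)"
    by (simp add: power_mult_distrib algebra_simps)
  also have "(vec_l2norm a)\<^sup>2 + (vec_l2norm b)\<^sup>2 = (vec_l2norm v)\<^sup>2"
    unfolding vec_l2norm_sq[OF a] vec_l2norm_sq[OF b] vec_l2norm_sq[OF v] sum_lessThan_add
    by (simp add: ai bi)
  also have "?K\<^sup>2 * (vec_l2norm v)\<^sup>2 = (?K * vec_l2norm v)\<^sup>2" by (simp add: power_mult_distrib)
  finally show "vec_l2norm (?D *\<^sub>v v) \<le> ?K * vec_l2norm v"
    by (rule power2_le_imp_le) (simp add: K vec_l2norm_nonneg)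
qed

lemma row_gram_carrier: "X \<in> nc_tuples n \<Longrightarrow> row_gram X \<in> carrier_mat n n"
  by (simp add: row_gram_def nc_dim_eq)

lemma nc_dsum_tuples:
  "X \<in> nc_tuples n \<Longrightarrow> Y \<in> nc_tuples m \<Longrightarrow> (\<lambda>j. mat_dsum (X j) (Y j)) \<in> nc_tuples (n + m)"
  by (simp add: nc_tuples_def mat_dsum_carrier)

lemma row_gram_dsum:
  assumes X: "X \<in> nc_tuples n" and Y: "Y \<in> nc_tuples m"
  shows "row_gram (\<lambda>j. mat_dsum (X j) (Y j)) = mat_dsum (row_gram X) (row_gram Y)"
proof (rule eq_matI)
  note W = nc_dsum_tuples[OF X Y]
  have Xj: "X j \<in> carrier_mat n n" and Yj: "Y j \<in> carrier_mat m m" for j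
    using X Y by (auto simp: nc_tuples_def)
  note R = row_gram_carrier[OF X] row_gram_carrier[OF Y]
  show "dim_row (row_gram (\<lambda>j. mat_dsum (X j) (Y j))) = dim_row (mat_dsum (row_gram X) (row_gram Y))"
    and "dim_col (row_gram (\<lambda>j. mat_dsum (X j) (Y j))) = dim_col (mat_dsum (row_gram X) (row_gram Y))"
    using row_gram_carrier[OF W] mat_dsum_carrier[OF R] by auto
  fix k l assume "k < dim_row (mat_dsum (row_gram X) (row_gram Y))"
    "l < dim_col (mat_dsum (row_gram X) (row_gram Y))"
  then have kl: "k < n + m" "l < n + m" using mat_dsum_carrier[OF R] by auto
  show "row_gram (\<lambda>j. mat_dsum (X j) (Y j)) $$ (k, l) = mat_dsum (row_gram X) (row_gram Y) $$ (k, l)"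
  proof -
    have "row_gram (\<lambda>j. mat_dsum (X j) (Y j)) $$ (k, l)
      = (\<Sum>j\<in>UNIV. \<Sum>p<n. mat_dsum (X j) (Y j) $$ (k, p) * cnj (mat_dsum (X j) (Y j) $$ (l, p)))
      + (\<Sum>j\<in>UNIV. \<Sum>p<m. mat_dsum (X j) (Y j) $$ (k, n + p) * cnj (mat_dsum (X j) (Y j) $$ (l, n + p)))"
      unfolding row_gram_index[OF W kl] sum_lessThan_add sum.distrib ..
    also have "(\<Sum>j\<in>UNIV. \<Sum>p<n. mat_dsum (X j) (Y j) $$ (k, p) * cnj (mat_dsum (X j) (Y j) $$ (l, p)))
      = (if k < n \<and> l < n then row_gram X $$ (k, l) else 0)"
    proof (cases "k < n \<and> l < n")
      case True
      then show ?thesis using kl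
        by (simp add: mat_dsum_index[OF Xj Yj] row_gram_index[OF X])
    next
      case False
      then show ?thesis using kl
        by (intro trans[OF sum.neutral]) (auto simp: mat_dsum_index[OF Xj Yj] intro!: sum.neutral)
    qed
    also have "(\<Sum>j\<in>UNIV. \<Sum>p<m. mat_dsum (X j) (Y j) $$ (k, n + p) * cnj (mat_dsum (X j) (Y j) $$ (l, n + p)))
      = (if k < n \<or> l < n then 0 else row_gram Y $$ (k - n, l - n))"
    proof (cases "k < n \<or> l < n")
      case True
      then show ?thesis using kl
        by (intro trans[OF sum.neutral]) (auto simp: mat_dsum_index[OF Xj Yj] intro!: sum.neutral)
    next
      case False
      then have "k - n < m" "l - n < m" using kl by auto
      then show ?thesis using kl False
        by (simp add: mat_dsum_index[OF Xj Yj] row_gram_index[OF Y])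
    qed
    finally show ?thesis using kl by (simp add: mat_dsum_index[OF R])
  qed
qed

lemma nc_dsum_ball:
  assumes "X \<in> nc_ball_at n" "Y \<in> nc_ball_at m"
  shows "(\<lambda>j. mat_dsum (X j) (Y j)) \<in> nc_ball_at (n + m)"
proof -
  have X: "X \<in> nc_tuples n" and Y: "Y \<in> nc_tuples m" using assms by (auto simp: nc_ball_at_def)
  have "mat_opnorm (row_gram (\<lambda>j. mat_dsum (X j) (Y j))) \<le> max (mat_opnorm (row_gram X)) (mat_opnorm (row_gram Y))"
    unfolding row_gram_dsum[OF X Y] by (rule mat_dsum_opnorm[OF row_gram_carrier[OF X] row_gram_carrier[OF Y]])
  also have "\<dots> < 1" using assms by (simp add: nc_ball_at_def)
  finally show ?thesis using nc_dsum_tuples[OF X Y] by (simp add: nc_ball_at_def)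
qed

lemma nc_word_dsum:
  assumes X: "X \<in> nc_tuples n" and Y: "Y \<in> nc_tuples m"
  shows "nc_word (\<lambda>j. mat_dsum (X j) (Y j)) \<alpha> = mat_dsum (nc_word X \<alpha>) (nc_word Y \<alpha>)"
proof (induction \<alpha>)
  case Nil
  have "mat_dsum (1\<^sub>m n) (1\<^sub>m m :: complex mat) = 1\<^sub>m (n + m)" by (simp add: mat_dsum_def)
  then show ?case
    by (simp only: nc_word.simps nc_dim_eq[OF X] nc_dim_eq[OF Y] nc_dim_eq[OF nc_dsum_tuples[OF X Y]])
next
  case (Cons j \<alpha>)
  have Xj: "X j \<in> carrier_mat n n" and Yj: "Y j \<in> carrier_mat m m"
    using X Y by (auto simp: nc_tuples_def)
  note c = nc_word_carrier[OF X, of \<alpha>] nc_word_carrier[OF Y, of \<alpha>]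
  show ?case
  proof (rule eq_matI)
    fix k l assume "k < dim_row (mat_dsum (nc_word X (j # \<alpha>)) (nc_word Y (j # \<alpha>)))"
      "l < dim_col (mat_dsum (nc_word X (j # \<alpha>)) (nc_word Y (j # \<alpha>)))"
    then have kl: "k < n + m" "l < n + m"
      using mat_dsum_carrier[OF nc_word_carrier[OF X] nc_word_carrier[OF Y], of "j # \<alpha>" "j # \<alpha>"] by auto
    show "nc_word (\<lambda>j. mat_dsum (X j) (Y j)) (j # \<alpha>) $$ (k, l)
        = mat_dsum (nc_word X (j # \<alpha>)) (nc_word Y (j # \<alpha>)) $$ (k, l)"
    proof -
      note d = mat_dsum_index[OF Xj Yj] mat_dsum_index[OF c]
        mat_dsum_index[OF nc_word_carrier[OF X, of "j # \<alpha>"] nc_word_carrier[OF Y, of "j # \<alpha>"]]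
      note e = nc_word_Cons_index[OF X] nc_word_Cons_index[OF Y]
      have eq: "nc_word (\<lambda>j. mat_dsum (X j) (Y j)) (j # \<alpha>) $$ (k, l)
        = (\<Sum>p<n. mat_dsum (X j) (Y j) $$ (k, p) * mat_dsum (nc_word X \<alpha>) (nc_word Y \<alpha>) $$ (p, l))
        + (\<Sum>p<m. mat_dsum (X j) (Y j) $$ (k, n + p) * mat_dsum (nc_word X \<alpha>) (nc_word Y \<alpha>) $$ (n + p, l))"
        unfolding nc_word_Cons_index[OF nc_dsum_tuples[OF X Y] kl] Cons.IH sum_lessThan_add ..
      show ?thesis unfolding eq
        using kl by (cases "k < n"; cases "l < n") (simp_all del: nc_word.simps add: d e)
    qed
  next
    show "dim_row (nc_word (\<lambda>j. mat_dsum (X j) (Y j)) (j # \<alpha>))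
        = dim_row (mat_dsum (nc_word X (j # \<alpha>)) (nc_word Y (j # \<alpha>)))"
      "dim_col (nc_word (\<lambda>j. mat_dsum (X j) (Y j)) (j # \<alpha>))
        = dim_col (mat_dsum (nc_word X (j # \<alpha>)) (nc_word Y (j # \<alpha>)))"
      using mat_dsum_carrier[OF nc_word_carrier[OF X] nc_word_carrier[OF Y], of "j # \<alpha>" "j # \<alpha>"]
        nc_word_carrier[OF nc_dsum_tuples[OF X Y], of "j # \<alpha>"] by auto
  qed
qed

lemma nc_word_sim:
  assumes X: "X \<in> nc_tuples n" and S: "S \<in> carrier_mat n n" and T: "T \<in> carrier_mat n n"
    and ST: "S * T = 1\<^sub>m n" and TS: "T * S = 1\<^sub>m n"
  shows "nc_word (\<lambda>j. T * X j * S) \<alpha> = T * nc_word X \<alpha> * S"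
proof (induction \<alpha>)
  case Nil
  have "(\<lambda>j. T * X j * S) \<in> nc_tuples n"
    using X S T by (auto simp: nc_tuples_def intro!: mult_carrier_mat)
  then show ?case using T TS by (simp add: nc_dim_eq[OF X] nc_dim_eq)
next
  case (Cons j \<alpha>)
  have Xj: "X j \<in> carrier_mat n n" using X by (auto simp: nc_tuples_def)
  note P = nc_word_carrier[OF X, of \<alpha>]
  have "T * X j * S * (T * nc_word X \<alpha> * S) = T * X j * S * (T * (nc_word X \<alpha> * S))"
    using T P S by (simp add: assoc_mult_mat[of _ n n _ n _ n])
  also have "\<dots> = T * X j * (S * T) * (nc_word X \<alpha> * S)"
    using T P S Xj by (simp add: assoc_mult_mat[of _ n n _ n _ n])
  also have "\<dots> = T * (X j * nc_word X \<alpha>) * S"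
    using T P S Xj by (simp add: ST assoc_mult_mat[of _ n n _ n _ n])
  finally show ?case by (simp add: Cons.IH)
qed

lemma has_sum_sum_fun:
  fixes f :: "'k \<Rightarrow> 'i \<Rightarrow> 'b::topological_comm_monoid_add"
  assumes "finite K" "\<And>k. k \<in> K \<Longrightarrow> (f k has_sum s k) A"
  shows "((\<lambda>i. \<Sum>k\<in>K. f k i) has_sum (\<Sum>k\<in>K. s k)) A"
  using assms by (induction K rule: finite_induct) (auto intro!: has_sum_add)

lemma has_sum_scaleC:
  fixes f :: "'i \<Rightarrow> 'e::complex_normed_vector"
  shows "(f has_sum s) A \<Longrightarrow> ((\<lambda>i. a *\<^sub>C f i) has_sum (a *\<^sub>C s)) A"
  by (rule has_sum_bounded_linear[OF bounded_linear_scaleC])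

lemma nc_series_has_sum:
  fixes c :: "'d::finite list \<Rightarrow> 'e::{complex_normed_vector, banach}"
  assumes c: "square_summable c" and n: "n \<ge> 1" and Z: "Z \<in> nc_ball_at n" and kl: "k < n" "l < n"
  shows "((\<lambda>\<alpha>. nc_word Z \<alpha> $$ (k, l) *\<^sub>C c \<alpha>) has_sum nc_series c Z $$ (k, l)) UNIV"
  unfolding nc_series_index[OF n Z kl] by (rule has_sum_infsum[OF nc_series_summable[OF c Z kl]])

lemma nc_function_nc_series:
  fixes c :: "'d::finite list \<Rightarrow> 'e::{complex_normed_vector, banach}"
  assumes c: "square_summable c"
  shows "nc_function (nc_series c)"
  unfolding nc_function_def
proof (intro conjI ballI allI impI)
  show "nc_series c \<in> extensional nc_ball" by (simp add: nc_series_def)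
  show "nc_series c X \<in> carrier_mat n n" if "1 \<le> n" "X \<in> nc_ball_at n" for n X
    using that by (rule nc_series_carrier)
next
  fix X Y :: "'d \<Rightarrow> complex mat" assume XY: "X \<in> nc_ball" "Y \<in> nc_ball"
  obtain n where n: "n \<ge> 1" "X \<in> nc_ball_at n" "X \<in> nc_tuples n" using XY(1) by (rule nc_ballE)
  obtain m where m: "m \<ge> 1" "Y \<in> nc_ball_at m" "Y \<in> nc_tuples m" using XY(2) by (rule nc_ballE)
  let ?W = "\<lambda>j. mat_dsum (X j) (Y j)"
  have W: "?W \<in> nc_ball_at (n + m)" by (rule nc_dsum_ball[OF n(2) m(2)])
  have nm: "n + m \<ge> 1" using n by simp
  note cX = nc_series_carrier[OF n(1,2), of c] and cY = nc_series_carrier[OF m(1,2), of c]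
  note cW = nc_series_carrier[OF nm W, of c]
  note D = mat_dsum_carrier[OF cX cY]
  show "nc_series c ?W = mat_dsum (nc_series c X) (nc_series c Y)"
  proof (rule eq_matI)
    fix k l assume "k < dim_row (mat_dsum (nc_series c X) (nc_series c Y))"
      "l < dim_col (mat_dsum (nc_series c X) (nc_series c Y))"
    then have kl: "k < n + m" "l < n + m" using D by auto
    show "nc_series c ?W $$ (k, l) = mat_dsum (nc_series c X) (nc_series c Y) $$ (k, l)"
      using kl
      by (auto simp: nc_series_index[OF nm W] nc_word_dsum[OF n(3) m(3)] mat_dsum_index[OF cX cY]
          mat_dsum_index[OF nc_word_carrier[OF n(3)] nc_word_carrier[OF m(3)]]
          nc_series_index[OF n(1,2)] nc_series_index[OF m(1,2)])
  qed (use D cW in auto)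
next
  fix n and X :: "'d \<Rightarrow> complex mat" and S T :: "complex mat"
  assume n: "1 \<le> n" and X: "X \<in> nc_ball_at n" and S: "S \<in> carrier_mat n n" and T: "T \<in> carrier_mat n n"
    and inv: "S * T = 1\<^sub>m n" "T * S = 1\<^sub>m n" and W: "(\<lambda>j. T * X j * S) \<in> nc_ball_at n"
  have Xt: "X \<in> nc_tuples n" using X by (simp add: nc_ball_at_def)
  note cX = nc_series_carrier[OF n X, of c] and cW = nc_series_carrier[OF n W, of c]
  show "nc_series c (\<lambda>j. T * X j * S) = scalar_mat_mult T (mat_scalar_mult (nc_series c X) S)"
  proof (rule eq_matI)
    fix k l assume "k < dim_row (scalar_mat_mult T (mat_scalar_mult (nc_series c X) S))"
      "l < dim_col (scalar_mat_mult T (mat_scalar_mult (nc_series c X) S))"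
    then have kl: "k < n" "l < n" using S T by (auto simp: scalar_mat_mult_def mat_scalar_mult_def)
    have entry: "nc_word (\<lambda>j. T * X j * S) \<alpha> $$ (k, l) *\<^sub>C c \<alpha> =
        (\<Sum>a<n. T $$ (k, a) *\<^sub>C (\<Sum>b<n. S $$ (b, l) *\<^sub>C (nc_word X \<alpha> $$ (a, b) *\<^sub>C c \<alpha>)))" for \<alpha>
    proof -
      note P = nc_word_carrier[OF Xt, of \<alpha>]
      have "nc_word (\<lambda>j. T * X j * S) \<alpha> = T * (nc_word X \<alpha> * S)"
        using T P S by (simp add: nc_word_sim[OF Xt S T inv] assoc_mult_mat[of _ n n _ n _ n])
      then have "nc_word (\<lambda>j. T * X j * S) \<alpha> $$ (k, l)
          = (\<Sum>a<n. T $$ (k, a) * (\<Sum>b<n. nc_word X \<alpha> $$ (a, b) * S $$ (b, l)))"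
        using kl by (simp add: mat_mult_index[OF T mult_carrier_mat[OF P S]] mat_mult_index[OF P S])
      then show ?thesis
        by (simp add: complex_vector.scale_sum_left complex_vector.scale_sum_right sum_distrib_left
            scaleC_scaleC mult_ac)
    qed
    have "((\<lambda>\<alpha>. nc_word (\<lambda>j. T * X j * S) \<alpha> $$ (k, l) *\<^sub>C c \<alpha>) has_sum
        (\<Sum>a<n. T $$ (k, a) *\<^sub>C (\<Sum>b<n. S $$ (b, l) *\<^sub>C nc_series c X $$ (a, b)))) UNIV"
      unfolding entry
      by (intro has_sum_sum_fun has_sum_scaleC nc_series_has_sum[OF c n X]) auto
    then have "nc_series c (\<lambda>j. T * X j * S) $$ (k, l)
        = (\<Sum>a<n. T $$ (k, a) *\<^sub>C (\<Sum>b<n. S $$ (b, l) *\<^sub>C nc_series c X $$ (a, b)))"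
      unfolding nc_series_index[OF n W kl] by (rule infsumI)
    also have "\<dots> = scalar_mat_mult T (mat_scalar_mult (nc_series c X) S) $$ (k, l)"
      using kl S T cX by (simp add: scalar_mat_mult_def mat_scalar_mult_def)
    finally show "nc_series c (\<lambda>j. T * X j * S) $$ (k, l)
        = scalar_mat_mult T (mat_scalar_mult (nc_series c X) S) $$ (k, l)" .
  qed (use S T cX cW in \<open>auto simp: scalar_mat_mult_def mat_scalar_mult_def\<close>)
qed

text \<open>The coefficients are recovered from the values on truncated weighted shifts.\<close>

definition test_point :: "'d list \<Rightarrow> 'd \<Rightarrow> complex mat"
  where "test_point \<alpha> j = Matrix.mat (Suc (length \<alpha>)) (Suc (length \<alpha>))
    (\<lambda>(k, l). if l = Suc k \<and> \<alpha> ! k = j then 1/2 else 0)"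

lemma test_point_tuples: "test_point \<alpha> \<in> nc_tuples (Suc (length \<alpha>))"
  by (simp add: nc_tuples_def test_point_def)

lemma test_point_ball: "test_point (\<alpha>::'d::finite list) \<in> nc_ball_at (Suc (length \<alpha>))"
proof -
  let ?n = "Suc (length \<alpha>)"
  let ?M = "row_gram (test_point \<alpha>)"
  note M = row_gram_carrier[OF test_point_tuples[of \<alpha>]]
  have M_idx: "?M $$ (k, l) = (if k = l \<and> k < length \<alpha> then 1/4 else 0)" if kl: "k < ?n" "l < ?n" for k l
  proof -
    have "?M $$ (k, l) = (\<Sum>j\<in>UNIV. \<Sum>m<?n. if m = Suc k then (if k = l \<and> k < length \<alpha> \<and> j = \<alpha> ! k then 1/4 else 0) else 0)"
      unfolding row_gram_index[OF test_point_tuples kl]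
      using kl by (intro sum.cong refl) (auto simp: test_point_def)
    also have "\<dots> = (\<Sum>j\<in>UNIV. if j = \<alpha> ! k then (if k = l \<and> k < length \<alpha> then 1/4 else 0) else 0)"
      by (intro sum.cong refl) (auto simp: sum.delta)
    finally show ?thesis by (simp add: sum.delta)
  qed
  have "mat_opnorm ?M \<le> 1/4"
  proof (rule mat_opnorm_le[OF M])
    fix v :: "complex vec" assume v: "v \<in> carrier_vec ?n"
    have Mv: "vec_index (?M *\<^sub>v v) k = (if k < length \<alpha> then vec_index v k / 4 else 0)" if k: "k < ?n" for k
    proof -
      have "vec_index (?M *\<^sub>v v) k = (\<Sum>l<?n. if l = k then (if k < length \<alpha> then vec_index v k / 4 else 0) else 0)"
        unfolding mat_mult_vec_index[OF M v k] using k by (intro sum.cong refl) (auto simp: M_idx)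
      then show ?thesis using k by (simp only: sum.delta finite_lessThan lessThan_iff if_True)
    qed
    have "(vec_l2norm (?M *\<^sub>v v))\<^sup>2 = (\<Sum>k<?n. (cmod (vec_index (?M *\<^sub>v v) k))\<^sup>2)"
      using mult_mat_vec_carrier[OF M v] by (intro vec_l2norm_sq) auto
    also have "\<dots> \<le> (\<Sum>k<?n. (1/4)\<^sup>2 * (cmod (vec_index v k))\<^sup>2)"
      by (intro sum_mono) (auto simp: Mv norm_divide power_divide)
    also have "\<dots> = (1/4 * vec_l2norm v)\<^sup>2"
      by (simp only: sum_distrib_left[symmetric] vec_l2norm_sq[OF v] power_mult_distrib)
    finally show "vec_l2norm (?M *\<^sub>v v) \<le> 1/4 * vec_l2norm v"
      by (rule power2_le_imp_le) (simp add: vec_l2norm_nonneg)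
  qed simp
  then show ?thesis using test_point_tuples[of \<alpha>] by (simp add: nc_ball_at_def)
qed

lemma test_point_word:
  assumes "k \<le> length \<alpha>" "l \<le> length \<alpha>"
  shows "nc_word (test_point \<alpha>) \<beta> $$ (k, l) =
    (if l = k + length \<beta> \<and> (\<forall>i<length \<beta>. \<alpha> ! (k + i) = \<beta> ! i) then (1/2) ^ length \<beta> else 0)"
  using assms
proof (induction \<beta> arbitrary: k)
  case Nil
  then show ?case by (auto simp: nc_dim_eq[OF test_point_tuples])
next
  case (Cons j \<beta>)
  let ?n = "Suc (length \<alpha>)"
  have all_Suc: "(\<forall>i<length (j # \<beta>). \<alpha> ! (k + i) = (j # \<beta>) ! i)
      \<longleftrightarrow> \<alpha> ! k = j \<and> (\<forall>i<length \<beta>. \<alpha> ! (Suc k + i) = \<beta> ! i)"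
    by (simp add: All_less_Suc2)
  have "nc_word (test_point \<alpha>) (j # \<beta>) $$ (k, l)
      = (\<Sum>m<?n. test_point \<alpha> j $$ (k, m) * nc_word (test_point \<alpha>) \<beta> $$ (m, l))"
    using Cons.prems by (intro nc_word_Cons_index test_point_tuples) auto
  also have "\<dots> = (\<Sum>m<?n. if m = Suc k then
      (if \<alpha> ! k = j then 1/2 * nc_word (test_point \<alpha>) \<beta> $$ (Suc k, l) else 0) else 0)"
    using Cons.prems by (intro sum.cong refl) (auto simp: test_point_def)
  also have "\<dots> = (if Suc k < ?n \<and> \<alpha> ! k = j then 1/2 * nc_word (test_point \<alpha>) \<beta> $$ (Suc k, l) else 0)"
    by (simp only: sum.delta finite_lessThan lessThan_iff if_True) auto
  also have "\<dots> = (if l = k + length (j # \<beta>) \<and> (\<forall>i<length (j # \<beta>). \<alpha> ! (k + i) = (j # \<beta>) ! i)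
      then (1/2) ^ length (j # \<beta>) else 0)"
  proof (cases "Suc k < ?n")
    case True
    then have eq: "nc_word (test_point \<alpha>) \<beta> $$ (Suc k, l) =
      (if l = Suc k + length \<beta> \<and> (\<forall>i<length \<beta>. \<alpha> ! (Suc k + i) = \<beta> ! i) then (1/2) ^ length \<beta> else 0)"
      using Cons.prems by (intro Cons.IH) auto
    show ?thesis unfolding all_Suc eq using True by simp
  next
    case False
    then show ?thesis using Cons.prems by auto
  qed
  finally show ?case .
qed

lemma nc_series_test_point:
  fixes c :: "'d::finite list \<Rightarrow> 'e::{complex_normed_vector, banach}"
  shows "nc_series c (test_point \<alpha>) $$ (0, length \<alpha>) = (1/2) ^ length \<alpha> *\<^sub>C c \<alpha>"
proof -
  have word: "nc_word (test_point \<alpha>) \<beta> $$ (0, length \<alpha>) = (if \<beta> = \<alpha> then (1/2) ^ length \<alpha> else 0)" for \<beta>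
  proof -
    have "\<beta> = \<alpha> \<longleftrightarrow> length \<alpha> = length \<beta> \<and> (\<forall>i<length \<beta>. \<alpha> ! i = \<beta> ! i)"
      by (metis nth_equalityI)
    then show ?thesis by (simp add: test_point_word)
  qed
  have "((\<lambda>\<beta>. nc_word (test_point \<alpha>) \<beta> $$ (0, length \<alpha>) *\<^sub>C c \<beta>) has_sum (1/2) ^ length \<alpha> *\<^sub>C c \<alpha>) UNIV"
    by (rule has_sum_finite_neutralI[where B = "{\<alpha>}"]) (auto simp: word)
  moreover have "nc_series c (test_point \<alpha>) $$ (0, length \<alpha>)
      = (\<Sum>\<^sub>\<infinity>\<beta>. nc_word (test_point \<alpha>) \<beta> $$ (0, length \<alpha>) *\<^sub>C c \<beta>)"
    using test_point_ball[of \<alpha>] by (intro nc_series_index) auto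
  ultimately show ?thesis by (simp add: infsumI)
qed

lemma nc_series_inject:
  fixes c c' :: "'d::finite list \<Rightarrow> 'e::{complex_normed_vector, banach}"
  assumes "nc_series c = nc_series c'"
  shows "c = c'"
proof
  fix \<alpha>
  have "(1/2::complex) ^ length \<alpha> *\<^sub>C c \<alpha> = (1/2) ^ length \<alpha> *\<^sub>C c' \<alpha>"
    using nc_series_test_point[of c \<alpha>] nc_series_test_point[of c' \<alpha>] assms by simp
  then show "c \<alpha> = c' \<alpha>" by (rule complex_vector.scale_left_imp_eq[rotated]) simp
qed

lemma square_summable_add:
  fixes c d :: "'i \<Rightarrow> 'e::real_normed_vector"
  assumes "square_summable c" "square_summable d"
  shows "square_summable (\<lambda>\<alpha>. c \<alpha> + d \<alpha>)"
  unfolding square_summable_def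
proof (rule summable_on_comparison_test)
  show "(\<lambda>\<alpha>. 2 * ((norm (c \<alpha>))\<^sup>2 + (norm (d \<alpha>))\<^sup>2)) summable_on UNIV"
    using assms by (intro summable_on_cmult_right summable_on_add) (auto simp: square_summable_def)
  fix \<alpha>
  have "(norm (c \<alpha> + d \<alpha>))\<^sup>2 \<le> (norm (c \<alpha>) + norm (d \<alpha>))\<^sup>2"
    by (intro power_mono norm_triangle_ineq) auto
  also have "\<dots> \<le> 2 * ((norm (c \<alpha>))\<^sup>2 + (norm (d \<alpha>))\<^sup>2)"
    using zero_le_power2[of "norm (c \<alpha>) - norm (d \<alpha>)"] by (simp add: power2_sum power2_diff)
  finally show "(norm (c \<alpha> + d \<alpha>))\<^sup>2 \<le> 2 * ((norm (c \<alpha>))\<^sup>2 + (norm (d \<alpha>))\<^sup>2)" .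
qed auto

lemma square_summable_scaleC:
  fixes c :: "'i \<Rightarrow> 'e::complex_normed_vector"
  shows "square_summable c \<Longrightarrow> square_summable (\<lambda>\<alpha>. a *\<^sub>C c \<alpha>)"
  by (simp add: square_summable_def norm_scaleC power_mult_distrib summable_on_cmult_right)

lemma square_summable_0: "square_summable (\<lambda>_. 0)"
  by (simp add: square_summable_def)

lemma nc_series_add:
  fixes c d :: "'d::finite list \<Rightarrow> 'e::{complex_normed_vector, banach}"
  assumes "square_summable c" "square_summable d"
  shows "(\<lambda>Z\<in>nc_ball. nc_series c Z + nc_series d Z) = nc_series (\<lambda>\<alpha>. c \<alpha> + d \<alpha>)"
proof (rule extensionalityI[of _ nc_ball])
  fix Z :: "'d \<Rightarrow> complex mat" assume Z: "Z \<in> nc_ball"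
  obtain n where n: "n \<ge> 1" "Z \<in> nc_ball_at n" using Z by (rule nc_ballE)
  note car = nc_series_carrier[OF n]
  have "nc_series c Z + nc_series d Z = nc_series (\<lambda>\<alpha>. c \<alpha> + d \<alpha>) Z"
  proof (rule eq_matI)
    fix k l assume "k < dim_row (nc_series (\<lambda>\<alpha>. c \<alpha> + d \<alpha>) Z)" "l < dim_col (nc_series (\<lambda>\<alpha>. c \<alpha> + d \<alpha>) Z)"
    then have kl: "k < n" "l < n" using car[of "\<lambda>\<alpha>. c \<alpha> + d \<alpha>"] by auto
    then have "(nc_series c Z + nc_series d Z) $$ (k, l) = nc_series c Z $$ (k, l) + nc_series d Z $$ (k, l)"
      using car[of d] by simp
    also have "\<dots> = nc_series (\<lambda>\<alpha>. c \<alpha> + d \<alpha>) Z $$ (k, l)"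
      unfolding nc_series_index[OF n kl] scaleC_add_right
      by (intro infsum_add[symmetric] nc_series_summable[OF _ n(2) kl] assms)
    finally show "(nc_series c Z + nc_series d Z) $$ (k, l) = nc_series (\<lambda>\<alpha>. c \<alpha> + d \<alpha>) Z $$ (k, l)" .
  qed (use car[of d] car[of "\<lambda>\<alpha>. c \<alpha> + d \<alpha>"] in auto)
  then show "(\<lambda>Z\<in>nc_ball. nc_series c Z + nc_series d Z) Z = nc_series (\<lambda>\<alpha>. c \<alpha> + d \<alpha>) Z"
    using Z by simp
qed (auto simp: nc_series_def)

lemma nc_series_scaleC:
  fixes c :: "'d::finite list \<Rightarrow> 'e::{complex_normed_vector, banach}"
  assumes "square_summable c"
  shows "(\<lambda>Z\<in>nc_ball. map_mat (scaleC a) (nc_series c Z)) = nc_series (\<lambda>\<alpha>. a *\<^sub>C c \<alpha>)"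
proof (rule extensionalityI[of _ nc_ball])
  fix Z :: "'d \<Rightarrow> complex mat" assume Z: "Z \<in> nc_ball"
  obtain n where n: "n \<ge> 1" "Z \<in> nc_ball_at n" using Z by (rule nc_ballE)
  note car = nc_series_carrier[OF n]
  have "map_mat (scaleC a) (nc_series c Z) = nc_series (\<lambda>\<alpha>. a *\<^sub>C c \<alpha>) Z"
  proof (rule eq_matI)
    fix k l assume "k < dim_row (nc_series (\<lambda>\<alpha>. a *\<^sub>C c \<alpha>) Z)" "l < dim_col (nc_series (\<lambda>\<alpha>. a *\<^sub>C c \<alpha>) Z)"
    then have kl: "k < n" "l < n" using car[of "\<lambda>\<alpha>. a *\<^sub>C c \<alpha>"] by auto
    have "((\<lambda>\<alpha>. a *\<^sub>C (nc_word Z \<alpha> $$ (k, l) *\<^sub>C c \<alpha>)) has_sum a *\<^sub>C nc_series c Z $$ (k, l)) UNIV"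
      by (intro has_sum_scaleC nc_series_has_sum[OF assms n kl])
    then have "nc_series (\<lambda>\<alpha>. a *\<^sub>C c \<alpha>) Z $$ (k, l) = a *\<^sub>C nc_series c Z $$ (k, l)"
      unfolding nc_series_index[OF n kl] by (intro infsumI) (simp add: scaleC_scaleC mult.commute)
    then show "map_mat (scaleC a) (nc_series c Z) $$ (k, l) = nc_series (\<lambda>\<alpha>. a *\<^sub>C c \<alpha>) Z $$ (k, l)"
      using kl car[of c] by simp
  qed (use car[of c] car[of "\<lambda>\<alpha>. a *\<^sub>C c \<alpha>"] in auto)
  then show "(\<lambda>Z\<in>nc_ball. map_mat (scaleC a) (nc_series c Z)) Z = nc_series (\<lambda>\<alpha>. a *\<^sub>C c \<alpha>) Z"
    using Z by simp
qed (auto simp: nc_series_def)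

lemma nc_series_zero:
  "(\<lambda>Z\<in>nc_ball. 0\<^sub>m (nc_dim Z) (nc_dim Z)) = nc_series (\<lambda>_. 0 :: 'e::{complex_normed_vector, banach})"
  by (rule extensionalityI[of _ nc_ball]) (auto simp: nc_series_def intro!: eq_matI)

section \<open>The nc Drury--Arveson space\<close>

typedef (overloaded) ('d, 'e) drury_arveson =
  "{f :: ('d::finite \<Rightarrow> complex mat) \<Rightarrow> 'e::chilbert_space mat.
      nc_function f \<and> (\<exists>c. square_summable c \<and> f = nc_series c)}"
  morphisms da_fun Abs_da
  using nc_function_nc_series[OF square_summable_0] square_summable_0 by blast

definition da_coeff :: "('d::finite, 'e::chilbert_space) drury_arveson \<Rightarrow> 'd list \<Rightarrow> 'e"
  where "da_coeff f = (THE c. square_summable c \<and> da_fun f = nc_series c)"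

lemma da_coeff: "square_summable (da_coeff f)" "da_fun f = nc_series (da_coeff f)"
proof -
  obtain c where c: "square_summable c" "da_fun f = nc_series c" using da_fun[of f] by blast
  have "square_summable (da_coeff f) \<and> da_fun f = nc_series (da_coeff f)"
    unfolding da_coeff_def by (rule theI[of _ c]) (use c nc_series_inject in \<open>auto\<close>)
  then show "square_summable (da_coeff f)" "da_fun f = nc_series (da_coeff f)" by auto
qed

lemma da_fun_Abs_series: "square_summable c \<Longrightarrow> da_fun (Abs_da (nc_series c)) = nc_series c"
  by (intro Abs_da_inverse) (auto simp: nc_function_nc_series)

lemma da_coeff_Abs_series: "square_summable c \<Longrightarrow> da_coeff (Abs_da (nc_series c)) = c"
  using da_coeff(2)[of "Abs_da (nc_series c)"] by (auto simp: da_fun_Abs_series dest: nc_series_inject)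

lemma da_eqI: "da_coeff f = da_coeff g \<Longrightarrow> f = g"
  using da_coeff(2)[of f] da_coeff(2)[of g] da_fun_inject by metis

lemma cinner_summable:
  fixes c d :: "'i \<Rightarrow> 'e::chilbert_space"
  assumes "square_summable c" "square_summable d"
  shows "(\<lambda>\<alpha>. cinner (c \<alpha>) (d \<alpha>)) summable_on UNIV"
proof (rule abs_summable_summable)
  have s: "(\<lambda>\<alpha>. norm (c \<alpha>) * norm (d \<alpha>)) summable_on UNIV"
    using assms by (intro abs_summable_prod_l2) (auto simp: square_summable_def)
  show "(\<lambda>\<alpha>. cinner (c \<alpha>) (d \<alpha>)) abs_summable_on UNIV"
    by (rule abs_summable_on_comparison_test'[OF s]) (rule cinner_Cauchy_Schwarz)
qed

definition l2n :: "('i \<Rightarrow> 'e::real_normed_vector) \<Rightarrow> real"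
  where "l2n c = sqrt (\<Sum>\<^sub>\<infinity>\<alpha>. (norm (c \<alpha>))\<^sup>2)"

lemma l2n_finite: "square_summable c \<Longrightarrow> finite F \<Longrightarrow> L2_set (\<lambda>\<alpha>. norm (c \<alpha>)) F \<le> l2n c"
  unfolding l2n_def L2_set_def
  by (intro real_sqrt_le_mono finite_sum_le_infsum) (auto simp: square_summable_def)

lemma square_summableI_bound:
  assumes "\<And>F. finite F \<Longrightarrow> L2_set (\<lambda>\<alpha>. norm (c \<alpha>)) F \<le> K"
  shows "square_summable c" "l2n c \<le> K"
proof -
  have K: "K \<ge> 0" using assms[of "{}"] by simp
  have le: "(\<Sum>\<alpha>\<in>F. (norm (c \<alpha>))\<^sup>2) \<le> K\<^sup>2" if "finite F" for F
    using assms[OF that] K unfolding L2_set_def by (simp add: real_sqrt_le_iff sqrt_le_D)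
  show ss: "square_summable c"
    unfolding square_summable_def
    by (rule nonneg_bdd_above_summable_on) (use le in \<open>auto intro!: bdd_aboveI2[where M = "K\<^sup>2"]\<close>)
  have "(\<Sum>\<^sub>\<infinity>\<alpha>. (norm (c \<alpha>))\<^sup>2) \<le> K\<^sup>2"
    using ss le unfolding square_summable_def by (intro infsum_le_finite_sums) auto
  then show "l2n c \<le> K" unfolding l2n_def using K by (intro real_le_lsqrt) auto
qed

lemma l2n_triangle:
  assumes "square_summable c" "square_summable d"
  shows "l2n (\<lambda>\<alpha>. c \<alpha> + d \<alpha>) \<le> l2n c + l2n d"
proof (rule square_summableI_bound(2))
  fix F :: "'a set" assume F: "finite F"
  have "L2_set (\<lambda>\<alpha>. norm (c \<alpha> + d \<alpha>)) F \<le> L2_set (\<lambda>\<alpha>. norm (c \<alpha>) + norm (d \<alpha>)) F"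
    by (intro L2_set_mono norm_triangle_ineq) auto
  also have "\<dots> \<le> L2_set (\<lambda>\<alpha>. norm (c \<alpha>)) F + L2_set (\<lambda>\<alpha>. norm (d \<alpha>)) F"
    by (rule L2_set_triangle_ineq)
  also have "\<dots> \<le> l2n c + l2n d" by (intro add_mono l2n_finite assms F)
  finally show "L2_set (\<lambda>\<alpha>. norm (c \<alpha> + d \<alpha>)) F \<le> l2n c + l2n d" .
qed

lemma norm_le_l2n: "square_summable c \<Longrightarrow> norm (c \<alpha>) \<le> l2n c"
  using l2n_finite[of c "{\<alpha>}"] by simp

lemma l2_complete:
  fixes c :: "nat \<Rightarrow> 'i \<Rightarrow> 'e::banach"
  assumes ss: "\<And>n. square_summable (c n)"
    and cau: "\<And>e. e > 0 \<Longrightarrow> \<exists>N. \<forall>m\<ge>N. \<forall>n\<ge>N. l2n (\<lambda>\<alpha>. c m \<alpha> - c n \<alpha>) < e"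
  shows "\<exists>a. square_summable a \<and> (\<forall>e>0. \<exists>N. \<forall>n\<ge>N. l2n (\<lambda>\<alpha>. c n \<alpha> - a \<alpha>) \<le> e)"
proof -
  have diff: "square_summable (\<lambda>\<alpha>. c m \<alpha> - c n \<alpha>)" for m n
    using square_summable_add[OF ss[of m], of "\<lambda>\<alpha>. - c n \<alpha>"] ss[of n] by (simp add: square_summable_def)
  have "Cauchy (\<lambda>n. c n \<alpha>)" for \<alpha>
  proof (rule CauchyI)
    fix e :: real assume "e > 0"
    then obtain N where "\<forall>m\<ge>N. \<forall>n\<ge>N. l2n (\<lambda>\<alpha>. c m \<alpha> - c n \<alpha>) < e" using cau by blast
    then show "\<exists>M. \<forall>m\<ge>M. \<forall>n\<ge>M. norm (c m \<alpha> - c n \<alpha>) < e"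
      using norm_le_l2n[OF diff] by (meson le_less_trans)
  qed
  then have "\<exists>a. (\<lambda>n. c n \<alpha>) \<longlonglongrightarrow> a" for \<alpha> by (metis Cauchy_convergent convergent_def)
  then obtain a where a: "\<And>\<alpha>. (\<lambda>n. c n \<alpha>) \<longlonglongrightarrow> a \<alpha>" by metis
  have key: "\<exists>N. \<forall>n\<ge>N. square_summable (\<lambda>\<alpha>. c n \<alpha> - a \<alpha>) \<and> l2n (\<lambda>\<alpha>. c n \<alpha> - a \<alpha>) \<le> e" if e: "e > 0" for e
  proof -
    obtain N where N: "\<forall>m\<ge>N. \<forall>n\<ge>N. l2n (\<lambda>\<alpha>. c m \<alpha> - c n \<alpha>) < e" using cau[OF e] by blast
    have "L2_set (\<lambda>\<alpha>. norm (c n \<alpha> - a \<alpha>)) F \<le> e" if n: "n \<ge> N" and F: "finite F" for n F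
    proof (rule LIMSEQ_le_const2)
      show "(\<lambda>m. L2_set (\<lambda>\<alpha>. norm (c n \<alpha> - c m \<alpha>)) F) \<longlonglongrightarrow> L2_set (\<lambda>\<alpha>. norm (c n \<alpha> - a \<alpha>)) F"
        unfolding L2_set_def by (intro tendsto_intros a)
      show "\<exists>N. \<forall>m\<ge>N. L2_set (\<lambda>\<alpha>. norm (c n \<alpha> - c m \<alpha>)) F \<le> e"
        using N n l2n_finite[OF diff F] by (meson less_imp_le order_trans)
    qed
    then show ?thesis using square_summableI_bound[of "\<lambda>\<alpha>. c _ \<alpha> - a \<alpha>" e] by blast
  qed
  obtain n where n: "square_summable (\<lambda>\<alpha>. c n \<alpha> - a \<alpha>)" using key[of 1] by auto
  have "square_summable (\<lambda>\<alpha>. - (c n \<alpha> - a \<alpha>))" using n by (simp add: square_summable_def norm_minus_commute)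
  from square_summable_add[OF ss[of n] this] have "square_summable a" by simp
  then show ?thesis using key by blast
qed

definition da_inner :: "('d::finite, 'e::chilbert_space) drury_arveson \<Rightarrow> ('d, 'e) drury_arveson \<Rightarrow> complex"
  where "da_inner f g = (\<Sum>\<^sub>\<infinity>\<alpha>. cinner (da_coeff f \<alpha>) (da_coeff g \<alpha>))"

instantiation drury_arveson :: (finite, chilbert_space) complex_normed_vector
begin

definition zero_drury_arveson :: "('a, 'b) drury_arveson"
  where "0 = Abs_da (\<lambda>Z\<in>nc_ball. 0\<^sub>m (nc_dim Z) (nc_dim Z))"
definition plus_drury_arveson :: "('a, 'b) drury_arveson \<Rightarrow> ('a, 'b) drury_arveson \<Rightarrow> ('a, 'b) drury_arveson"
  where "f + g = Abs_da (\<lambda>Z\<in>nc_ball. da_fun f Z + da_fun g Z)"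
definition scaleC_drury_arveson :: "complex \<Rightarrow> ('a, 'b) drury_arveson \<Rightarrow> ('a, 'b) drury_arveson"
  where "a *\<^sub>C f = Abs_da (\<lambda>Z\<in>nc_ball. map_mat (scaleC a) (da_fun f Z))"
definition scaleR_drury_arveson :: "real \<Rightarrow> ('a, 'b) drury_arveson \<Rightarrow> ('a, 'b) drury_arveson"
  where "r *\<^sub>R f = complex_of_real r *\<^sub>C (f :: ('a, 'b) drury_arveson)"
definition uminus_drury_arveson :: "('a, 'b) drury_arveson \<Rightarrow> ('a, 'b) drury_arveson"
  where "- f = (- 1) *\<^sub>C (f :: ('a, 'b) drury_arveson)"
definition minus_drury_arveson :: "('a, 'b) drury_arveson \<Rightarrow> ('a, 'b) drury_arveson \<Rightarrow> ('a, 'b) drury_arveson"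
  where "f - g = f + - (g :: ('a, 'b) drury_arveson)"
definition norm_drury_arveson :: "('a, 'b) drury_arveson \<Rightarrow> real"
  where "norm f = sqrt (Re (da_inner f (f :: ('a, 'b) drury_arveson)))"
definition dist_drury_arveson :: "('a, 'b) drury_arveson \<Rightarrow> ('a, 'b) drury_arveson \<Rightarrow> real"
  where "dist f g = norm (f - (g :: ('a, 'b) drury_arveson))"
definition sgn_drury_arveson :: "('a, 'b) drury_arveson \<Rightarrow> ('a, 'b) drury_arveson"
  where "sgn f = inverse (norm f) *\<^sub>R (f :: ('a, 'b) drury_arveson)"
definition uniformity_drury_arveson :: "(('a, 'b) drury_arveson \<times> ('a, 'b) drury_arveson) filter"
  where "uniformity = (INF e\<in>{0<..}. principal {(x :: ('a, 'b) drury_arveson, y). dist x y < e})"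
definition open_drury_arveson :: "('a, 'b) drury_arveson set \<Rightarrow> bool"
  where "open U = (\<forall>x\<in>U. eventually (\<lambda>(x' :: ('a, 'b) drury_arveson, y). x' = x \<longrightarrow> y \<in> U) uniformity)"

lemma da_coeff_zero: "da_coeff (0 :: ('a, 'b) drury_arveson) = (\<lambda>_. 0)"
  unfolding zero_drury_arveson_def nc_series_zero by (rule da_coeff_Abs_series[OF square_summable_0])

lemma da_coeff_plus: "da_coeff (f + g :: ('a, 'b) drury_arveson) = (\<lambda>\<alpha>. da_coeff f \<alpha> + da_coeff g \<alpha>)"
  unfolding plus_drury_arveson_def da_coeff(2) nc_series_add[OF da_coeff(1) da_coeff(1)]
  by (intro da_coeff_Abs_series square_summable_add da_coeff(1))

lemma da_coeff_scaleC: "da_coeff (a *\<^sub>C f :: ('a, 'b) drury_arveson) = (\<lambda>\<alpha>. a *\<^sub>C da_coeff f \<alpha>)"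
  unfolding scaleC_drury_arveson_def da_coeff(2) nc_series_scaleC[OF da_coeff(1)]
  by (intro da_coeff_Abs_series square_summable_scaleC da_coeff(1))

lemma da_coeff_scaleR: "da_coeff (r *\<^sub>R f :: ('a, 'b) drury_arveson) = (\<lambda>\<alpha>. r *\<^sub>R da_coeff f \<alpha>)"
  by (simp add: scaleR_drury_arveson_def da_coeff_scaleC scaleR_scaleC)

lemma da_coeff_uminus: "da_coeff (- f :: ('a, 'b) drury_arveson) = (\<lambda>\<alpha>. - da_coeff f \<alpha>)"
  by (simp add: uminus_drury_arveson_def da_coeff_scaleC scaleC_one)

lemma da_coeff_minus: "da_coeff (f - g :: ('a, 'b) drury_arveson) = (\<lambda>\<alpha>. da_coeff f \<alpha> - da_coeff g \<alpha>)"
  by (simp add: minus_drury_arveson_def da_coeff_plus da_coeff_uminus)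

lemmas da_coeff_ops = da_coeff_zero da_coeff_plus da_coeff_scaleC da_coeff_scaleR da_coeff_uminus da_coeff_minus

lemma norm_da_l2n: "norm (f :: ('a, 'b) drury_arveson) = l2n (da_coeff f)"
proof -
  have "((\<lambda>\<alpha>. complex_of_real ((norm (da_coeff f \<alpha>))\<^sup>2)) has_sum
      complex_of_real (\<Sum>\<^sub>\<infinity>\<alpha>. (norm (da_coeff f \<alpha>))\<^sup>2)) UNIV"
    using da_coeff(1)[of f] unfolding square_summable_def
    by (intro has_sum_of_real has_sum_infsum)
  then have "da_inner f f = complex_of_real (\<Sum>\<^sub>\<infinity>\<alpha>. (norm (da_coeff f \<alpha>))\<^sup>2)"
    unfolding da_inner_def cinner_self by (rule infsumI)
  then show ?thesis by (simp add: norm_drury_arveson_def l2n_def)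
qed

instance
proof
  fix f g h :: "('a, 'b) drury_arveson" and a b :: complex and r s :: real
  show "f + g + h = f + (g + h)" "f + g = g + f" "0 + f = f" "- f + f = 0" "f - g = f + - g"
    by (intro da_eqI; simp add: da_coeff_ops algebra_simps)+
  show "a *\<^sub>C (f + g) = a *\<^sub>C f + a *\<^sub>C g" "(a + b) *\<^sub>C f = a *\<^sub>C f + b *\<^sub>C f"
    "a *\<^sub>C b *\<^sub>C f = (a * b) *\<^sub>C f"
    by (intro da_eqI; simp add: da_coeff_ops scaleC_add_left scaleC_add_right scaleC_scaleC)+
  show "r *\<^sub>R (f + g) = r *\<^sub>R f + r *\<^sub>R g" "(r + s) *\<^sub>R f = r *\<^sub>R f + s *\<^sub>R f"
    "r *\<^sub>R s *\<^sub>R f = (r * s) *\<^sub>R f" "1 *\<^sub>R f = f"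
    by (intro da_eqI; simp add: da_coeff_ops scaleR_add_left scaleR_add_right)+
  show "r *\<^sub>R f = complex_of_real r *\<^sub>C f" by (rule scaleR_drury_arveson_def)
  show "dist f g = norm (f - g)" by (rule dist_drury_arveson_def)
  show "sgn f = inverse (norm f) *\<^sub>R f" by (rule sgn_drury_arveson_def)
  show "uniformity = (INF e\<in>{0<..}. principal {(x :: ('a, 'b) drury_arveson, y). dist x y < e})"
    by (rule uniformity_drury_arveson_def)
  show "open U = (\<forall>x\<in>U. eventually (\<lambda>(x', y). x' = x \<longrightarrow> y \<in> U) uniformity)"
    for U :: "('a, 'b) drury_arveson set"
    by (rule open_drury_arveson_def)
  show "norm (f + g) \<le> norm f + norm g"
    unfolding norm_da_l2n da_coeff_plus by (intro l2n_triangle da_coeff(1))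
  show normC: "norm (a *\<^sub>C f) = cmod a * norm f" for a and f :: "('a, 'b) drury_arveson"
  proof -
    have "(\<Sum>\<^sub>\<infinity>\<alpha>. (norm (a *\<^sub>C da_coeff f \<alpha>))\<^sup>2) = (cmod a)\<^sup>2 * (\<Sum>\<^sub>\<infinity>\<alpha>. (norm (da_coeff f \<alpha>))\<^sup>2)"
      unfolding norm_scaleC power_mult_distrib by (rule infsum_cmult_right')
    then show ?thesis
      unfolding norm_da_l2n da_coeff_scaleC l2n_def by (simp add: real_sqrt_mult)
  qed
  show "norm (r *\<^sub>R f) = \<bar>r\<bar> * norm f"
    unfolding scaleR_drury_arveson_def by (simp add: normC)
  show "(norm f = 0) = (f = 0)"
  proof
    assume "norm f = 0"
    then have "da_coeff f \<alpha> = 0" for \<alpha>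
      using norm_le_l2n[OF da_coeff(1), of f \<alpha>] by (simp add: norm_da_l2n)
    then show "f = 0" by (intro da_eqI) (auto simp: da_coeff_zero)
  qed (simp add: norm_da_l2n da_coeff_zero l2n_def)
qed

end

instantiation drury_arveson :: (finite, chilbert_space) chilbert_space
begin

definition cinner_drury_arveson :: "('a, 'b) drury_arveson \<Rightarrow> ('a, 'b) drury_arveson \<Rightarrow> complex"
  where "cinner_drury_arveson = da_inner"

instance
proof
  fix f g h :: "('a, 'b) drury_arveson" and a :: complex
  show "cinner (f + g) h = cinner f h + cinner g h"
    unfolding cinner_drury_arveson_def da_inner_def da_coeff_plus cinner_add_left
    by (intro infsum_add cinner_summable da_coeff(1))
  show "cinner (a *\<^sub>C f) g = a * cinner f g"
    unfolding cinner_drury_arveson_def da_inner_def da_coeff_scaleC cinner_scaleC_left by (rule infsum_cmult_right')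
  show "cinner f g = cnj (cinner g f)"
    unfolding cinner_drury_arveson_def da_inner_def infsum_cnj[symmetric]
    by (intro infsum_cong cinner_commute)
  show "norm f = sqrt (Re (cinner f f))"
    unfolding cinner_drury_arveson_def by (rule norm_drury_arveson_def)
next
  fix F :: "nat \<Rightarrow> ('a, 'b) drury_arveson" assume F: "Cauchy F"
  have dist_l2n: "dist f g = l2n (\<lambda>\<alpha>. da_coeff f \<alpha> - da_coeff g \<alpha>)" for f g :: "('a, 'b) drury_arveson"
    unfolding dist_drury_arveson_def norm_da_l2n da_coeff_minus ..
  have "\<exists>a. square_summable a \<and> (\<forall>e>0. \<exists>N. \<forall>n\<ge>N. l2n (\<lambda>\<alpha>. da_coeff (F n) \<alpha> - a \<alpha>) \<le> e)"
    using F by (intro l2_complete da_coeff(1)) (auto simp: Cauchy_def dist_l2n[symmetric])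
  then obtain a where a: "square_summable a"
    and lim: "\<And>e. e > 0 \<Longrightarrow> \<exists>N. \<forall>n\<ge>N. l2n (\<lambda>\<alpha>. da_coeff (F n) \<alpha> - a \<alpha>) \<le> e" by blast
  have "F \<longlonglongrightarrow> Abs_da (nc_series a)"
    unfolding lim_sequentially dist_l2n da_coeff_Abs_series[OF a]
  proof (intro allI impI)
    fix e :: real assume "e > 0"
    then show "\<exists>no. \<forall>n\<ge>no. l2n (\<lambda>\<alpha>. da_coeff (F n) \<alpha> - a \<alpha>) < e"
      using lim[of "e / 2"] by (metis field_sum_of_halves half_gt_zero less_add_same_cancel1 order.strict_trans1)
  qed
  then show "convergent F" by (auto simp: convergent_def)
qed

end


section \<open>Operators\<close>

text \<open>For an operator with an adjoint (in particular for every bounded operator on a Hilbert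
space) \<open>cadjoint T\<close> is that adjoint.\<close>

definition cadjoint :: "('a::chilbert_space \<Rightarrow> 'b::chilbert_space) \<Rightarrow> 'b \<Rightarrow> 'a"
  where "cadjoint T = (SOME S. \<forall>f g. cinner (T f) g = cinner f (S g))"

definition orth_proj :: "'a::chilbert_space set \<Rightarrow> 'a \<Rightarrow> 'a"
  where "orth_proj Q f = (THE g. g \<in> Q \<and> (\<forall>h\<in>Q. cinner (f - g) h = 0))"

text \<open>Operators on a subspace \<open>Q\<close> are functions on the whole type of which only the values on
\<open>Q\<close> matter.\<close>

definition bounded_ops_on :: "'a::complex_normed_vector set \<Rightarrow> ('a \<Rightarrow> 'a) set"
  where "bounded_ops_on Q = {X.
    (\<forall>f\<in>Q. X f \<in> Q) \<and>
    (\<forall>f\<in>Q. \<forall>g\<in>Q. X (f + g) = X f + X g) \<and>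
    (\<forall>a. \<forall>f\<in>Q. X (a *\<^sub>C f) = a *\<^sub>C X f) \<and>
    (\<exists>K. \<forall>f\<in>Q. norm (X f) \<le> K * norm f)}"

definition onorm_on :: "'a::real_normed_vector set \<Rightarrow> ('a \<Rightarrow> 'b::real_normed_vector) \<Rightarrow> real"
  where "onorm_on Q X = (SUP f\<in>Q. norm (X f) / norm f)"

lemma onorm_on_UNIV: "onorm_on UNIV X = onorm X"
  by (simp add: onorm_on_def onorm_def)

definition right_shift :: "'d::finite \<Rightarrow> ('d, 'e::chilbert_space) drury_arveson \<Rightarrow> ('d, 'e) drury_arveson"
  where "right_shift i f = Abs_da (\<lambda>Z\<in>nc_ball. Matrix.mat (nc_dim Z) (nc_dim Z)
    (\<lambda>(k, l). \<Sum>\<^sub>\<infinity>\<alpha>. nc_word Z (\<alpha> @ [i]) $$ (k, l) *\<^sub>C da_coeff f \<alpha>))"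

definition right_shift_coinvariant :: "('d::finite, 'e::chilbert_space) drury_arveson set \<Rightarrow> bool"
  where "right_shift_coinvariant Q \<longleftrightarrow> (\<forall>i. cadjoint (right_shift i) ` Q \<subseteq> Q)"

text \<open>The product of a matrix of operators with a matrix of vectors, as for the corresponding
operators on the Hilbert space tensor products with $\mathbb{C}^n$.\<close>

definition cblin_mat_mult :: "('a::complex_normed_vector, 'b::complex_normed_vector) cblin mat \<Rightarrow> 'a mat \<Rightarrow> 'b mat"
  where "cblin_mat_mult M A = Matrix.mat (dim_row M) (dim_col A)
    (\<lambda>(i, j). \<Sum>k<dim_row A. cblin_apply (M $$ (i, k)) (A $$ (k, j)))"

definition mult_fun :: "(('d::finite \<Rightarrow> complex mat) \<Rightarrow> ('e::chilbert_space, 'e) cblin mat)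
    \<Rightarrow> ('d, 'e) drury_arveson \<Rightarrow> ('d \<Rightarrow> complex mat) \<Rightarrow> 'e mat"
  where "mult_fun \<Phi> f = (\<lambda>W\<in>nc_ball. cblin_mat_mult (\<Phi> W) (da_fun f W))"

definition left_multipliers :: "(('d::finite \<Rightarrow> complex mat) \<Rightarrow> ('e::chilbert_space, 'e) cblin mat) set"
  where "left_multipliers = {\<Phi>. nc_function \<Phi> \<and> (\<forall>f. mult_fun \<Phi> f \<in> range da_fun)}"

definition mult_op :: "(('d::finite \<Rightarrow> complex mat) \<Rightarrow> ('e::chilbert_space, 'e) cblin mat)
    \<Rightarrow> ('d, 'e) drury_arveson \<Rightarrow> ('d, 'e) drury_arveson"
  where "mult_op \<Phi> f = Abs_da (mult_fun \<Phi> f)"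

lemma da_fun_mult_op: "\<Phi> \<in> left_multipliers \<Longrightarrow> da_fun (mult_op \<Phi> f) = mult_fun \<Phi> f"
  unfolding mult_op_def left_multipliers_def by (auto simp: f_inv_into_f dest!: spec[of _ f] simp: da_fun_inverse)

lemma has_sum_shift:
  fixes g :: "'d list \<Rightarrow> 'b::topological_comm_monoid_add"
  assumes "\<And>\<beta>. \<beta> = [] \<or> last \<beta> \<noteq> i \<Longrightarrow> g \<beta> = 0"
  shows "(g has_sum s) UNIV \<longleftrightarrow> ((\<lambda>\<alpha>. g (\<alpha> @ [i])) has_sum s) UNIV"
proof -
  have "(g has_sum s) UNIV \<longleftrightarrow> (g has_sum s) (range (\<lambda>\<alpha>. \<alpha> @ [i]))"
  proof (rule has_sum_cong_neutral)
    fix \<beta> assume "\<beta> \<in> UNIV - range (\<lambda>\<alpha>. \<alpha> @ [i])"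
    then have "\<beta> = [] \<or> last \<beta> \<noteq> i" by (metis DiffE append_butlast_last_id rangeI)
    then show "g \<beta> = 0" by (rule assms)
  qed auto
  also have "\<dots> \<longleftrightarrow> ((\<lambda>\<alpha>. g (\<alpha> @ [i])) has_sum s) UNIV"
    by (subst has_sum_reindex) (auto simp: inj_on_def comp_def)
  finally show ?thesis .
qed

lemma right_shift_coeffs:
  defines "sc i c \<equiv> (\<lambda>\<beta>. if \<beta> \<noteq> [] \<and> last \<beta> = i then c (butlast \<beta>) else 0)"
  shows "right_shift i f = Abs_da (nc_series (sc i (da_coeff f)))"
    and "da_coeff (right_shift i f) = sc i (da_coeff f)"
proof -
  let ?c = "sc i (da_coeff f)"
  have app: "?c (\<alpha> @ [i]) = da_coeff f \<alpha>" for \<alpha> by (simp add: sc_def)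
  have zero: "\<beta> = [] \<or> last \<beta> \<noteq> i \<Longrightarrow> ?c \<beta> = 0" for \<beta> by (auto simp: sc_def)
  have "(\<lambda>\<beta>. (norm (?c \<beta>))\<^sup>2) summable_on UNIV \<longleftrightarrow> (\<lambda>\<alpha>. (norm (?c (\<alpha> @ [i])))\<^sup>2) summable_on UNIV"
    unfolding summable_on_def by (subst has_sum_shift[where i = i]) (auto simp: zero)
  then have ss: "square_summable ?c"
    using da_coeff(1)[of f] by (simp add: square_summable_def app)
  have eq: "(\<Sum>\<^sub>\<infinity>\<alpha>. nc_word Z (\<alpha> @ [i]) $$ (k, l) *\<^sub>C da_coeff f \<alpha>) = (\<Sum>\<^sub>\<infinity>\<beta>. nc_word Z \<beta> $$ (k, l) *\<^sub>C ?c \<beta>)" for Z k l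
  proof -
    have "((\<lambda>\<beta>. nc_word Z \<beta> $$ (k, l) *\<^sub>C ?c \<beta>) has_sum s) UNIV \<longleftrightarrow>
      ((\<lambda>\<alpha>. nc_word Z (\<alpha> @ [i]) $$ (k, l) *\<^sub>C ?c (\<alpha> @ [i])) has_sum s) UNIV" for s
      by (rule has_sum_shift) (simp add: zero)
    then have H: "((\<lambda>\<beta>. nc_word Z \<beta> $$ (k, l) *\<^sub>C ?c \<beta>) has_sum s) UNIV \<longleftrightarrow>
      ((\<lambda>\<alpha>. nc_word Z (\<alpha> @ [i]) $$ (k, l) *\<^sub>C da_coeff f \<alpha>) has_sum s) UNIV" for s
      unfolding app .
    show ?thesis
    proof (cases "(\<lambda>\<beta>. nc_word Z \<beta> $$ (k, l) *\<^sub>C ?c \<beta>) summable_on UNIV")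
      case True
      show ?thesis by (rule infsumI[OF iffD1[OF H has_sum_infsum[OF True]]])
    next
      case False
      moreover have "\<not> (\<lambda>\<alpha>. nc_word Z (\<alpha> @ [i]) $$ (k, l) *\<^sub>C da_coeff f \<alpha>) summable_on UNIV"
        using False by (simp add: summable_on_def H)
      ultimately show ?thesis by (simp add: infsum_not_exists)
    qed
  qed
  show 1: "right_shift i f = Abs_da (nc_series ?c)"
    unfolding right_shift_def nc_series_def eq ..
  show "da_coeff (right_shift i f) = ?c" unfolding 1 by (rule da_coeff_Abs_series[OF ss])
qed

lemma cadjoint_eqI:
  assumes "\<And>f g. cinner (T f) g = cinner f (S g)"
  shows "cadjoint T = S"
proof -
  have ex: "\<forall>f g. cinner (T f) g = cinner f (cadjoint T g)"
    unfolding cadjoint_def by (rule someI[of _ S]) (use assms in auto)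
  have "cadjoint T g = S g" for g
  proof -
    let ?d = "cadjoint T g - S g"
    have "cinner ?d (cadjoint T g) = cinner ?d (S g)" using ex assms by metis
    moreover have "cinner ?d (cadjoint T g) = cinner ?d ?d + cinner ?d (S g)"
      by (simp flip: cinner_add_right)
    ultimately have "cinner ?d ?d = 0" by simp
    then show ?thesis by (simp add: cinner_self)
  qed
  then show ?thesis by blast
qed

lemma cadjoint_right_shift:
  "cadjoint (right_shift i) g = Abs_da (nc_series (\<lambda>\<alpha>. da_coeff g (\<alpha> @ [i])))"
  "da_coeff (cadjoint (right_shift i) g) = (\<lambda>\<alpha>. da_coeff g (\<alpha> @ [i]))"
proof -
  let ?S = "\<lambda>g. Abs_da (nc_series (\<lambda>\<alpha>. da_coeff g (\<alpha> @ [i])))"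
  have ss: "square_summable (\<lambda>\<alpha>. da_coeff g (\<alpha> @ [i]))" for g
  proof -
    have "(\<lambda>\<beta>. (norm (da_coeff g \<beta>))\<^sup>2) summable_on range (\<lambda>\<alpha>. \<alpha> @ [i])"
      using da_coeff(1)[of g] unfolding square_summable_def by (rule summable_on_subset_banach) auto
    then show ?thesis
      unfolding square_summable_def by (subst (asm) summable_on_reindex) (auto simp: inj_on_def comp_def)
  qed
  have adj: "cinner (right_shift i f) g = cinner f (?S g)" for f g
  proof -
    have "((\<lambda>\<beta>. cinner (da_coeff (right_shift i f) \<beta>) (da_coeff g \<beta>)) has_sum cinner (right_shift i f) g) UNIV"
      unfolding cinner_drury_arveson_def da_inner_def by (intro has_sum_infsum cinner_summable da_coeff(1))
    then have "((\<lambda>\<alpha>. cinner (da_coeff f \<alpha>) (da_coeff g (\<alpha> @ [i]))) has_sum cinner (right_shift i f) g) UNIV"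
      by (subst (asm) has_sum_shift[where i = i]) (auto simp: right_shift_coeffs(2))
    then show ?thesis
      unfolding cinner_drury_arveson_def da_inner_def[of f] da_coeff_Abs_series[OF ss] by (rule infsumI[symmetric])
  qed
  show 1: "cadjoint (right_shift i) g = ?S g"
    by (simp only: cadjoint_eqI[of "right_shift i" ?S, OF adj])
  show "da_coeff (cadjoint (right_shift i) g) = (\<lambda>\<alpha>. da_coeff g (\<alpha> @ [i]))"
    unfolding 1 by (rule da_coeff_Abs_series[OF ss])
qed

end

theory Submission
  imports Defs "HOL-Analysis.Elementary_Normed_Spaces"
begin

text \<open>Writing \<open>R\<^sub>i\<close> for the right shifts, a bounded operator commuting with all \<open>R\<^sub>i\<close> is multiplication by
the nc function whose value on \<open>x\<close> is the image of the constant function \<open>x\<close>. So it suffices to lift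
\<open>A = X P\<close> to an operator \<open>M\<close> of the same norm with \<open>P M = A\<close> that commutes with the \<open>R\<^sub>i\<close>. If \<open>P\<close> projects onto
the co-invariant \<open>Q\<close>, then \<open>Q \<subseteq> Q' = E \<oplus> (\<Oplus>\<^sub>i R\<^sub>i Q)\<close> is again co-invariant, with projection \<open>P'\<close>, and an operator
\<open>A'\<close> into \<open>Q'\<close> with \<open>P A' = A\<close> satisfies \<open>A' R\<^sub>i = P' R\<^sub>i A'\<close> as soon as \<open>A' R\<^sub>i = R\<^sub>i A\<close>; such an
\<open>A'\<close> exists by Parrott's lemma. Iterating gives operators whose compressions are compatible and which
converge strongly to \<open>M\<close>.\<close>

section \<open>Complex linear maps and inner products\<close>

abbreviation clinear :: "('a::complex_vector \<Rightarrow> 'b::complex_vector) \<Rightarrow> bool"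
  where "clinear \<equiv> Vector_Spaces.linear scaleC scaleC"

lemma clinearI:
  assumes "\<And>x y. f (x + y) = f x + f y" "\<And>a x. f (a *\<^sub>C x) = a *\<^sub>C f x"
  shows "clinear f"
  using assms by (auto simp: Vector_Spaces.linear_iff intro: complex_vector.vector_space_axioms)

lemma clinear_simps:
  assumes "clinear f"
  shows clinear_add: "f (x + y) = f x + f y"
    and clinear_scaleC: "f (a *\<^sub>C x) = a *\<^sub>C f x"
    and clinear_diff: "f (x - y) = f x - f y"
    and clinear_0: "f 0 = 0"
    and clinear_sum: "f (sum g I) = (\<Sum>i\<in>I. f (g i))"
proof -
  interpret Vector_Spaces.linear scaleC scaleC f by (rule assms)
  show "f (x + y) = f x + f y" "f (a *\<^sub>C x) = a *\<^sub>C f x" "f (x - y) = f x - f y" "f 0 = 0"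
    "f (sum g I) = (\<Sum>i\<in>I. f (g i))"
    by (rule add scale diff zero sum)+
qed

lemma bounded_clinearI:
  assumes f: "clinear f" and bound: "\<And>x. norm (f x) \<le> K * norm x"
  shows "bounded_clinear f"
  unfolding bounded_clinear_def
  by (auto simp: clinear_simps[OF f] scaleR_scaleC bound mult.commute intro!: bounded_linear_intro[where K = K])

lemma bounded_clinear_clinear: "bounded_clinear f \<Longrightarrow> clinear f"
  by (auto simp: bounded_clinear_def linear_add dest: bounded_linear.linear intro!: clinearI)

lemma cinner_minus_left: "cinner (x - y) z = cinner x z - cinner y (z::'a::chilbert_space)"
  using cinner_add_left[of "x - y" y z] by simp

lemma cinner_minus_right: "cinner z (x - y) = cinner z x - cinner z (y::'a::chilbert_space)"
  using cinner_add_right[of z "x - y" y] by simp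

lemma cinner_sum_left: "cinner (sum f I) z = (\<Sum>i\<in>I. cinner (f i) (z::'a::chilbert_space))"
  by (induction I rule: infinite_finite_induct) (auto simp: cinner_add_left)

lemma cinner_sum_right: "cinner z (sum f I) = (\<Sum>i\<in>I. cinner (z::'a::chilbert_space) (f i))"
  by (induction I rule: infinite_finite_induct) (auto simp: cinner_add_right)

lemma cinner_eqI:
  fixes x y :: "'a::chilbert_space"
  assumes "\<And>z. cinner z x = cinner z y"
  shows "x = y"
proof -
  have "cinner (x - y) (x - y) = 0" by (simp add: cinner_minus_right assms)
  then show ?thesis by (simp add: cinner_self)
qed

lemma norm_sq_cinner: "(norm x)\<^sup>2 = Re (cinner x (x::'a::chilbert_space))"
  by (simp add: cinner_self)

lemma norm_sq_add_orthogonal: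
  fixes x y :: "'a::chilbert_space"
  assumes "cinner x y = 0"
  shows "(norm (x + y))\<^sup>2 = (norm x)\<^sup>2 + (norm y)\<^sup>2"
proof -
  have "cinner y x = 0" using assms cinner_commute[of y x] by simp
  then show ?thesis by (simp add: norm_sq_cinner cinner_add_left cinner_add_right assms)
qed

section \<open>Extension of contractions on semi-inner product spaces\<close>

locale semi_inner =
  fixes B :: "'a::complex_vector \<Rightarrow> 'a \<Rightarrow> complex"
  assumes add_left: "B (x + y) z = B x z + B y z"
    and scaleC_left: "B (a *\<^sub>C x) y = a * B x y"
    and commute: "B x y = cnj (B y x)"
    and nonneg: "Re (B x x) \<ge> 0"
begin

lemma add_right: "B x (y + z) = B x y + B x z"
  by (metis add_left commute complex_cnj_add)

lemma scaleC_right: "B x (a *\<^sub>C y) = cnj a * B x y"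
  by (metis scaleC_left commute complex_cnj_mult)

lemma diff_left: "B (x - y) z = B x z - B y z"
  using add_left[of "x - y" y z] by simp

lemma diff_right: "B x (y - z) = B x y - B x z"
  using add_right[of x "y - z" z] by simp

lemma zero_left [simp]: "B 0 y = 0" using diff_left[of 0 0 y] by simp

definition seminorm :: "'a \<Rightarrow> real" where "seminorm x = sqrt (Re (B x x))"

lemma seminorm_nonneg: "seminorm x \<ge> 0" by (simp add: seminorm_def nonneg)

lemma seminorm_sq: "(seminorm x)\<^sup>2 = Re (B x x)" by (simp add: seminorm_def nonneg)

lemma quadratic: "Re (B (x - a *\<^sub>C y) (x - a *\<^sub>C y))
    = Re (B x x) - 2 * Re (cnj a * B x y) + (cmod a)\<^sup>2 * Re (B y y)"
proof -
  have "B y x = cnj (B x y)" by (rule commute)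
  moreover have "Im (B y y) = 0" using commute[of y y] by (metis cnj.simps(2) neg_equal_zero)
  ultimately show ?thesis
    by (simp add: diff_left diff_right scaleC_left scaleC_right cmod_power2 algebra_simps)
      (simp add: power2_eq_square)
qed

text \<open>Minimality at \<open>a = s * B x y\<close> with real \<open>s\<close> reads
  \<open>2 * s * b <= e^2 + s^2 * b * Re (B y y)\<close> for \<open>b = |B x y|^2\<close>, and the
  best \<open>s\<close> gives the claim. The slack \<open>e\<close> is there because a minimum need
  not be attained.\<close>

lemma near_minimal_imp_near_orthogonal:
  assumes min: "\<And>a. Re (B x x) \<le> Re (B (x - a *\<^sub>C y) (x - a *\<^sub>C y)) + e\<^sup>2" and e: "e \<ge> 0"
  shows "cmod (B x y) \<le> e * seminorm y"
proof -
  define b where "b = (cmod (B x y))\<^sup>2"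
  have b: "b \<ge> 0" by (simp add: b_def)
  have le: "2 * s * b \<le> e\<^sup>2 + s\<^sup>2 * b * Re (B y y)" for s
  proof -
    have "cnj (of_real s * B x y) * B x y = of_real (s * b)"
      unfolding b_def by (simp only: complex_cnj_mult complex_cnj_complex_of_real of_real_mult complex_norm_square mult_ac)
    then have "Re (cnj (of_real s * B x y) * B x y) = s * b" by (simp only: Re_complex_of_real)
    then show ?thesis
      using min[of "of_real s * B x y"] unfolding quadratic
      by (simp add: norm_mult power_mult_distrib b_def)
  qed
  have "b \<le> e\<^sup>2 * Re (B y y)"
  proof (cases "Re (B y y) = 0")
    case True
    have "b = 0"
    proof (rule ccontr)
      assume "b \<noteq> 0"
      \<comment> \<open>For a null vector \<open>y\<close> the right side does not depend on
        \<open>s\<close>, so a large \<open>s\<close> refutes \<open>b \<noteq> 0\<close>.\<close>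
      then show False using le[of "(e\<^sup>2 + 1) / b"] True zero_le_power2[of e] by simp
    qed
    then show ?thesis using True by simp
  next
    case False
    then have "Re (B y y) > 0" using nonneg[of y] by simp
    then show ?thesis using le[of "1 / Re (B y y)"] by (simp add: power2_eq_square field_simps)
  qed
  then have "(cmod (B x y))\<^sup>2 \<le> (e * seminorm y)\<^sup>2" by (simp add: b_def power_mult_distrib seminorm_sq)
  then show ?thesis by (rule power2_le_imp_le) (simp add: e seminorm_nonneg)
qed

text \<open>By positivity every \<open>x\<close> is minimal up to its own squared seminorm, so this
  is the case \<open>e = seminorm x\<close>.\<close>

lemma Cauchy_Schwarz: "cmod (B x y) \<le> seminorm x * seminorm y"
  by (rule near_minimal_imp_near_orthogonal) (auto simp: seminorm_sq nonneg seminorm_nonneg)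

text \<open>The extension is the composition of \<open>C\<close> with the orthogonal projection onto (the completion
of) \<open>L\<close>. Since \<open>B\<close> may be degenerate and \<open>L\<close> incomplete, the projection of \<open>h\<close> is replaced by
elements of \<open>L\<close> from which \<open>h\<close> differs almost orthogonally to \<open>L\<close>.\<close>

lemma contraction_extension:
  fixes C :: "'a \<Rightarrow> 'b::{complex_normed_vector, banach}"
  assumes L: "complex_vector.subspace L" and C: "clinear C"
    and bound: "\<And>l. l \<in> L \<Longrightarrow> norm (C l) \<le> seminorm l"
  shows "\<exists>D. clinear D \<and> (\<forall>l\<in>L. D l = C l) \<and> (\<forall>h. norm (D h) \<le> seminorm h) \<and> (\<forall>h. D h \<in> closure (C ` L))"
proof -
  \<comment> \<open>\<open>G h v\<close> says that \<open>v\<close> is a limit of values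
    \<open>C l\<close> at approximate projections \<open>l\<close> of \<open>h\<close>. It is the
    graph of the extension; linearity, bound and uniqueness are proved for this relation before
    existence.\<close>
  define G where "G h v \<longleftrightarrow> (\<forall>e>0. \<exists>l\<in>L. (\<forall>l'\<in>L. cmod (B (h - l) l') \<le> e * seminorm l') \<and> norm (C l - v) \<le> e)" for h v
  note Lsub = complex_vector.subspace_add[OF L] complex_vector.subspace_diff[OF L] complex_vector.subspace_scale[OF L]
  have G_add: "G (h + h') (v + v')" if "G h v" "G h' v'" for h h' v v'
    unfolding G_def
  proof (intro allI impI)
    fix e :: real assume "e > 0"
    then have e: "e / 2 > 0" by simp
    obtain l where l: "l \<in> L" "\<forall>l'\<in>L. cmod (B (h - l) l') \<le> e / 2 * seminorm l'" "norm (C l - v) \<le> e / 2"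
      using \<open>G h v\<close> e unfolding G_def by blast
    obtain m where m: "m \<in> L" "\<forall>l'\<in>L. cmod (B (h' - m) l') \<le> e / 2 * seminorm l'" "norm (C m - v') \<le> e / 2"
      using \<open>G h' v'\<close> e unfolding G_def by blast
    have "cmod (B (h + h' - (l + m)) l') \<le> e * seminorm l'" if "l' \<in> L" for l'
    proof -
      have "B (h + h' - (l + m)) l' = B (h - l) l' + B (h' - m) l'"
        by (simp add: add_left diff_left)
      then have "cmod (B (h + h' - (l + m)) l') \<le> cmod (B (h - l) l') + cmod (B (h' - m) l')"
        by (simp add: norm_triangle_ineq)
      also have "\<dots> \<le> e / 2 * seminorm l' + e / 2 * seminorm l'" using l m that by (intro add_mono) auto
      finally show ?thesis by simp
    qed
    moreover have "norm (C (l + m) - (v + v')) \<le> e"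
    proof -
      have "C (l + m) - (v + v') = (C l - v) + (C m - v')" by (simp add: clinear_add[OF C])
      then show ?thesis using norm_triangle_mono[OF l(3) m(3)] by (simp only: field_sum_of_halves)
    qed
    ultimately show "\<exists>l\<in>L. (\<forall>l'\<in>L. cmod (B (h + h' - l) l') \<le> e * seminorm l') \<and> norm (C l - (v + v')) \<le> e"
      using l(1) m(1) Lsub(1) by blast
  qed
  have G_scaleC: "G (a *\<^sub>C h) (a *\<^sub>C v)" if "G h v" for a h v
    unfolding G_def
  proof (intro allI impI)
    fix e :: real assume e: "e > 0"
    \<comment> \<open>Adding 1 keeps the divisor positive when \<open>a = 0\<close>.\<close>
    define d where "d = e / (cmod a + 1)"
    have d: "d > 0" using e by (simp add: d_def add_nonneg_pos)
    have "cmod a * d \<le> (cmod a + 1) * d" using d by simp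
    also have "\<dots> = e"
      unfolding d_def by (simp add: add_nonneg_eq_0_iff)
    finally have ad: "cmod a * d \<le> e" .
    obtain l where l: "l \<in> L" "\<forall>l'\<in>L. cmod (B (h - l) l') \<le> d * seminorm l'" "norm (C l - v) \<le> d"
      using \<open>G h v\<close> d unfolding G_def by blast
    have "cmod (B (a *\<^sub>C h - a *\<^sub>C l) l') \<le> e * seminorm l'" if "l' \<in> L" for l'
    proof -
      have "cmod (B (a *\<^sub>C h - a *\<^sub>C l) l') = cmod a * cmod (B (h - l) l')"
        by (simp flip: complex_vector.scale_right_diff_distrib add: scaleC_left norm_mult)
      also have "\<dots> \<le> cmod a * (d * seminorm l')" using l that by (intro mult_left_mono) auto
      also have "\<dots> \<le> e * seminorm l'"
        using ad seminorm_nonneg by (simp flip: mult.assoc add: mult_right_mono)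
      finally show ?thesis .
    qed
    moreover have "norm (C (a *\<^sub>C l) - a *\<^sub>C v) \<le> e"
    proof -
      have "norm (C (a *\<^sub>C l) - a *\<^sub>C v) = cmod a * norm (C l - v)"
        by (simp add: clinear_scaleC[OF C] norm_scaleC flip: complex_vector.scale_right_diff_distrib)
      also have "\<dots> \<le> cmod a * d" using l by (intro mult_left_mono) auto
      finally show ?thesis using ad by simp
    qed
    ultimately show "\<exists>l\<in>L. (\<forall>l'\<in>L. cmod (B (a *\<^sub>C h - l) l') \<le> e * seminorm l') \<and> norm (C l - a *\<^sub>C v) \<le> e"
      using l(1) Lsub(3) by blast
  qed
  have G_bound: "norm v \<le> seminorm h" if "G h v" for h v
  proof (rule field_le_epsilon)
    fix e :: real assume "e > 0"
    then have e: "e / 2 > 0" by simp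
    obtain l where l: "l \<in> L" "\<forall>l'\<in>L. cmod (B (h - l) l') \<le> e / 2 * seminorm l'" "norm (C l - v) \<le> e / 2"
      using \<open>G h v\<close> e unfolding G_def by blast
    \<comment> \<open>Testing almost orthogonality against \<open>l\<close> itself bounds the
      approximate projection by \<open>h\<close>.\<close>
    have "seminorm l * seminorm l = Re (B h l) - Re (B (h - l) l)"
      by (simp add: diff_left seminorm_sq flip: power2_eq_square)
    also have "\<dots> \<le> cmod (B h l) + cmod (B (h - l) l)"
      using complex_Re_le_cmod[of "B h l"] abs_Re_le_cmod[of "B (h - l) l"] by linarith
    also have "\<dots> \<le> seminorm h * seminorm l + e / 2 * seminorm l"
      using l by (intro add_mono Cauchy_Schwarz) auto
    also have "\<dots> = (seminorm h + e / 2) * seminorm l" by (simp add: distrib_right)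
    finally have "seminorm l \<le> seminorm h + e / 2"
      using seminorm_nonneg[of l] seminorm_nonneg[of h] e by (cases "seminorm l = 0") auto
    moreover have "norm v \<le> norm (C l) + norm (C l - v)" by (metis norm_minus_commute norm_triangle_sub)
    ultimately show "norm v \<le> seminorm h + e" using bound[OF l(1)] l(3) by simp
  qed
  have G_unique: "v = v'" if "G h v" "G h v'" for h v v'
  proof -
    \<comment> \<open>By linearity the difference is a value at 0, where the bound leaves only
      0.\<close>
    have "G (h + (-1) *\<^sub>C h) (v + (-1) *\<^sub>C v')" by (intro G_add G_scaleC that)
    then have "G 0 (v - v')" by (simp add: scaleC_one)
    then have "norm (v - v') \<le> seminorm 0" by (rule G_bound)
    then show ?thesis by (simp add: seminorm_def)
  qed
  have G_ex: "\<exists>v. G h v" for h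
  proof -
    define Q where "Q x = Re (B x x)" for x
    define d where "d = (INF l\<in>L. Q (h - l))"
    have bdd: "bdd_below ((\<lambda>l. Q (h - l)) ` L)" by (rule bdd_belowI2[of _ 0]) (simp add: Q_def nonneg)
    have d_le: "d \<le> Q (h - l)" if "l \<in> L" for l unfolding d_def by (rule cINF_lower[OF bdd that])
    \<comment> \<open>This yields a minimizing sequence for the squared distance from
      \<open>h\<close> to \<open>L\<close>; the excess is a square so that the orthogonality error
      becomes \<open>1 / Suc n\<close>.\<close>
    have "\<exists>l\<in>L. Q (h - l) < d + (1 / Suc n)\<^sup>2" for n
    proof -
      have "L \<noteq> {}" using complex_vector.subspace_0[OF L] by blast
      then show ?thesis unfolding d_def using bdd by (subst cINF_less_iff[symmetric]) auto
    qed
    then obtain l where l: "\<And>n. l n \<in> L" "\<And>n. Q (h - l n) < d + (1 / Suc n)\<^sup>2" by metis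
    have orth: "cmod (B (h - l n) l') \<le> 1 / Suc n * seminorm l'" if "l' \<in> L" for n l'
    proof (rule near_minimal_imp_near_orthogonal)
      fix a
      have "d \<le> Q (h - (l n + a *\<^sub>C l'))" using that l Lsub by (intro d_le) auto
      then show "Re (B (h - l n) (h - l n)) \<le> Re (B (h - l n - a *\<^sub>C l') (h - l n - a *\<^sub>C l')) + (1 / Suc n)\<^sup>2"
        using l(2)[of n] by (simp add: Q_def diff_diff_add)
    qed simp
    \<comment> \<open>The difference of two approximants lies in \<open>L\<close> and is also the
      difference of their residuals, so both residuals can be tested against it.\<close>
    have close: "seminorm (l m - l n) \<le> 1 / Suc m + 1 / Suc n" for m n
    proof -
      let ?x = "l m - l n"
      have x: "?x \<in> L" using l Lsub by auto
      have "seminorm ?x * seminorm ?x = Re (B (h - l n) ?x) - Re (B (h - l m) ?x)"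
        by (simp add: diff_left diff_right seminorm_sq flip: power2_eq_square)
      also have "\<dots> \<le> cmod (B (h - l n) ?x) + cmod (B (h - l m) ?x)"
        using complex_Re_le_cmod[of "B (h - l n) ?x"] abs_Re_le_cmod[of "B (h - l m) ?x"] by linarith
      also have "\<dots> \<le> (1 / Suc m + 1 / Suc n) * seminorm ?x"
        using orth[OF x, of n] orth[OF x, of m] by (simp add: distrib_right)
      finally show ?thesis using seminorm_nonneg[of ?x] by (cases "seminorm ?x = 0") auto
    qed
    have "Cauchy (\<lambda>n. C (l n))"
    proof (rule CauchyI)
      fix e :: real assume "e > 0"
      then obtain N where N: "1 / real (Suc N) < e / 2" using nat_approx_posE[of "e / 2"] by auto
      show "\<exists>M. \<forall>m\<ge>M. \<forall>n\<ge>M. norm (C (l m) - C (l n)) < e"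
      proof (intro exI allI impI)
        fix m n assume mn: "N \<le> m" "N \<le> n"
        have "norm (C (l m) - C (l n)) = norm (C (l m - l n))" by (simp add: clinear_diff[OF C])
        also have "\<dots> \<le> seminorm (l m - l n)" using l Lsub by (intro bound) auto
        also have "\<dots> \<le> 1 / Suc m + 1 / Suc n" by (rule close)
        also have "\<dots> \<le> 1 / Suc N + 1 / Suc N" using mn by (intro add_mono divide_left_mono) auto
        also have "\<dots> < e" using N by simp
        finally show "norm (C (l m) - C (l n)) < e" .
      qed
    qed
    then obtain v where v: "(\<lambda>n. C (l n)) \<longlonglongrightarrow> v" by (auto simp: Cauchy_convergent_iff convergent_def)
    have "G h v" unfolding G_def
    proof (intro allI impI)
      fix e :: real assume e: "e > 0"
      obtain N where N: "1 / real (Suc N) < e" using nat_approx_posE[OF e] by auto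
      obtain M where M: "\<forall>n\<ge>M. norm (C (l n) - v) < e" using LIMSEQ_D[OF v e] by blast
      let ?n = "max M N"
      have "1 / real (Suc ?n) \<le> 1 / Suc N" by (intro divide_left_mono) auto
      then have "1 / real (Suc ?n) \<le> e" using N by linarith
      then have "cmod (B (h - l ?n) l') \<le> e * seminorm l'" if "l' \<in> L" for l'
        using orth[OF that, of ?n] mult_right_mono[OF _ seminorm_nonneg] order.trans by blast
      moreover have "norm (C (l ?n) - v) \<le> e" using M by (simp add: less_imp_le)
      ultimately show "\<exists>l\<in>L. (\<forall>l'\<in>L. cmod (B (h - l) l') \<le> e * seminorm l') \<and> norm (C l - v) \<le> e"
        using l(1) by blast
    qed
    then show ?thesis ..
  qed
  define D where "D h = (THE v. G h v)" for h
  have D: "G h (D h)" for h unfolding D_def using G_ex G_unique by (metis theI)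
  have D_eqI: "G h v \<Longrightarrow> D h = v" for h v using D G_unique by blast
  have "clinear D" by (intro clinearI D_eqI G_add G_scaleC D)
  moreover have "D l = C l" if "l \<in> L" for l
  proof (rule D_eqI)
    show "G l (C l)" unfolding G_def
    proof (intro allI impI)
      fix e :: real assume "e > 0"
      then show "\<exists>k\<in>L. (\<forall>l'\<in>L. cmod (B (l - k) l') \<le> e * seminorm l') \<and> norm (C k - C l) \<le> e"
        using that by (intro bexI[of _ l]) (auto simp: seminorm_nonneg)
    qed
  qed
  moreover have "D h \<in> closure (C ` L)" for h
    unfolding closure_approachable
  proof (intro allI impI)
    fix e :: real assume "e > 0"
    then have "e / 2 > 0" by simp
    then obtain l where "l \<in> L" "norm (C l - D h) \<le> e / 2" using D[of h] unfolding G_def by blast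
    then show "\<exists>y\<in>C ` L. dist y (D h) < e" using \<open>e > 0\<close> by (intro bexI[of _ "C l"]) (auto simp: dist_norm)
  qed
  ultimately show ?thesis using G_bound[OF D] by blast
qed

end

section \<open>Orthogonal projections\<close>

lemma semi_inner_cinner: "semi_inner (cinner :: 'a::chilbert_space \<Rightarrow> _)"
  by unfold_locales (auto simp: cinner_add_left cinner_scaleC_left cinner_self intro: cinner_commute)

lemma orth_proj_eqI:
  fixes Q :: "'a::chilbert_space set"
  assumes Q: "complex_vector.subspace Q" and g: "g \<in> Q" "\<And>h. h \<in> Q \<Longrightarrow> cinner (f - g) h = 0"
  shows "orth_proj Q f = g"
  unfolding orth_proj_def
proof (rule the_equality)
  show "g \<in> Q \<and> (\<forall>h\<in>Q. cinner (f - g) h = 0)" using g by blast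
  fix g' assume g': "g' \<in> Q \<and> (\<forall>h\<in>Q. cinner (f - g') h = 0)"
  have "g' - g \<in> Q" using g g' by (simp add: complex_vector.subspace_diff[OF Q])
  then have "cinner (f - g) (g' - g) - cinner (f - g') (g' - g) = 0" using g g' by simp
  then have "cinner (g' - g) (g' - g) = 0" by (simp flip: cinner_minus_left)
  then show "g' = g" by (simp add: cinner_self)
qed

text \<open>\<open>contraction_extension\<close>, applied to the identity on \<open>Q\<close> with
  the inner product as form, gives a contraction of the whole space that fixes \<open>Q\<close> and,
  by closedness, takes its values there.\<close>

lemma orth_proj:
  fixes Q :: "'a::chilbert_space set"
  assumes Q: "complex_vector.subspace Q" and cl: "closed Q"
  shows orth_proj_in: "orth_proj Q f \<in> Q"
    and orth_proj_orthogonal: "h \<in> Q \<Longrightarrow> cinner (f - orth_proj Q f) h = 0"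
proof -
  interpret semi_inner "cinner :: 'a \<Rightarrow> 'a \<Rightarrow> complex" by (rule semi_inner_cinner)
  have sn: "seminorm x = norm x" for x by (simp add: seminorm_def cinner_self)
  have "clinear (\<lambda>x::'a. x)" by (rule clinearI) auto
  from contraction_extension[OF Q this] obtain D :: "'a \<Rightarrow> 'a"
    where D: "clinear D" "\<And>l. l \<in> Q \<Longrightarrow> D l = l" "\<And>h. norm (D h) \<le> norm h" "\<And>h. D h \<in> Q"
    using closure_closed[OF cl] by (auto simp: sn)
  \<comment> \<open>A contractive idempotent is an orthogonal projection.\<close>
  have orth: "cinner (f - D f) h = 0" if h: "h \<in> Q" for h
  proof -
    let ?g = "f - D f"
    have Dg: "D ?g = 0" using D(2)[OF D(4)[of f]] by (simp add: clinear_diff[OF D(1)])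
    \<comment> \<open>\<open>D\<close> sends \<open>?g - a h\<close> to \<open>- a h\<close>. At
      \<open>a = s * cinner ?g h\<close> the quadratic terms of the norm comparison cancel, and a
      bound linear in \<open>s\<close> for all \<open>s\<close> forces the coefficient to
      vanish.\<close>
    have le: "2 * s * (cmod (cinner ?g h))\<^sup>2 \<le> (norm ?g)\<^sup>2" for s
    proof -
      define a where "a = of_real s * cinner ?g h"
      have "D (?g - a *\<^sub>C h) = - (a *\<^sub>C h)"
        unfolding clinear_diff[OF D(1), of ?g] clinear_scaleC[OF D(1)] Dg D(2)[OF h] by simp
      then have "cmod a * norm h \<le> norm (?g - a *\<^sub>C h)"
        using D(3)[of "?g - a *\<^sub>C h"] by (simp add: norm_scaleC)
      then have "(cmod a)\<^sup>2 * (norm h)\<^sup>2 \<le> (norm (?g - a *\<^sub>C h))\<^sup>2"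
        by (metis mult_nonneg_nonneg norm_ge_zero power_mono power_mult_distrib)
      also have "\<dots> = (norm ?g)\<^sup>2 - 2 * Re (cnj a * cinner ?g h) + (cmod a)\<^sup>2 * (norm h)\<^sup>2"
        by (simp only: norm_sq_cinner quadratic)
      also have "cnj a * cinner ?g h = of_real (s * (cmod (cinner ?g h))\<^sup>2)"
        unfolding a_def
        by (simp only: complex_cnj_mult complex_cnj_complex_of_real of_real_mult complex_norm_square mult_ac)
      finally show ?thesis by (simp del: of_real_mult)
    qed
    show ?thesis
    proof (rule ccontr)
      assume "\<not> ?thesis"
      then have "(cmod (cinner ?g h))\<^sup>2 > 0" by simp
      then show False using le[of "((norm ?g)\<^sup>2 + 1) / (cmod (cinner ?g h))\<^sup>2"]
        by simp (smt (verit) zero_le_power2)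
    qed
  qed
  have "orth_proj Q f = D f" by (rule orth_proj_eqI[OF Q D(4) orth])
  then show "orth_proj Q f \<in> Q" "h \<in> Q \<Longrightarrow> cinner (f - orth_proj Q f) h = 0"
    using D(4) orth by auto
qed

text \<open>A projection is represented by the map instead of its range, so that enlarged
  projections can be given by a formula and iterated.\<close>

definition projector :: "('a::chilbert_space \<Rightarrow> 'a) \<Rightarrow> bool"
  where "projector P \<longleftrightarrow> clinear P \<and> (\<forall>f. P (P f) = P f) \<and> (\<forall>f g. cinner (P f) g = cinner f (P g))"

lemma projectorD:
  assumes "projector P"
  shows projector_clinear: "clinear P" and projector_idem: "P (P f) = P f"
    and projector_adj: "cinner (P f) g = cinner f (P g)"
  using assms unfolding projector_def by auto

lemma projector_Pythagoras:
  assumes "projector P"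
  shows "(norm f)\<^sup>2 = (norm (P f))\<^sup>2 + (norm (f - P f))\<^sup>2"
proof -
  have "cinner (P f) (f - P f) = 0"
    using projectorD[OF assms] by (simp add: cinner_minus_right)
  from norm_sq_add_orthogonal[OF this] show ?thesis by simp
qed

lemma projector_norm_le:
  assumes "projector P"
  shows "norm (P f) \<le> norm f"
  using projector_Pythagoras[OF assms, of f]
  by (metis le_add_same_cancel1 norm_ge_zero power2_le_imp_le zero_le_power2)

lemma projector_bounded: "projector P \<Longrightarrow> bounded_clinear P"
  by (rule bounded_clinearI[where K = 1]) (auto simp: projector_clinear projector_norm_le)

lemma projector_orth_proj:
  fixes Q :: "'a::chilbert_space set"
  assumes Q: "complex_vector.subspace Q" and cl: "closed Q"
  shows "projector (orth_proj Q)"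
proof -
  note P = orth_proj_in[OF Q cl] and o = orth_proj_orthogonal[OF Q cl]
  have o': "cinner h (f - orth_proj Q f) = 0" if "h \<in> Q" for f h
    using o[OF that, of f] cinner_commute[of h] by simp
  have "clinear (orth_proj Q)"
  proof (intro clinearI orth_proj_eqI[OF Q])
    fix x y h assume h: "h \<in> Q"
    have eq: "x + y - (orth_proj Q x + orth_proj Q y) = (x - orth_proj Q x) + (y - orth_proj Q y)" by simp
    then show "cinner (x + y - (orth_proj Q x + orth_proj Q y)) h = 0"
      unfolding eq cinner_add_left by (simp add: o[OF h])
    show "cinner (a *\<^sub>C x - a *\<^sub>C orth_proj Q x) h = 0" for a
      using o[OF h, of x] by (simp flip: complex_vector.scale_right_diff_distrib add: cinner_scaleC_left)
  qed (auto intro: P complex_vector.subspace_add[OF Q] complex_vector.subspace_scale[OF Q])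
  moreover have "orth_proj Q (orth_proj Q f) = orth_proj Q f" for f
    by (rule orth_proj_eqI[OF Q P]) simp
  moreover have "cinner (orth_proj Q f) g = cinner f (orth_proj Q g)" for f g
    using o[OF P, of f g] o'[OF P, of f g] by (simp add: cinner_minus_left cinner_minus_right)
  ultimately show ?thesis by (simp add: projector_def)
qed

section \<open>Commutant lifting for row isometries\<close>

text \<open>The \<open>S i\<close> are the adjoints of isometries \<open>R i\<close> with pairwise
  orthogonal ranges; equivalently, the row of the \<open>R i\<close> is an isometry on the direct
  sum of copies of the space, as in \<open>norm_sum_R\<close>.\<close>

locale row_isometry =
  fixes R S :: "'d::finite \<Rightarrow> 'h::chilbert_space \<Rightarrow> 'h"
  assumes R_clinear: "clinear (R i)"
    and adj: "cinner (R i f) g = cinner f (S i g)"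
    and SR: "S i (R j f) = (if i = j then f else 0)"
begin

lemma adj': "cinner g (R i f) = cinner (S i g) f"
  by (metis adj cinner_commute)

lemma S_clinear: "clinear (S i)"
proof (rule clinearI)
  show "S i (x + y) = S i x + S i y" for x y
    by (rule cinner_eqI) (simp flip: adj add: cinner_add_right)
  show "S i (a *\<^sub>C x) = a *\<^sub>C S i x" for a x
    by (rule cinner_eqI) (simp flip: adj add: cinner_scaleC_right)
qed

lemmas R_simps = clinear_simps[OF R_clinear]
lemmas S_simps = clinear_simps[OF S_clinear]

lemma S_sum_R: "S i (\<Sum>j\<in>UNIV. R j (g j)) = g i"
  by (simp add: S_simps SR)

lemma norm_sum_R: "(norm (\<Sum>i\<in>UNIV. R i (g i)))\<^sup>2 = (\<Sum>i\<in>UNIV. (norm (g i))\<^sup>2)"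
proof -
  have "cinner (\<Sum>i\<in>UNIV. R i (g i)) (\<Sum>i\<in>UNIV. R i (g i)) = (\<Sum>i\<in>UNIV. cinner (g i) (g i))"
    by (simp add: cinner_sum_left adj S_sum_R)
  then show ?thesis by (simp add: norm_sq_cinner)
qed

text \<open>For a projection \<open>P\<close> with range \<open>Q\<close>, and \<open>E\<close> the
  common kernel of the \<open>S i\<close>, this projects onto the sum of \<open>E\<close> and the
  spaces \<open>R i Q\<close>: it removes from each range of \<open>R i\<close> the part coming from
  the complement of \<open>Q\<close>.\<close>

definition lift_proj :: "('h \<Rightarrow> 'h) \<Rightarrow> 'h \<Rightarrow> 'h"
  where "lift_proj P f = f - (\<Sum>i\<in>UNIV. R i (S i f - P (S i f)))"

definition coinvariant_projector :: "('h \<Rightarrow> 'h) \<Rightarrow> bool"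
  where "coinvariant_projector P \<longleftrightarrow> projector P \<and> (\<forall>i f. P (S i (P f)) = S i (P f))"

text \<open>The last conclusion is the adjoint of the second.\<close>

lemma coinvariant_projectorD:
  assumes "coinvariant_projector P"
  shows "projector P" "P (S i (P f)) = S i (P f)" "P (R i (P f)) = P (R i f)"
proof -
  show P: "projector P" and SP: "P (S i (P f)) = S i (P f)" for i f
    using assms by (auto simp: coinvariant_projector_def)
  show "P (R i (P f)) = P (R i f)"
  proof (rule cinner_eqI)
    fix z show "cinner z (P (R i (P f))) = cinner z (P (R i f))"
      by (simp flip: projector_adj[OF P] add: adj' SP)
  qed
qed

text \<open>Co-invariance makes the correction term vanish on the range of \<open>P\<close>, which
  therefore lies in the lifted range. Each \<open>S i\<close> carries the lifted range into the
  range of \<open>P\<close>, so the lifted range is co-invariant too.\<close>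

lemma lift_proj:
  assumes "coinvariant_projector P"
  shows lift_proj_coinvariant: "coinvariant_projector (lift_proj P)"
    and lift_proj_left: "lift_proj P (P f) = P f"
    and lift_proj_right: "P (lift_proj P f) = P f"
    and lift_proj_R: "lift_proj P (R i f) = R i (P f)"
proof -
  note P = coinvariant_projectorD[OF assms]
  note Pl = clinear_simps[OF projector_clinear[OF P(1)]]
  have S: "S i (lift_proj P f) = P (S i f)" for i f
    by (simp add: lift_proj_def S_simps(3) S_sum_R)
  show left: "lift_proj P (P f) = P f" for f
    by (simp add: lift_proj_def P(2) R_simps(4))
  show "P (lift_proj P f) = P f"
  proof -
    have "P (R i (g - P g)) = 0" for i g using P(3)[of i g] by (simp add: R_simps(3) Pl(3))
    then show ?thesis by (simp add: lift_proj_def Pl)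
  qed
  show "lift_proj P (R i f) = R i (P f)"
  proof -
    have "lift_proj P (R i f) = R i f - (\<Sum>j\<in>UNIV. if j = i then R i (f - P f) else 0)"
      unfolding lift_proj_def by (intro arg_cong2[where f = minus] sum.cong refl) (simp add: SR Pl(4) R_simps(4))
    then show ?thesis by (simp add: R_simps(3))
  qed
  have "projector (lift_proj P)"
    unfolding projector_def
  proof (intro conjI allI)
    show "clinear (lift_proj P)"
      unfolding lift_proj_def
      by (rule clinearI) (simp_all add: S_simps Pl R_simps sum.distrib sum_subtractf complex_vector.scale_sum_right
          complex_vector.scale_right_diff_distrib)
    show "lift_proj P (lift_proj P f) = lift_proj P f" for f
    proof -
      have "lift_proj P (lift_proj P f) = lift_proj P f - (\<Sum>i\<in>UNIV. R i (P (S i f) - P (P (S i f))))"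
        unfolding lift_proj_def[of P "lift_proj P f"] S ..
      then show ?thesis by (simp add: projector_idem[OF P(1)] R_simps(4))
    qed
    show "cinner (lift_proj P f) g = cinner f (lift_proj P g)" for f g
      by (simp add: lift_proj_def cinner_minus_left cinner_minus_right cinner_sum_left cinner_sum_right
          adj adj' projector_adj[OF P(1)])
  qed
  then show "coinvariant_projector (lift_proj P)"
    unfolding coinvariant_projector_def by (simp add: S left)
qed

text \<open>The operators act on the whole space, as \<open>X P\<close> does, so that lifts for
  different projections can be compared.\<close>

definition compressed_intertwiner :: "real \<Rightarrow> ('h \<Rightarrow> 'h) \<Rightarrow> ('h \<Rightarrow> 'h) \<Rightarrow> bool"
  where "compressed_intertwiner c P A \<longleftrightarrow> clinear A \<and> (\<forall>f. P (A f) = A f) \<and>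
    (\<forall>i f. A (R i f) = P (R i (A f))) \<and> (\<forall>f. norm (A f) \<le> c * norm f)"

text \<open>An instance of Parrott's lemma: the lifted operator must be
\<open>\<Sum>i. R i \<circ> A \<circ> S i\<close> on the span of the ranges of the \<open>R i\<close>, and its compression by \<open>P\<close> must
be \<open>A\<close>. The part \<open>C\<close> that is to be added to \<open>A\<close> is on that span a contraction for the form
\<open>c\<^sup>2 \<langle>f, g\<rangle> - \<langle>A f, A g\<rangle>\<close>.\<close>

lemma lift_step:
  assumes P: "coinvariant_projector P" and A: "compressed_intertwiner c P A"
  shows "\<exists>A'. compressed_intertwiner c (lift_proj P) A' \<and> (\<forall>f. P (A' f) = A f) \<and> (\<forall>i f. A' (R i f) = R i (A f))"
proof -
  note Pp = coinvariant_projectorD(1)[OF P]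
  note Pl = clinear_simps[OF projector_clinear[OF Pp]]
  have Al: "clinear A" and PA: "P (A f) = A f" and AR: "A (R i f) = P (R i (A f))"
    and Ac: "norm (A f) \<le> c * norm f" for i f
    using A by (auto simp: compressed_intertwiner_def)
  note As = clinear_simps[OF Al]
  define B where "B f g = of_real (c\<^sup>2) * cinner f g - cinner (A f) (A g)" for f g
  have Bre: "Re (B f f) = (c * norm f)\<^sup>2 - (norm (A f))\<^sup>2" for f
    by (simp add: B_def cinner_self power_mult_distrib)
  interpret B: semi_inner B
  proof
    show "B (x + y) z = B x z + B y z" for x y z
      by (simp add: B_def As cinner_add_left algebra_simps)
    show "B (a *\<^sub>C x) y = a * B x y" for a x y
      by (simp add: B_def As cinner_scaleC_left algebra_simps)
    show "B x y = cnj (B y x)" for x y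
      unfolding B_def by (simp flip: cinner_commute)
    show "Re (B x x) \<ge> 0" for x
      unfolding Bre using power_mono[OF Ac[of x] norm_ge_zero, of 2] by simp
  qed
  \<comment> \<open>\<open>L\<close> is the sum of the ranges of the \<open>R i\<close>,
    \<open>T\<close> is what the lift has to equal there, and \<open>V\<close> is the complement of
    the range of \<open>P\<close> in the lifted range, where the added part has to take its
    values.\<close>
  define L where "L = {f. (\<Sum>i\<in>UNIV. R i (S i f)) = f}"
  define T where "T f = (\<Sum>i\<in>UNIV. R i (A (S i f)))" for f
  define C where "C f = T f - A f" for f
  define V where "V = {v. P v = 0 \<and> lift_proj P v = v}"
  have L: "complex_vector.subspace L"
    unfolding L_def complex_vector.subspace_def
    by (auto simp: S_simps R_simps sum.distrib simp flip: complex_vector.scale_sum_right)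
  have RL: "R i f \<in> L" for i f
  proof -
    have "(\<Sum>j\<in>UNIV. R j (S j (R i f))) = (\<Sum>j\<in>UNIV. if j = i then R i f else 0)"
      by (intro sum.cong refl) (simp add: SR R_simps(4))
    then show ?thesis by (simp add: L_def)
  qed
  have Cl: "clinear C"
    unfolding C_def T_def
    by (rule clinearI) (simp_all add: S_simps R_simps As sum.distrib complex_vector.scale_sum_right
        complex_vector.scale_right_diff_distrib)
  \<comment> \<open>The two prescriptions for the lift are consistent: intertwining turns each
    compressed summand into \<open>A (R i (S i l))\<close>, and these reassemble
    \<open>A l\<close>.\<close>
  have PT: "P (T l) = A l" if "l \<in> L" for l
  proof -
    have "P (T l) = (\<Sum>i\<in>UNIV. A (R i (S i l)))" by (simp add: T_def Pl AR)
    also have "\<dots> = A (\<Sum>i\<in>UNIV. R i (S i l))" by (simp add: As)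
    also have "\<dots> = A l" using that by (simp add: L_def)
    finally show ?thesis .
  qed
  have bound: "norm (C l) \<le> B.seminorm l" if l: "l \<in> L" for l
  proof -
    have "(norm (T l))\<^sup>2 = (\<Sum>i\<in>UNIV. (norm (A (S i l)))\<^sup>2)" unfolding T_def by (rule norm_sum_R)
    also have "\<dots> \<le> (\<Sum>i\<in>UNIV. (c * norm (S i l))\<^sup>2)" by (intro sum_mono power_mono Ac) auto
    also have "\<dots> = c\<^sup>2 * (\<Sum>i\<in>UNIV. (norm (S i l))\<^sup>2)" by (simp add: power_mult_distrib sum_distrib_left)
    also have "\<dots> = (c * norm l)\<^sup>2" using l unfolding norm_sum_R[symmetric] by (simp add: L_def power_mult_distrib)
    \<comment> \<open>As \<open>T l\<close> has norm at most \<open>c * norm l\<close> and projects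
      to \<open>A l\<close>, the Pythagorean identity leaves at most the form \<open>B\<close> at
      \<open>l\<close> for the remainder.\<close>
    finally have "(norm (C l))\<^sup>2 \<le> (B.seminorm l)\<^sup>2"
      using projector_Pythagoras[OF Pp, of "T l"] by (simp add: PT[OF l] C_def B.seminorm_sq Bre)
    then show ?thesis by (rule power2_le_imp_le) (rule B.seminorm_nonneg)
  qed
  obtain D where D: "clinear D" "\<And>l. l \<in> L \<Longrightarrow> D l = C l" "\<And>h. norm (D h) \<le> B.seminorm h"
    "\<And>h. D h \<in> closure (C ` L)"
    using B.contraction_extension[OF L Cl bound] by blast
  have P'p: "projector (lift_proj P)" by (rule coinvariant_projectorD(1)[OF lift_proj_coinvariant[OF P]])
  have P'A: "lift_proj P (A f) = A f" for f
    using lift_proj_left[OF P, of "A f"] by (simp add: PA)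
  have CV: "C l \<in> V" if l: "l \<in> L" for l
  proof -
    have "lift_proj P (T l) = T l"
      unfolding T_def clinear_sum[OF projector_clinear[OF P'p]] by (simp add: lift_proj_R[OF P] PA)
    then show ?thesis
      using PT[OF l] by (simp add: V_def C_def Pl PA P'A clinear_diff[OF projector_clinear[OF P'p]])
  qed
  have cont: "continuous_on UNIV P" "continuous_on UNIV (lift_proj P)"
    using projector_bounded[OF Pp] projector_bounded[OF P'p]
    by (auto simp: bounded_clinear_def linear_continuous_on)
  \<comment> \<open>Membership of the values of \<open>C\<close> on \<open>L\<close> passes to their
    closure, which contains the values of \<open>D\<close>.\<close>
  have "closed V" unfolding V_def by (intro closed_Collect_conj closed_Collect_eq cont continuous_intros)
  then have DV: "D h \<in> V" for h
    using D(4)[of h] closure_minimal[of "C ` L" V] CV by blast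
  define A' where "A' f = A f + D f" for f
  have PA': "P (A' f) = A f" for f using DV[of f] by (simp add: A'_def V_def Pl PA)
  have A'R: "A' (R i f) = R i (A f)" for i f
  proof -
    have "T (R i f) = (\<Sum>j\<in>UNIV. if j = i then R i (A f) else 0)"
      unfolding T_def by (intro sum.cong refl) (simp add: SR As(4) R_simps(4))
    then show ?thesis by (simp add: A'_def D(2)[OF RL] C_def)
  qed
  have "compressed_intertwiner c (lift_proj P) A'"
    unfolding compressed_intertwiner_def
  proof (intro conjI allI)
    show "clinear A'" unfolding A'_def
      by (rule clinearI) (simp_all add: As clinear_simps[OF D(1)] scaleC_add_right)
    show "lift_proj P (A' f) = A' f" for f
      using DV[of f] by (simp add: A'_def V_def P'A clinear_add[OF projector_clinear[OF P'p]])
    show "A' (R i f) = lift_proj P (R i (A' f))" for i f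
      by (simp add: A'R lift_proj_R[OF P] PA')
    show "norm (A' f) \<le> c * norm f" for f
    proof -
      \<comment> \<open>\<open>A f\<close> and \<open>D f\<close> are orthogonal, and
        \<open>B\<close> was chosen so that the bounds on their squared norms add up to
        \<open>(c * norm f)^2\<close>.\<close>
      have "(norm (A' f))\<^sup>2 = (norm (A f))\<^sup>2 + (norm (D f))\<^sup>2"
        using projector_Pythagoras[OF Pp, of "A' f"] unfolding PA' by (simp add: A'_def)
      also have "\<dots> \<le> (norm (A f))\<^sup>2 + (B.seminorm f)\<^sup>2"
        by (intro add_left_mono power_mono D(3)) auto
      also have "\<dots> = (c * norm f)\<^sup>2" by (simp add: B.seminorm_sq Bre)
      finally show ?thesis
        by (rule power2_le_imp_le) (rule order.trans[OF norm_ge_zero Ac])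
    qed
  qed
  then show ?thesis using PA' A'R by blast
qed

text \<open>Iterating \<open>lift_step\<close> gives a bounded martingale: \<open>F n f\<close> is
  the projection of every later \<open>F (n + k) f\<close>, so increments are orthogonal and the
  sequence converges. Commutation is the limit of \<open>F (Suc n) (R i f) = R i (F n f)\<close>,
  where the index shift disappears.\<close>

theorem commutant_lifting:
  assumes P: "coinvariant_projector P" and A: "compressed_intertwiner c P A"
  shows "\<exists>M. clinear M \<and> (\<forall>f. norm (M f) \<le> c * norm f) \<and> (\<forall>f. P (M f) = A f) \<and> (\<forall>i f. M (R i f) = R i (M f))"
proof -
  define Pn where "Pn n = (lift_proj ^^ n) P" for n
  have Pn: "coinvariant_projector (Pn n)" for n
    by (induction n) (simp_all add: Pn_def P lift_proj_coinvariant)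
  have Pn_Suc: "Pn (Suc n) = lift_proj (Pn n)" for n by (simp add: Pn_def)
  define next_op where "next_op P A A' \<longleftrightarrow> (\<forall>f. P (A' f) = A f) \<and> (\<forall>i f. A' (R i f) = R i (A f))" for P A A' :: "'h \<Rightarrow> 'h"
  have "\<exists>F. F 0 = A \<and> (\<forall>n. compressed_intertwiner c (Pn n) (F n)) \<and> (\<forall>n. next_op (Pn n) (F n) (F (Suc n)))"
  proof -
    \<comment> \<open>The clause for \<open>n = 0\<close> makes the dependent choice start at
      \<open>A\<close>.\<close>
    have "\<exists>F. \<forall>n. (compressed_intertwiner c (Pn n) (F n) \<and> (n = 0 \<longrightarrow> F n = A)) \<and> next_op (Pn n) (F n) (F (Suc n))"
    proof (rule dependent_nat_choice[where P = "\<lambda>n x. compressed_intertwiner c (Pn n) x \<and> (n = 0 \<longrightarrow> x = A)"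
          and Q = "\<lambda>n. next_op (Pn n)"])
      show "\<exists>x. compressed_intertwiner c (Pn 0) x \<and> (0 = (0::nat) \<longrightarrow> x = A)" using A by (auto simp: Pn_def)
      show "\<exists>y. (compressed_intertwiner c (Pn (Suc n)) y \<and> (Suc n = 0 \<longrightarrow> y = A)) \<and> next_op (Pn n) x y"
        if "compressed_intertwiner c (Pn n) x \<and> (n = 0 \<longrightarrow> x = A)" for n x
        using lift_step[OF Pn[of n], of c x] that by (auto simp: Pn_Suc next_op_def)
    qed
    then show ?thesis by blast
  qed
  then obtain F where F0: "F 0 = A" and F: "\<And>n. compressed_intertwiner c (Pn n) (F n)"
    and nx: "\<And>n. next_op (Pn n) (F n) (F (Suc n))" by blast
  have PF: "Pn n (F n f) = F n f" and Fl: "clinear (F n)" and Fc: "norm (F n f) \<le> c * norm f" for n f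
    using F[of n] by (auto simp: compressed_intertwiner_def)
  have next_F: "Pn n (F (Suc n) f) = F n f" and FR: "F (Suc n) (R i f) = R i (F n f)" for n f i
    using nx[of n] by (auto simp: next_op_def)
  have PP: "Pn n (Pn (n + k) f) = Pn n f" for n k f
  proof (induction k arbitrary: f)
    case 0
    show ?case by (simp add: projector_idem[OF coinvariant_projectorD(1)[OF Pn]])
  next
    case (Suc k)
    have "Pn n (Pn (n + Suc k) f) = Pn n (Pn (n + k) (Pn (n + Suc k) f))" by (simp only: Suc)
    also have "\<dots> = Pn n (Pn (n + k) f)" by (simp add: Pn_Suc lift_proj_right[OF Pn])
    finally show ?case by (simp only: Suc)
  qed
  have PFk: "Pn n (F (n + k) f) = F n f" for n k f
  proof (induction k)
    case (Suc k)
    have "Pn n (F (n + Suc k) f) = Pn n (Pn (n + k) (F (Suc (n + k)) f))" by (simp add: PP)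
    then show ?case by (simp add: next_F Suc)
  qed (simp add: PF)
  have diff: "(norm (F (n + k) f - F n f))\<^sup>2 = (norm (F (n + k) f))\<^sup>2 - (norm (F n f))\<^sup>2" for n k f
    using projector_Pythagoras[OF coinvariant_projectorD(1)[OF Pn], of "F (n + k) f" n] by (simp add: PFk)
  have "convergent (\<lambda>n. F n f)" for f
  proof -
    \<comment> \<open>By \<open>diff\<close> squared distances are differences of squared norms, so
      convergence of this bounded increasing real sequence makes the vectors Cauchy.\<close>
    define a where "a n = (norm (F n f))\<^sup>2" for n
    have "incseq a"
    proof (rule incseq_SucI)
      show "a n \<le> a (Suc n)" for n
        using diff[of n 1 f] zero_le_power2[of "norm (F (n + 1) f - F n f)"] by (simp add: a_def)
    qed
    moreover have "\<forall>n. a n \<le> (c * norm f)\<^sup>2" unfolding a_def by (intro allI power_mono Fc) auto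
    ultimately have "convergent a" by (metis incseq_convergent convergent_def)
    then have cau: "Cauchy a" by (rule convergent_Cauchy)
    have "Cauchy (\<lambda>n. F n f)"
      unfolding Cauchy_altdef2
    proof (intro allI impI)
      fix e :: real assume e: "e > 0"
      then obtain N where N: "\<forall>n\<ge>N. dist (a n) (a N) < e\<^sup>2"
        using cau unfolding Cauchy_altdef2 by (meson zero_less_power)
      have "dist (F n f) (F N f) < e" if n: "n \<ge> N" for n
      proof -
        obtain k where k: "n = N + k" using n le_Suc_ex by blast
        have "(norm (F n f - F N f))\<^sup>2 = a n - a N" using diff[of N k f] by (simp add: k a_def)
        also have "\<dots> \<le> dist (a n) (a N)" by (simp add: dist_real_def)
        also have "\<dots> < e\<^sup>2" using N n by blast
        finally show ?thesis using e by (simp add: dist_norm power_less_imp_less_base)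
      qed
      then show "\<exists>N. \<forall>n\<ge>N. dist (F n f) (F N f) < e" by blast
    qed
    then show ?thesis by (simp add: Cauchy_convergent_iff)
  qed
  then obtain M where M: "\<And>f. (\<lambda>n. F n f) \<longlonglongrightarrow> M f" unfolding convergent_def by metis
  have lim_bounded: "(\<lambda>n. T (F n f)) \<longlonglongrightarrow> T (M f)" if "bounded_clinear T" for T :: "'h \<Rightarrow> 'h" and f
    using that by (intro bounded_linear.tendsto[OF _ M]) (simp add: bounded_clinear_def)
  have "clinear M"
  proof (rule clinearI)
    fix x y a
    have "(\<lambda>n. F n (x + y)) \<longlonglongrightarrow> M x + M y" unfolding clinear_add[OF Fl] by (intro tendsto_add M)
    then show "M (x + y) = M x + M y" using M LIMSEQ_unique by blast
    have "(\<lambda>n. F n (a *\<^sub>C x)) \<longlonglongrightarrow> a *\<^sub>C M x"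
      unfolding clinear_scaleC[OF Fl] by (rule bounded_linear.tendsto[OF bounded_linear_scaleC M])
    then show "M (a *\<^sub>C x) = a *\<^sub>C M x" using M LIMSEQ_unique by blast
  qed
  moreover have "norm (M f) \<le> c * norm f" for f
    by (rule LIMSEQ_le_const2[OF tendsto_norm[OF M]]) (auto intro: Fc)
  moreover have "P (M f) = A f" for f
  proof -
    have "(\<lambda>n. P (F n f)) \<longlonglongrightarrow> P (M f)"
      by (intro lim_bounded projector_bounded coinvariant_projectorD(1)[OF P])
    moreover have "P (F n f) = A f" for n using PFk[of 0 n f] by (simp add: Pn_def F0)
    ultimately show ?thesis by (simp add: LIMSEQ_const_iff)
  qed
  moreover have "M (R i f) = R i (M f)" for i f
  proof -
    have "norm (R i g) \<le> 1 * norm g" for g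
      by (rule power2_le_imp_le) (simp_all add: norm_sq_cinner adj SR)
    then have "(\<lambda>n. R i (F n f)) \<longlonglongrightarrow> R i (M f)"
      by (intro lim_bounded bounded_clinearI[OF R_clinear])
    then have "(\<lambda>n. F (Suc n) (R i f)) \<longlonglongrightarrow> R i (M f)" unfolding FR .
    then show ?thesis using LIMSEQ_unique LIMSEQ_Suc[OF M] by blast
  qed
  ultimately show ?thesis by blast
qed

end

section \<open>Right shifts and evaluations\<close>

lemma bounded_clinear_compose:
  "bounded_clinear f \<Longrightarrow> bounded_clinear g \<Longrightarrow> bounded_clinear (\<lambda>x. f (g x))"
  by (simp add: bounded_clinear_def bounded_linear_compose)

lemma bounded_clinear_cblin_apply: "bounded_clinear (cblin_apply T)"
  using cblin_apply[of T] by simp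

lemma bounded_clinear_sum:
  assumes "\<And>i. i \<in> I \<Longrightarrow> bounded_clinear (f i)"
  shows "bounded_clinear (\<lambda>x. \<Sum>i\<in>I. f i x)"
  using assms unfolding bounded_clinear_def
  by (auto intro!: bounded_linear_sum simp: complex_vector.scale_sum_right)

lemma cinner_da_has_sum:
  "((\<lambda>\<alpha>. cinner (da_coeff f \<alpha>) (da_coeff g \<alpha>)) has_sum cinner f g) UNIV"
  unfolding cinner_drury_arveson_def da_inner_def by (intro has_sum_infsum cinner_summable da_coeff(1))

text \<open>\<open>cadjoint\<close> is defined by choice, so adjointness needs a proof: pairing with
  a right shift sees only the coefficients at words ending in \<open>i\<close>, and dropping that
  letter reindexes the sum.\<close>

lemma cinner_right_shift: "cinner (right_shift i f) g = cinner f (cadjoint (right_shift i) g)"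
proof -
  have "((\<lambda>\<alpha>. cinner (da_coeff f \<alpha>) (da_coeff (cadjoint (right_shift i) g) \<alpha>)) has_sum cinner (right_shift i f) g) UNIV"
    using cinner_da_has_sum[of "right_shift i f" g]
    by (subst (asm) has_sum_shift[where i = i]) (auto simp: right_shift_coeffs(2) cadjoint_right_shift(2))
  then show ?thesis using cinner_da_has_sum has_sum_unique by blast
qed

lemma clinear_right_shift: "clinear (right_shift i)"
  by (rule clinearI; rule da_eqI) (auto simp: right_shift_coeffs(2) da_coeff_ops)

lemma cadjoint_right_shift_right_shift:
  "cadjoint (right_shift i) (right_shift j f) = (if i = j then f else 0)"
  by (rule da_eqI) (auto simp: right_shift_coeffs(2) cadjoint_right_shift(2) da_coeff_zero)

lemma nc_word_snoc: "Z \<in> nc_tuples n \<Longrightarrow> nc_word Z (\<alpha> @ [i]) = nc_word Z \<alpha> * Z i"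
proof (induction \<alpha>)
  case Nil
  then have "Z i \<in> carrier_mat n n" by (simp add: nc_tuples_def)
  then show ?case by (simp add: nc_dim_eq[OF Nil])
next
  case (Cons j \<alpha>)
  then have "Z i \<in> carrier_mat n n" "Z j \<in> carrier_mat n n" by (simp_all add: nc_tuples_def)
  then show ?case
    using Cons nc_word_carrier[OF Cons.prems, of \<alpha>] by (simp add: assoc_mult_mat[of _ n n _ n _ n])
qed

lemma da_fun_has_sum:
  assumes "n \<ge> 1" "Z \<in> nc_ball_at n" "k < n" "l < n"
  shows "((\<lambda>\<alpha>. nc_word Z \<alpha> $$ (k, l) *\<^sub>C da_coeff f \<alpha>) has_sum da_fun f Z $$ (k, l)) UNIV"
  unfolding da_coeff(2) by (rule nc_series_has_sum[OF da_coeff(1) assms])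

lemma da_fun_carrier: "n \<ge> 1 \<Longrightarrow> Z \<in> nc_ball_at n \<Longrightarrow> da_fun f Z \<in> carrier_mat n n"
  unfolding da_coeff(2) by (rule nc_series_carrier)

text \<open>Appending a letter multiplies every monomial by \<open>Z i\<close> on the right, so the
  right shift multiplies values by \<open>Z i\<close> on the right.\<close>

lemma da_fun_right_shift:
  assumes n: "n \<ge> 1" and Z: "Z \<in> nc_ball_at n" and kl: "k < n" "l < n"
  shows "da_fun (right_shift i f) Z $$ (k, l) = (\<Sum>m<n. Z i $$ (m, l) *\<^sub>C da_fun f Z $$ (k, m))"
proof (rule has_sum_unique)
  have Zt: "Z \<in> nc_tuples n" using Z by (simp add: nc_ball_at_def)
  then have Zi: "Z i \<in> carrier_mat n n" by (simp add: nc_tuples_def)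
  show "((\<lambda>\<alpha>. nc_word Z (\<alpha> @ [i]) $$ (k, l) *\<^sub>C da_coeff f \<alpha>) has_sum da_fun (right_shift i f) Z $$ (k, l)) UNIV"
    using da_fun_has_sum[OF n Z kl, of "right_shift i f"]
    by (subst (asm) has_sum_shift[where i = i]) (auto simp: right_shift_coeffs(2))
  have "((\<lambda>\<alpha>. \<Sum>m<n. Z i $$ (m, l) *\<^sub>C (nc_word Z \<alpha> $$ (k, m) *\<^sub>C da_coeff f \<alpha>))
      has_sum (\<Sum>m<n. Z i $$ (m, l) *\<^sub>C da_fun f Z $$ (k, m))) UNIV"
    by (intro has_sum_sum_fun has_sum_scaleC da_fun_has_sum[OF n Z]) (use kl in auto)
  moreover have "nc_word Z (\<alpha> @ [i]) $$ (k, l) *\<^sub>C da_coeff f \<alpha>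
      = (\<Sum>m<n. Z i $$ (m, l) *\<^sub>C (nc_word Z \<alpha> $$ (k, m) *\<^sub>C da_coeff f \<alpha>))" for \<alpha>
    unfolding nc_word_snoc[OF Zt] mat_mult_index[OF nc_word_carrier[OF Zt] Zi kl]
    by (simp add: complex_vector.scale_sum_left scaleC_scaleC mult.commute)
  ultimately show "((\<lambda>\<alpha>. nc_word Z (\<alpha> @ [i]) $$ (k, l) *\<^sub>C da_coeff f \<alpha>)
      has_sum (\<Sum>m<n. Z i $$ (m, l) *\<^sub>C da_fun f Z $$ (k, m))) UNIV" by simp
qed

text \<open>Entries of monomials are square summable over the words, so Cauchy-Schwarz bounds
  evaluation by their l2 norm. Continuity of evaluations will make sets of agreement closed.\<close>

lemma bounded_clinear_da_fun:
  fixes Z :: "'d::finite \<Rightarrow> complex mat"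
  assumes n: "n \<ge> 1" and Z: "Z \<in> nc_ball_at n" and kl: "k < n" "l < n"
  shows "bounded_clinear (\<lambda>f :: ('d, 'e::chilbert_space) drury_arveson. da_fun f Z $$ (k, l))"
proof (rule bounded_clinearI[where K = "l2n (\<lambda>\<alpha>. nc_word Z \<alpha> $$ (k, l))"])
  note hs = da_fun_has_sum[OF n Z kl]
  show "clinear (\<lambda>f :: ('d, 'e) drury_arveson. da_fun f Z $$ (k, l))"
  proof (rule clinearI)
    fix f g :: "('d, 'e) drury_arveson" and a
    have "((\<lambda>\<alpha>. nc_word Z \<alpha> $$ (k, l) *\<^sub>C da_coeff (f + g) \<alpha>) has_sum da_fun f Z $$ (k, l) + da_fun g Z $$ (k, l)) UNIV"
      unfolding da_coeff_plus scaleC_add_right by (intro has_sum_add hs)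
    then show "da_fun (f + g) Z $$ (k, l) = da_fun f Z $$ (k, l) + da_fun g Z $$ (k, l)"
      by (rule has_sum_unique[OF hs])
    have "((\<lambda>\<alpha>. nc_word Z \<alpha> $$ (k, l) *\<^sub>C da_coeff (a *\<^sub>C f) \<alpha>) has_sum a *\<^sub>C da_fun f Z $$ (k, l)) UNIV"
      using has_sum_scaleC[OF hs[of f], of a] by (simp add: da_coeff_scaleC scaleC_scaleC mult.commute)
    then show "da_fun (a *\<^sub>C f) Z $$ (k, l) = a *\<^sub>C da_fun f Z $$ (k, l)"
      by (rule has_sum_unique[OF hs])
  qed
  fix f :: "('d, 'e) drury_arveson"
  let ?z = "\<lambda>\<alpha>. nc_word Z \<alpha> $$ (k, l)"
  have z: "square_summable ?z" using nc_word_square_summable[OF Z kl] by (simp add: square_summable_def)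
  have abs: "(\<lambda>\<alpha>. norm (?z \<alpha> *\<^sub>C da_coeff f \<alpha>)) summable_on UNIV"
    using abs_summable_prod_l2[of "\<lambda>\<alpha>. norm (?z \<alpha>)" "\<lambda>\<alpha>. norm (da_coeff f \<alpha>)"] z da_coeff(1)[of f]
    by (simp add: square_summable_def norm_scaleC)
  have "norm (da_fun f Z $$ (k, l)) \<le> (\<Sum>\<^sub>\<infinity>\<alpha>. norm (?z \<alpha> *\<^sub>C da_coeff f \<alpha>))"
    using norm_infsum_bound[of "\<lambda>\<alpha>. ?z \<alpha> *\<^sub>C da_coeff f \<alpha>" UNIV] abs infsumI[OF hs[of f]] by simp
  also have "\<dots> \<le> l2n ?z * norm f"
  proof (rule infsum_le_finite_sums[OF abs])
    fix F :: "'d list set" assume F: "finite F"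
    have "(\<Sum>\<alpha>\<in>F. norm (?z \<alpha> *\<^sub>C da_coeff f \<alpha>)) = (\<Sum>\<alpha>\<in>F. \<bar>norm (?z \<alpha>)\<bar> * \<bar>norm (da_coeff f \<alpha>)\<bar>)"
      by (simp add: norm_scaleC)
    also have "\<dots> \<le> L2_set (\<lambda>\<alpha>. norm (?z \<alpha>)) F * L2_set (\<lambda>\<alpha>. norm (da_coeff f \<alpha>)) F"
      by (rule L2_set_mult_ineq)
    also have "\<dots> \<le> l2n ?z * l2n (da_coeff f)"
      by (intro mult_mono l2n_finite z da_coeff(1) F) (auto simp: l2n_def infsum_nonneg)
    finally show "(\<Sum>\<alpha>\<in>F. norm (?z \<alpha> *\<^sub>C da_coeff f \<alpha>)) \<le> l2n ?z * norm f" by (simp add: norm_da_l2n)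
  qed
  finally show "norm (da_fun f Z $$ (k, l)) \<le> l2n ?z * norm f" .
qed

section \<open>Constant functions and the density of their right shifts\<close>

definition da_const :: "'e::chilbert_space \<Rightarrow> ('d::finite, 'e) drury_arveson"
  where "da_const x = Abs_da (nc_series (\<lambda>\<alpha>. if \<alpha> = [] then x else 0))"

lemma has_sum_single: "(\<And>j. j \<noteq> i \<Longrightarrow> f j = 0) \<Longrightarrow> f i = s \<Longrightarrow> (f has_sum s) UNIV"
  by (rule has_sum_finite_neutralI[where B = "{i}"]) auto

lemma da_coeff_const:
  "da_coeff (da_const x :: ('d::finite, 'e::chilbert_space) drury_arveson) = (\<lambda>\<alpha>. if \<alpha> = [] then x else 0)"
  unfolding da_const_def
proof (rule da_coeff_Abs_series)
  show "square_summable (\<lambda>\<alpha>::'d list. if \<alpha> = [] then x else 0)"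
    unfolding square_summable_def
    by (rule has_sum_imp_summable) (rule has_sum_single[of "[]"], simp_all)
qed

lemma da_fun_const:
  assumes "n \<ge> 1" "Z \<in> nc_ball_at n" "k < n" "l < n"
  shows "da_fun (da_const x) Z $$ (k, l) = (if k = l then x else 0)"
proof (rule has_sum_unique[OF da_fun_has_sum[OF assms]])
  have "((\<lambda>\<alpha>. nc_word Z \<alpha> $$ (k, l) *\<^sub>C da_coeff (da_const x) \<alpha>) has_sum
      nc_word Z [] $$ (k, l) *\<^sub>C da_coeff (da_const x) []) UNIV"
    by (rule has_sum_single[of "[]"]) (simp_all add: da_coeff_const)
  then show "((\<lambda>\<alpha>. nc_word Z \<alpha> $$ (k, l) *\<^sub>C da_coeff (da_const x) \<alpha>) has_sum (if k = l then x else 0)) UNIV"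
    using assms by (simp add: nc_ball_at_dim[OF assms(2)] da_coeff_const scaleC_one split: if_splits)
qed

lemma bounded_clinear_da_const: "bounded_clinear (da_const :: 'e::chilbert_space \<Rightarrow> ('d::finite, 'e) drury_arveson)"
proof (rule bounded_clinearI[where K = 1])
  show "clinear (da_const :: 'e \<Rightarrow> ('d, 'e) drury_arveson)" by (rule clinearI; rule da_eqI) (auto simp: da_coeff_ops da_coeff_const)
  fix x :: 'e
  have "((\<lambda>\<alpha>. (norm (da_coeff (da_const x :: ('d, 'e) drury_arveson) \<alpha>))\<^sup>2) has_sum
      (norm (da_coeff (da_const x :: ('d, 'e) drury_arveson) []))\<^sup>2) UNIV"
    by (rule has_sum_single[of "[]"]) (simp_all add: da_coeff_const)
  from infsumI[OF this] show "norm (da_const x :: ('d, 'e) drury_arveson) \<le> 1 * norm x"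
    unfolding norm_da_l2n l2n_def by (simp add: da_coeff_const)
qed

text \<open>Repeated right shifts of constants produce all monomials, and a vector orthogonal to
  every monomial has zero coefficients.\<close>

lemma shift_invariant_subspace_eq_UNIV:
  fixes D :: "('d::finite, 'e::chilbert_space) drury_arveson set"
  assumes D: "complex_vector.subspace D" "closed D"
    and const: "\<And>x. da_const x \<in> D" and shift: "\<And>i f. f \<in> D \<Longrightarrow> right_shift i f \<in> D"
  shows "D = UNIV"
proof -
  have mono: "\<exists>m\<in>D. da_coeff m = (\<lambda>\<alpha>. if \<alpha> = \<beta> then x else 0)" for \<beta> x
  proof (induction \<beta> rule: rev_induct)
    case Nil
    show ?case using const[of x] da_coeff_const[of x] by blast
  next
    case (snoc i \<beta>)
    then obtain m where m: "m \<in> D" "da_coeff m = (\<lambda>\<alpha>. if \<alpha> = \<beta> then x else 0)" by blast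
    have "da_coeff (right_shift i m) \<alpha> = (if \<alpha> = \<beta> @ [i] then x else 0)" for \<alpha>
      by (cases \<alpha> rule: rev_cases) (auto simp: right_shift_coeffs(2) m(2))
    then show ?case using shift[OF m(1), of i] by blast
  qed
  have "f \<in> D" for f
  proof -
    define g where "g = f - orth_proj D f"
    have "da_coeff g \<beta> = 0" for \<beta>
    proof -
      \<comment> \<open>The monomial carries the coefficient of \<open>g\<close> itself, so pairing
        it with \<open>g\<close> gives the squared norm of that coefficient.\<close>
      obtain m where m: "m \<in> D" "da_coeff m = (\<lambda>\<alpha>. if \<alpha> = \<beta> then da_coeff g \<beta> else 0)" using mono by blast
      have "((\<lambda>\<alpha>. cinner (da_coeff g \<alpha>) (da_coeff m \<alpha>)) has_sum cinner (da_coeff g \<beta>) (da_coeff m \<beta>)) UNIV"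
        by (rule has_sum_single[of \<beta>]) (simp_all add: m(2))
      then have "cinner (da_coeff g \<beta>) (da_coeff m \<beta>) = cinner g m"
        using cinner_da_has_sum has_sum_unique by blast
      also have "\<dots> = 0" unfolding g_def by (rule orth_proj_orthogonal[OF D m(1)])
      finally show ?thesis by (simp add: m(2) cinner_self)
    qed
    then have "g = 0" by (intro da_eqI) (auto simp: da_coeff_zero)
    then show ?thesis using orth_proj_in[OF D, of f] by (simp add: g_def)
  qed
  then show ?thesis by blast
qed

section \<open>Symbols of operators commuting with the right shifts\<close>

definition symbol :: "(('d::finite, 'e::chilbert_space) drury_arveson \<Rightarrow> ('d, 'e) drury_arveson)
    \<Rightarrow> ('d \<Rightarrow> complex mat) \<Rightarrow> ('e, 'e) cblin mat"
  where "symbol M = (\<lambda>Z\<in>nc_ball. Matrix.mat (nc_dim Z) (nc_dim Z)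
    (\<lambda>(k, l). Cblin (\<lambda>x. da_fun (M (da_const x)) Z $$ (k, l))))"

lemma symbol_carrier: "n \<ge> 1 \<Longrightarrow> Z \<in> nc_ball_at n \<Longrightarrow> symbol M Z \<in> carrier_mat n n"
  using nc_ball_at_ball[of n Z] by (simp add: symbol_def nc_ball_at_dim)

text \<open>For bounded \<open>M\<close> the entry is a composition of bounded complex linear maps
  in \<open>x\<close>, so \<open>Cblin\<close> wraps it faithfully.\<close>

lemma symbol_apply:
  assumes M: "bounded_clinear M" and n: "n \<ge> 1" and Z: "Z \<in> nc_ball_at n" and kl: "k < n" "l < n"
  shows "cblin_apply (symbol M Z $$ (k, l)) x = da_fun (M (da_const x)) Z $$ (k, l)"
proof -
  have "bounded_clinear (\<lambda>x. da_fun (M (da_const x)) Z $$ (k, l))"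
    by (intro bounded_clinear_compose[OF bounded_clinear_da_fun[OF n Z kl]]
        bounded_clinear_compose[OF M] bounded_clinear_da_const)
  then show ?thesis
    using nc_ball_at_ball[OF n Z] kl by (simp add: symbol_def nc_ball_at_dim[OF Z] Cblin_inverse)
qed

lemma cblin_apply_0: "cblin_apply 0 x = 0" by transfer simp

lemma cblin_apply_sum_scaleC:
  "cblin_apply (\<Sum>i\<in>I. a i *\<^sub>C T i) x = (\<Sum>i\<in>I. a i *\<^sub>C cblin_apply (T i) x)"
proof (induction I rule: infinite_finite_induct)
  case (insert i I)
  then show ?case by (simp add: plus_cblin.rep_eq scaleC_cblin.rep_eq)
qed (auto simp: cblin_apply_0)

lemma cblin_eqI: "(\<And>x. cblin_apply S x = cblin_apply T x) \<Longrightarrow> S = T"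
  by (simp add: cblin_apply_inject[symmetric] fun_eq_iff)

text \<open>The nc conditions are linear in the entries and operators can be compared on vectors, so
  the conditions pass from the functions \<open>g x\<close> to \<open>F\<close>.\<close>

lemma nc_function_pointwise:
  fixes F :: "('d::finite \<Rightarrow> complex mat) \<Rightarrow> ('a::complex_normed_vector, 'b::complex_normed_vector) cblin mat"
  assumes ext: "F \<in> extensional nc_ball" and car: "\<And>n X. n \<ge> 1 \<Longrightarrow> X \<in> nc_ball_at n \<Longrightarrow> F X \<in> carrier_mat n n"
    and g: "\<And>x. nc_function (g x)"
    and gF: "\<And>x n X k l. n \<ge> 1 \<Longrightarrow> X \<in> nc_ball_at n \<Longrightarrow> k < n \<Longrightarrow> l < n \<Longrightarrow> g x X $$ (k, l) = cblin_apply (F X $$ (k, l)) x"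
  shows "nc_function F"
  unfolding nc_function_def
proof (intro conjI ballI allI impI ext car)
  have gcar: "g x X \<in> carrier_mat n n" if "n \<ge> 1" "X \<in> nc_ball_at n" for x n X
    using g[of x] that unfolding nc_function_def by blast
  fix X Y :: "'d \<Rightarrow> complex mat" assume XY: "X \<in> nc_ball" "Y \<in> nc_ball"
  obtain n where n: "n \<ge> 1" "X \<in> nc_ball_at n" using XY(1) by (rule nc_ballE)
  obtain m where m: "m \<ge> 1" "Y \<in> nc_ball_at m" using XY(2) by (rule nc_ballE)
  let ?W = "\<lambda>j. mat_dsum (X j) (Y j)"
  have W: "?W \<in> nc_ball_at (n + m)" by (rule nc_dsum_ball[OF n(2) m(2)])
  have nm: "n + m \<ge> 1" using n by simp
  note D = mat_dsum_carrier[OF car[OF n] car[OF m]]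
  show "F ?W = mat_dsum (F X) (F Y)"
  proof (rule eq_matI)
    fix k l assume "k < dim_row (mat_dsum (F X) (F Y))" "l < dim_col (mat_dsum (F X) (F Y))"
    then have kl: "k < n + m" "l < n + m" using D by auto
    show "F ?W $$ (k, l) = mat_dsum (F X) (F Y) $$ (k, l)"
    proof (rule cblin_eqI)
      fix x
      have "g x ?W = mat_dsum (g x X) (g x Y)" using g[of x] XY unfolding nc_function_def by blast
      then have "cblin_apply (F ?W $$ (k, l)) x = mat_dsum (g x X) (g x Y) $$ (k, l)"
        using gF[OF nm W kl, of x] by simp
      also have "\<dots> = cblin_apply (mat_dsum (F X) (F Y) $$ (k, l)) x"
        using kl unfolding mat_dsum_index[OF gcar[OF n] gcar[OF m] kl] mat_dsum_index[OF car[OF n] car[OF m] kl]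
        by (auto simp: gF[OF n] gF[OF m] cblin_apply_0)
      finally show "cblin_apply (F ?W $$ (k, l)) x = cblin_apply (mat_dsum (F X) (F Y) $$ (k, l)) x" .
    qed
  qed (use D car[OF nm W] in auto)
next
  have gcar: "g x X \<in> carrier_mat n n" if "n \<ge> 1" "X \<in> nc_ball_at n" for x n X
    using g[of x] that unfolding nc_function_def by blast
  fix n and X :: "'d \<Rightarrow> complex mat" and S T :: "complex mat"
  assume n: "1 \<le> n" and X: "X \<in> nc_ball_at n" and S: "S \<in> carrier_mat n n" and T: "T \<in> carrier_mat n n"
    and inv: "S * T = 1\<^sub>m n" "T * S = 1\<^sub>m n" and W: "(\<lambda>j. T * X j * S) \<in> nc_ball_at n"
  let ?W = "\<lambda>j. T * X j * S"
  note FX = car[OF n X] and FW = car[OF n W]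
  show "F ?W = scalar_mat_mult T (mat_scalar_mult (F X) S)"
  proof (rule eq_matI)
    fix k l assume "k < dim_row (scalar_mat_mult T (mat_scalar_mult (F X) S))"
      "l < dim_col (scalar_mat_mult T (mat_scalar_mult (F X) S))"
    then have kl: "k < n" "l < n" using S T by (auto simp: scalar_mat_mult_def mat_scalar_mult_def)
    have entry: "scalar_mat_mult T (mat_scalar_mult A S) $$ (k, l)
        = (\<Sum>a<n. T $$ (k, a) *\<^sub>C (\<Sum>b<n. S $$ (b, l) *\<^sub>C A $$ (a, b)))"
      if "A \<in> carrier_mat n n" for A :: "'v::complex_vector mat"
      using kl S T that by (simp add: scalar_mat_mult_def mat_scalar_mult_def)
    show "F ?W $$ (k, l) = scalar_mat_mult T (mat_scalar_mult (F X) S) $$ (k, l)"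
    proof (rule cblin_eqI)
      fix x
      have "g x ?W = scalar_mat_mult T (mat_scalar_mult (g x X) S)"
        using g[of x] n X S T inv W unfolding nc_function_def by blast
      then have "cblin_apply (F ?W $$ (k, l)) x = scalar_mat_mult T (mat_scalar_mult (g x X) S) $$ (k, l)"
        using gF[OF n W kl, of x] by simp
      also have "\<dots> = (\<Sum>a<n. T $$ (k, a) *\<^sub>C (\<Sum>b<n. S $$ (b, l) *\<^sub>C cblin_apply (F X $$ (a, b)) x))"
        unfolding entry[OF gcar[OF n X]] by (simp add: gF[OF n X])
      also have "\<dots> = cblin_apply (scalar_mat_mult T (mat_scalar_mult (F X) S) $$ (k, l)) x"
        unfolding entry[OF FX] cblin_apply_sum_scaleC ..
      finally show "cblin_apply (F ?W $$ (k, l)) x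
          = cblin_apply (scalar_mat_mult T (mat_scalar_mult (F X) S) $$ (k, l)) x" .
    qed
  qed (use S T FX FW in \<open>auto simp: scalar_mat_mult_def mat_scalar_mult_def\<close>)
qed

lemma nc_function_symbol:
  assumes M: "bounded_clinear M"
  shows "nc_function (symbol M)"
proof (rule nc_function_pointwise[where g = "\<lambda>x. da_fun (M (da_const x))"])
  show "symbol M \<in> extensional nc_ball" by (simp add: symbol_def)
  show "nc_function (da_fun (M (da_const x)))" for x using da_fun by blast
qed (simp_all only: symbol_carrier symbol_apply[OF M])

text \<open>Both sides are bounded and linear in \<open>f\<close>, so it suffices to compare them on
  constants, where the symbol is so defined, and to see that agreement survives right shifts. It
  does because shifts act from the right and the symbol from the left.\<close>

lemma mult_fun_symbol:
  fixes M :: "('d::finite, 'e::chilbert_space) drury_arveson \<Rightarrow> ('d, 'e) drury_arveson"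
  assumes M: "bounded_clinear M" and comm: "\<And>i f. M (right_shift i f) = right_shift i (M f)"
  shows "mult_fun (symbol M) f = da_fun (M f)"
proof (rule extensionalityI[of _ nc_ball])
  show "mult_fun (symbol M) f \<in> extensional nc_ball" by (simp add: mult_fun_def)
  show "da_fun (M f) \<in> extensional nc_ball" unfolding da_coeff(2) by (simp add: nc_series_def)
  fix Z :: "'d \<Rightarrow> complex mat" assume Zb: "Z \<in> nc_ball"
  obtain n where n: "n \<ge> 1" and Z: "Z \<in> nc_ball_at n" using Zb by (rule nc_ballE)
  have eq: "(\<Sum>m<n. cblin_apply (symbol M Z $$ (k, m)) (da_fun f Z $$ (m, l))) = da_fun (M f) Z $$ (k, l)"
    if k: "k < n" and l: "l < n" for k l
  proof -
    define u where "u l f = (\<Sum>m<n. cblin_apply (symbol M Z $$ (k, m)) (da_fun f Z $$ (m, l)))" for l f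
    define v where "v l f = da_fun (M f) Z $$ (k, l)" for l f
    have u: "bounded_clinear (u l)" if "l < n" for l
      unfolding u_def
      by (intro bounded_clinear_sum bounded_clinear_compose[OF bounded_clinear_cblin_apply]
          bounded_clinear_da_fun[OF n Z] that) auto
    have v: "bounded_clinear (v l)" if "l < n" for l
      unfolding v_def by (rule bounded_clinear_compose[OF bounded_clinear_da_fun[OF n Z k that] M])
    \<comment> \<open>All columns are treated together, since column \<open>l\<close> after a right
      shift combines all columns before it.\<close>
    define D where "D = (\<Inter>l\<in>{..<n}. {f. u l f = v l f})"
    have cont: "continuous_on UNIV w" if "bounded_clinear w" for w :: "('d, 'e) drury_arveson \<Rightarrow> 'e"
      using that by (auto simp: bounded_clinear_def linear_continuous_on)
    have "D = UNIV"
    proof (rule shift_invariant_subspace_eq_UNIV)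
      show "closed D" unfolding D_def by (intro closed_INT ballI closed_Collect_eq cont u v) auto
      show "complex_vector.subspace D"
        unfolding complex_vector.subspace_def D_def
        by (auto simp: clinear_simps[OF bounded_clinear_clinear[OF u]] clinear_simps[OF bounded_clinear_clinear[OF v]])
      show "da_const x \<in> D" for x
      proof -
        have "u l (da_const x) = v l (da_const x)" if l: "l < n" for l
        proof -
          \<comment> \<open>A constant has \<open>x\<close> on the diagonal and 0 elsewhere, so only
            \<open>m = l\<close> survives.\<close>
          have "u l (da_const x) = (\<Sum>m<n. if m = l then v l (da_const x) else 0)"
            unfolding u_def v_def using l k
            by (intro sum.cong refl) (auto simp: da_fun_const[OF n Z] symbol_apply[OF M n Z]
                clinear_0[OF bounded_clinear_clinear[OF bounded_clinear_da_const]]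
                clinear_0[OF bounded_clinear_clinear[OF M]]
                clinear_0[OF bounded_clinear_clinear[OF bounded_clinear_da_fun[OF n Z]]])
          then show ?thesis using l by simp
        qed
        then show ?thesis by (simp add: D_def)
      qed
      show "right_shift i f \<in> D" if f: "f \<in> D" for i f
      proof -
        have "u l (right_shift i f) = v l (right_shift i f)" if l: "l < n" for l
        proof -
          note T = clinear_simps[OF bounded_clinear_clinear[OF bounded_clinear_cblin_apply]]
          have "u l (right_shift i f) = (\<Sum>m<n. \<Sum>p<n. Z i $$ (p, l) *\<^sub>C cblin_apply (symbol M Z $$ (k, m)) (da_fun f Z $$ (m, p)))"
            unfolding u_def by (intro sum.cong refl) (simp add: da_fun_right_shift[OF n Z _ l] T)
          also have "\<dots> = (\<Sum>p<n. Z i $$ (p, l) *\<^sub>C u p f)"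
            unfolding u_def complex_vector.scale_sum_right by (rule sum.swap)
          also have "\<dots> = (\<Sum>p<n. Z i $$ (p, l) *\<^sub>C v p f)" using f by (simp add: D_def)
          also have "\<dots> = v l (right_shift i f)"
            unfolding v_def comm da_fun_right_shift[OF n Z k l] ..
          finally show ?thesis .
        qed
        then show ?thesis by (simp add: D_def)
      qed
    qed
    then show ?thesis using l by (auto simp: D_def u_def v_def)
  qed
  have "cblin_mat_mult (symbol M Z) (da_fun f Z) = da_fun (M f) Z"
    using symbol_carrier[OF n Z, of M] da_fun_carrier[OF n Z, of f] da_fun_carrier[OF n Z, of "M f"]
    by (intro eq_matI) (auto simp: cblin_mat_mult_def eq)
  then show "mult_fun (symbol M) f Z = da_fun (M f) Z" using Zb by (simp add: mult_fun_def)
qed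

lemma symbol_left_multiplier:
  assumes "bounded_clinear M" "\<And>i f. M (right_shift i f) = right_shift i (M f)"
  shows "symbol M \<in> left_multipliers" and "mult_op (symbol M) = M"
proof -
  note eq = mult_fun_symbol[OF assms]
  show "symbol M \<in> left_multipliers"
    by (simp add: left_multipliers_def nc_function_symbol[OF assms(1)] eq)
  show "mult_op (symbol M) = M" by (simp add: fun_eq_iff mult_op_def eq da_fun_inverse)
qed

section \<open>Commutant lifting on the nc Drury-Arveson space\<close>

theorem theorem5p3:
  fixes Q :: "('d::finite, 'e::chilbert_space) drury_arveson set"
    and X :: "('d, 'e) drury_arveson \<Rightarrow> ('d, 'e) drury_arveson"
  assumes "complex_vector.subspace Q" and "closed Q"
    and "right_shift_coinvariant Q"
    and "X \<in> bounded_ops_on Q" and "onorm_on Q X \<le> 1"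
    and "\<And>i f. f \<in> Q \<Longrightarrow> X (orth_proj Q (right_shift i f)) = orth_proj Q (right_shift i (X f))"
  shows "\<exists>\<Phi> :: ('d \<Rightarrow> complex mat) \<Rightarrow> ('e, 'e) cblin mat.
    \<Phi> \<in> left_multipliers \<and>
    bounded_clinear (mult_op \<Phi>) \<and>
    onorm (mult_op \<Phi>) = onorm_on Q X \<and>
    (\<forall>f\<in>Q. X f = orth_proj Q (mult_op \<Phi> f))"
proof -
  let ?P = "orth_proj Q" and ?c = "onorm_on Q X"
  \<comment> \<open>Only the values of \<open>X\<close> on \<open>Q\<close> have a meaning, so it is
    extended by zero on the orthogonal complement.\<close>
  define A where "A f = X (?P f)" for f
  have X: "f \<in> Q \<Longrightarrow> X f \<in> Q" "f \<in> Q \<Longrightarrow> g \<in> Q \<Longrightarrow> X (f + g) = X f + X g"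
    "f \<in> Q \<Longrightarrow> X (a *\<^sub>C f) = a *\<^sub>C X f" for f g a
    using assms(4) by (auto simp: bounded_ops_on_def)
  obtain K where K: "\<And>f. f \<in> Q \<Longrightarrow> norm (X f) \<le> K * norm f"
    using assms(4) unfolding bounded_ops_on_def by blast
  have Q0: "0 \<in> Q" by (rule complex_vector.subspace_0[OF assms(1)])
  have X0: "X 0 = 0" using X(3)[OF Q0, of 0] by simp
  have bdd: "bdd_above ((\<lambda>f. norm (X f) / norm f) ` Q)"
  \<comment> \<open>At \<open>f = 0\<close> the quotient is 0 by the convention for division, while
    \<open>K\<close> may be negative if \<open>Q\<close> is zero.\<close>
  proof (rule bdd_aboveI2[where M = "max K 0"])
    fix f assume f: "f \<in> Q"
    show "norm (X f) / norm f \<le> max K 0"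
    proof (cases "f = 0")
      case False
      then have "norm (X f) / norm f \<le> K" using K[OF f] by (simp add: divide_le_eq)
      then show ?thesis by simp
    qed simp
  qed
  have Xc: "norm (X f) \<le> ?c * norm f" if f: "f \<in> Q" for f
  proof (cases "f = 0")
    case False
    have "norm (X f) / norm f \<le> ?c" unfolding onorm_on_def by (rule cSUP_upper[OF f bdd])
    then show ?thesis using False by (simp add: divide_le_eq)
  qed (simp add: X0)
  have c0: "?c \<ge> 0"
    using cSUP_upper[OF Q0 bdd] by (simp add: onorm_on_def)
  have Pp: "projector ?P" by (rule projector_orth_proj[OF assms(1,2)])
  note PQ = orth_proj_in[OF assms(1,2)]
  have Pid: "?P f = f" if "f \<in> Q" for f by (rule orth_proj_eqI[OF assms(1) that]) simp
  interpret row_isometry right_shift "\<lambda>i. cadjoint (right_shift i) :: ('d, 'e) drury_arveson \<Rightarrow> _"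
    by (rule row_isometry.intro[OF clinear_right_shift cinner_right_shift cadjoint_right_shift_right_shift])
  have P: "coinvariant_projector ?P"
    unfolding coinvariant_projector_def
    using Pp PQ assms(3) by (auto simp: right_shift_coinvariant_def intro!: Pid)
  have "compressed_intertwiner ?c ?P A"
    unfolding compressed_intertwiner_def
  proof (intro conjI allI)
    show "clinear A"
      unfolding A_def by (rule clinearI) (simp_all add: clinear_simps[OF projector_clinear[OF Pp]] X PQ)
    show "?P (A f) = A f" for f unfolding A_def by (intro Pid X(1) PQ)
    show "A (right_shift i f) = ?P (right_shift i (A f))" for i f
      \<comment> \<open>The commutation hypothesis at \<open>?P f\<close> moves \<open>X\<close>
        outside, and co-invariance then removes the inner \<open>?P\<close>.\<close>
      unfolding A_def assms(6)[OF PQ, symmetric] coinvariant_projectorD(3)[OF P] ..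
    show "norm (A f) \<le> ?c * norm f" for f
      unfolding A_def
      by (rule order.trans[OF Xc[OF PQ] mult_left_mono[OF projector_norm_le[OF Pp] c0]])
  qed
  from commutant_lifting[OF P this] obtain M
    where M: "clinear M" "\<And>f. norm (M f) \<le> ?c * norm f" "\<And>f. ?P (M f) = A f"
      "\<And>i f. M (right_shift i f) = right_shift i (M f)" by blast
  have bM: "bounded_clinear M" by (rule bounded_clinearI[OF M(1,2)])
  have XM: "X f = ?P (M f)" if "f \<in> Q" for f using that by (simp add: M(3) A_def Pid)
  have "onorm M = ?c"
  proof (rule antisym)
    show "onorm M \<le> ?c" by (rule onorm_bound[OF c0 M(2)])
    have bl: "bounded_linear M" using bM by (simp add: bounded_clinear_def)
    \<comment> \<open>\<open>X\<close> is a compression of \<open>M\<close>, so its norm cannot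
      exceed that of \<open>M\<close>.\<close>
    show "?c \<le> onorm M"
      unfolding onorm_on_def
    proof (rule cSUP_least)
      fix f assume f: "f \<in> Q"
      have "norm (X f) \<le> onorm M * norm f"
        unfolding XM[OF f] by (rule order.trans[OF projector_norm_le[OF Pp] onorm[OF bl]])
      then show "norm (X f) / norm f \<le> onorm M"
        using onorm_pos_le[OF bl] by (cases "f = 0") (simp_all add: divide_le_eq)
    qed (use Q0 in blast)
  qed
  then show ?thesis
    using symbol_left_multiplier[OF bM M(4)] bM XM by (intro exI[of _ "symbol M"]) simp
qed

end
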